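(* Consider the bilevel problem $\min_{x}\Phi(x)=f(x,y^*(x))$, $y^*(x)=\arg\min_y g(x,y)$, and suppose Assumptions A1, A2, A3, A4 of the context hold. Let $T$ and $J$ be any positive integers. Run ALS-SPIDER (the algorithm of the context with $\tau^x=\tau^y=\tau^v=0$) with $S_2=q_1$, $0<\beta<1$, $0<\eta<1$, and, with $r=S_2/q_1$, $C_3=J^2+J^2M^2+2T^2$, $$\lambda_1=\min\Big\{\tfrac{1}{2L_g+2\mu},\ \tfrac{(1/2)^{2T+5}\mu r}{T L_g^2\beta^2C_3}\Big\},\qquad \lambda_2=\min\Big\{\tfrac{1}{2L_g+2\mu},\ \tfrac{\mu^2\lambda_1\beta}{128\bar M_1J\eta},\ \tfrac{(1/2)^{2(T+J)+6}\mu r}{J(L_g^2\eta^2+T\bar M_1\beta\eta)}\Big\},$$ $$\alpha=\min\Big\{\tfrac{\mu\lambda_1\beta}{96C_y^2+8\bar M_1},\ \tfrac{\mu\lambda_2\eta}{48(L_g^2+C_v^2)},\ \tfrac{1}{6L_\Phi},\ \tfrac{\sqrt r}{12\sqrt{\bar M_1}},\ \tfrac{\mu}{C_4},\ \tfrac{\mu}{C_5},\ \tfrac{(1/2)^{2(T+J)+3}r}{\bar M_1T\beta+L_g^2\eta}\Big\},$$ where $C_4=192\lambda_1\beta L_g^2(1+r^{-1}C_3)$ and $C_5=192\lambda_2\eta\bar M_1(1+C_y^2+r^{-1}J)$. Then, with suitable choices $K=O(\epsilon^{-1})$, $S_1=O(\epsilon^{-1})$ and $S_2=q_1=S_1^{1/2}$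 $(=O(\epsilon^{-0.5}))$, ALS-SPIDER finds an $\epsilon$-stationary point of the bilevel problem with a sample complexity of $O(\epsilon^{-1.5})$.
   Context: Problem. $f(x,y)=\mathbb{E}_\xi[F(x,y;\xi)]$ and $g(x,y)=\mathbb{E}_\zeta[G(x,y;\zeta)]$ for $x\in\mathbb{R}^p$, $y\in\mathbb{R}^q$; $y^*(x)=\arg\min_{y\in\mathbb{R}^q}g(x,y)$; $\Phi(x)=f(x,y^*(x))$. $\|\cdot\|$ is the Euclidean norm for vectors and the spectral norm for matrices. $\nabla_x\nabla_y g$ is the Jacobian of $\nabla_x g$ with respect to $y$, $\nabla_y^2 g$ the Hessian in $y$. $\epsilon$-stationary point and complexity. A (random) point $\bar x$ is an $\epsilon$-stationary point if $\mathbb{E}\|\nabla\Phi(\bar x)\|^2\le\epsilon$. The output of the algorithm is $\bar x$ chosen uniformly at random from $\{x_0,\dots,x_{K-1}\}$. Sample complexity is the total number of evaluations of the stochastic gradients $\nabla_xF(x,y;\xi)$, $\nabla_yF(x,y;\xi)$, $\nabla_yG(x,y;\zeta)$, stochastic Jacobian-vector products $\nabla_x\nabla_yG(x,y;\zeta)v$ and stochastic Hessian-vector products $\nabla_y^2G(x,y;\zeta)v$. The $O(\cdot)$ is as $\epsilon\to0$, with constants independent of $\epsilon$. Assumption A1. For every $\xi,\zeta$: $f$, $F(\cdot,\cdot;\xi)$ are continuously differentiable and $g$, $G(\cdot,\cdot;\zeta)$ twice continuously differentiable on $\mathbb{R}^p\times\mathbb{R}^q$; for every $x,\zeta$, $g(x,\cdot)$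 and $G(x,\cdot;\zeta)$ are $\mu$-strongly convex ($\mu>0$); $\Phi$ is nonconvex and $\inf_x\Phi(x)>-\infty$. Assumption A2. (a) $f$ and $\nabla f$ are Lipschitz in $(x,y)$ with constants $C_f$ and $L_f$. (b) $\nabla g$, $\nabla_x\nabla_yg$, $\nabla_y^2g$ are Lipschitz in $(x,y)$ with constants $L_g$, $L_{gxy}$, $L_{gyy}$. Assumption A3. $\nabla F(x,y;\xi)$, $\nabla G(x,y;\zeta)$, $\nabla_x\nabla_yG(x,y;\zeta)$, $\nabla_y^2G(x,y;\zeta)$ are unbiased estimates of $\nabla f$, $\nabla g$, $\nabla_x\nabla_yg$, $\nabla_y^2g$ at $(x,y)$, and $\mathbb{E}\|\nabla F-\nabla f\|^2\le\sigma_f^2$, $\mathbb{E}\|\nabla G-\nabla g\|^2\le\sigma_g^2$, $\mathbb{E}\|\nabla_x\nabla_yG-\nabla_x\nabla_yg\|^2\le\sigma_{gxy}^2$, $\mathbb{E}\|\nabla_y^2G-\nabla_y^2g\|^2\le\sigma_{gyy}^2$ for all $(x,y)$. Assumption A4. For all $\xi,\zeta$, $F(\cdot,\cdot;\xi)$ and $G(\cdot,\cdot;\zeta)$ satisfy the same conditions as $f$ and $g$ in A2 (same constants). Constants. $M\ge C_f/\mu$ is fixed, $\Omega=\{v\in\mathbb{R}^q:\|v\|\le M\}$, $L_{gg}=\max\{L_{gxy},L_{gyy}\}$, $\bar M_1=4L_f^2+4M^2L_{gg}^2$, $C_y=L_g/\mu$, $C_v=\big(\frac{L_f}{\mu}+\frac{C_fL_{gg}}{\mu^2}\big)\big(1+\frac{L_g}{\mu}\big)$,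 and $L_\Phi=L_f+\frac{2L_fL_g+C_fL_{gg}}{\mu}+\frac{L_fL_g^2+2C_fL_gL_{gg}}{\mu^2}+\frac{C_fL_g^2L_{gg}}{\mu^3}$ (a Lipschitz constant of $\nabla\Phi$). Directions. $D_y(x,y)=\nabla_yg(x,y)$, $D_v(x,y,v)=\nabla_y^2g(x,y)v-\nabla_yf(x,y)$, $D_x(x,y,v)=\nabla_xf(x,y)-\nabla_x\nabla_yg(x,y)v$. A single-sample version replaces $f,g$ by $F(\cdot;\xi_i),G(\cdot;\zeta_i)$ with $\xi_i,\zeta_i$ fresh samples of $\xi,\zeta$ (for $D_y$ only $\zeta_i$); for a sample set $\mathcal S$, $D_\bullet(\cdot;\mathcal S)$ is the average of the single-sample versions over $\mathcal S$. Algorithm (parameters: positive integers $K,T,J,q_1,S_1,S_2$; stepsizes $\lambda_1,\lambda_2,\alpha,\beta,\eta>0$; $\tau^x,\tau^y,\tau^v$; initial $x_0\in\mathbb{R}^p$, $y_0\in\mathbb{R}^q$, $v_0\in\Omega$). All sample sets drawn are fresh and consist of mutually independent samples, and sets drawn are mutually independent. For $k=0,\dots,K-1$: 1. If $k\equiv0\pmod{q_1}$, draw sample sets $\mathcal S_{1,x},\mathcal S_{1,y},\mathcal S_{1,v}$ of size $S_1$ and set $D_k^x=D_x(x_k,y_k,v_k;\mathcal S_{1,x})$, $D_k^y=D_y(x_k,y_k;\mathcal S_{1,y})$, $D_k^v=D_v(x_k,y_k,v_k;\mathcal S_{1,v})$. Otherwise set $D_k^x=D_{k-1,J-1}^x$,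 $D_k^y=D_{k-1,T-1}^y$, $D_k^v=D_{k-1,J-1}^v$. 2. $x_{k+1}=x_k-\alpha D_k^x$. 3. Put $\bar x_{k,-1}=x_k$, $\bar y_{k,-1}=y_k$, $D_{k,-1}^y=D_k^y$, and $\bar x_{k,t}=x_{k+1}$ for $t\ge0$. For $t=0,\dots,T-1$: $\bar y_{k,t}=\bar y_{k,t-1}-\lambda_1\beta D_{k,t-1}^y$; draw a sample set $\mathcal S_{2,y}$ of size $S_2$; $D_{k,t}^y=D_y(\bar x_{k,t},\bar y_{k,t};\mathcal S_{2,y})+(1-\tau^y)\big(D_{k,t-1}^y-D_y(\bar x_{k,t-1},\bar y_{k,t-1};\mathcal S_{2,y})\big)$. Set $y_{k+1}=\bar y_{k,T-1}$. 4. Put $(x_{k,-1},y_{k,-1},v_{k,-1})=(x_k,y_k,v_k)$, $D_{k,-1}^x=D_k^x$, $D_{k,-1}^v=D_k^v$, and $x_{k,j}=x_{k+1}$, $y_{k,j}=y_{k+1}$ for $j\ge0$. For $j=0,\dots,J-1$: $v_{k,j}=\mathrm{proj}_\Omega(v_{k,j-1}-\lambda_2\eta D_{k,j-1}^v)$ (Euclidean projection); draw sample sets $\mathcal S_{2,x},\mathcal S_{2,v}$ of size $S_2$; with $u_{k,j}=(x_{k,j},y_{k,j},v_{k,j})$, $D_{k,j}^x=D_x(u_{k,j};\mathcal S_{2,x})+(1-\tau^x)\big(D_{k,j-1}^x-D_x(u_{k,j-1};\mathcal S_{2,x})\big)$ and $D_{k,j}^v=D_v(u_{k,j};\mathcal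 S_{2,v})+(1-\tau^v)\big(D_{k,j-1}^v-D_v(u_{k,j-1};\mathcal S_{2,v})\big)$. Set $v_{k+1}=v_{k,J-1}$. *)

theory Defs
  imports "HOL-Probability.Probability" "HOL-Library.Landau_Symbols"
begin

text \<open>
  Functions of \<^term>\<open>x\<close> and \<^term>\<open>y\<close> jointly are functions on the product
  \<open>(real^'p) \<times> (real^'q)\<close>, whose norm is the Euclidean norm of the concatenated vector.
\<close>

section \<open>Calculus\<close>

definition grad :: "('a::real_inner \<Rightarrow> real) \<Rightarrow> 'a \<Rightarrow> 'a" where
  "grad h z = (THE D. GDERIV h z :> D)"

definition grad_x :: "((real^'p) \<times> (real^'q) \<Rightarrow> real) \<Rightarrow> (real^'p) \<times> (real^'q) \<Rightarrow> real^'p" where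
  "grad_x h z = grad (\<lambda>x. h (x, snd z)) (fst z)"

definition grad_y :: "((real^'p) \<times> (real^'q) \<Rightarrow> real) \<Rightarrow> (real^'p) \<times> (real^'q) \<Rightarrow> real^'q" where
  "grad_y h z = grad (\<lambda>y. h (fst z, y)) (snd z)"

definition jac_xy :: "((real^'p) \<times> (real^'q) \<Rightarrow> real) \<Rightarrow> (real^'p) \<times> (real^'q) \<Rightarrow> real^'q^'p" where
  "jac_xy h z = jacobian (\<lambda>y. grad_x h (fst z, y)) (at (snd z))"

definition hess_y :: "((real^'p) \<times> (real^'q) \<Rightarrow> real) \<Rightarrow> (real^'p) \<times> (real^'q) \<Rightarrow> real^'q^'q" where
  "hess_y h z = jacobian (\<lambda>y. grad_y h (fst z, y)) (at (snd z))"

text \<open>The library norm on matrices is the Frobenius norm, so the spectral norm is separate.\<close>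

definition spectral_norm :: "real^'n^'m \<Rightarrow> real" where
  "spectral_norm A = onorm ((*v) A)"

definition spectral_lipschitz :: "real \<Rightarrow> ('a::metric_space \<Rightarrow> real^'n^'m) \<Rightarrow> bool" where
  "spectral_lipschitz L A \<longleftrightarrow> 0 \<le> L \<and> (\<forall>z w. spectral_norm (A z - A w) \<le> L * dist z w)"

definition C1 :: "('a::real_normed_vector \<Rightarrow> 'b::real_normed_vector) \<Rightarrow> bool" where
  "C1 h \<longleftrightarrow> (\<exists>h' :: 'a \<Rightarrow> 'a \<Rightarrow>\<^sub>L 'b.
     (\<forall>z. (h has_derivative blinfun_apply (h' z)) (at z)) \<and> continuous_on UNIV h')"

definition C2 :: "('a::real_normed_vector \<Rightarrow> 'b::real_normed_vector) \<Rightarrow> bool" where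
  "C2 h \<longleftrightarrow> (\<exists>h' :: 'a \<Rightarrow> 'a \<Rightarrow>\<^sub>L 'b.
     (\<forall>z. (h has_derivative blinfun_apply (h' z)) (at z)) \<and> C1 h')"

definition strongly_convex :: "real \<Rightarrow> ('a::real_normed_vector \<Rightarrow> real) \<Rightarrow> bool" where
  "strongly_convex mu h \<longleftrightarrow> (\<forall>u w. \<forall>t\<in>{0..1}.
     h ((1 - t) *\<^sub>R u + t *\<^sub>R w)
       \<le> (1 - t) * h u + t * h w - mu / 2 * t * (1 - t) * (norm (u - w))\<^sup>2)"


section \<open>The bilevel problem\<close>

definition y_star :: "((real^'p) \<times> (real^'q) \<Rightarrow> real) \<Rightarrow> real^'p \<Rightarrow> real^'q" where
  "y_star g x = arg_min (\<lambda>y. g (x, y)) (\<lambda>_. True)"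

definition Phi ::
    "((real^'p) \<times> (real^'q) \<Rightarrow> real) \<Rightarrow> ((real^'p) \<times> (real^'q) \<Rightarrow> real) \<Rightarrow> real^'p \<Rightarrow> real" where
  "Phi f g x = f (x, y_star g x)"

definition mean_le :: "'w measure \<Rightarrow> ('w \<Rightarrow> real) \<Rightarrow> real \<Rightarrow> bool" where
  "mean_le \<P> h c \<longleftrightarrow> integrable \<P> h \<and> integral\<^sup>L \<P> h \<le> c"

definition eps_stationary ::
    "'w measure \<Rightarrow> ('a::real_inner \<Rightarrow> real) \<Rightarrow> ('w \<Rightarrow> 'a) \<Rightarrow> real \<Rightarrow> bool" where
  "eps_stationary \<P> \<phi> X \<epsilon> \<longleftrightarrow> mean_le \<P> (\<lambda>\<omega>. (norm (grad \<phi> (X \<omega>)))\<^sup>2) \<epsilon>"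

record problem_consts =
  c_mu :: real
  c_f :: real       \<comment> \<open>\<open>C\<^sub>f\<close>\<close>
  L_f :: real
  L_g :: real
  L_gxy :: real
  L_gyy :: real
  sigma_f :: real
  sigma_g :: real
  sigma_gxy :: real
  sigma_gyy :: real

definition stochastic_objectives ::
    "'xi measure \<Rightarrow> 'zeta measure \<Rightarrow>
     ((real^'p) \<times> (real^'q) \<Rightarrow> real) \<Rightarrow> ((real^'p) \<times> (real^'q) \<Rightarrow> real) \<Rightarrow>
     ('xi \<Rightarrow> (real^'p) \<times> (real^'q) \<Rightarrow> real) \<Rightarrow> ('zeta \<Rightarrow> (real^'p) \<times> (real^'q) \<Rightarrow> real) \<Rightarrow> bool" where
  "stochastic_objectives P\<xi> P\<zeta> f g F G \<longleftrightarrow>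
     prob_space P\<xi> \<and> prob_space P\<zeta> \<and>
     (\<forall>z. has_bochner_integral P\<xi> (\<lambda>\<xi>. F \<xi> z) (f z)) \<and>
     (\<forall>z. has_bochner_integral P\<zeta> (\<lambda>\<zeta>. G \<zeta> z) (g z))"

definition assumption_A1 ::
    "problem_consts \<Rightarrow> 'xi measure \<Rightarrow> 'zeta measure \<Rightarrow>
     ((real^'p) \<times> (real^'q) \<Rightarrow> real) \<Rightarrow> ((real^'p) \<times> (real^'q) \<Rightarrow> real) \<Rightarrow>
     ('xi \<Rightarrow> (real^'p) \<times> (real^'q) \<Rightarrow> real) \<Rightarrow> ('zeta \<Rightarrow> (real^'p) \<times> (real^'q) \<Rightarrow> real) \<Rightarrow> bool" where
  "assumption_A1 c P\<xi> P\<zeta> f g F G \<longleftrightarrow>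
     C1 f \<and> (\<forall>\<xi>\<in>space P\<xi>. C1 (F \<xi>)) \<and>
     C2 g \<and> (\<forall>\<zeta>\<in>space P\<zeta>. C2 (G \<zeta>)) \<and>
     c_mu c > 0 \<and>
     (\<forall>x. strongly_convex (c_mu c) (\<lambda>y. g (x, y))) \<and>
     (\<forall>\<zeta>\<in>space P\<zeta>. \<forall>x. strongly_convex (c_mu c) (\<lambda>y. G \<zeta> (x, y))) \<and>
     \<not> convex_on UNIV (Phi f g) \<and> bdd_below (range (Phi f g))"

definition lipschitz_upper :: "problem_consts \<Rightarrow> ((real^'p) \<times> (real^'q) \<Rightarrow> real) \<Rightarrow> bool" where
  "lipschitz_upper c h \<longleftrightarrow> (c_f c)-lipschitz_on UNIV h \<and> (L_f c)-lipschitz_on UNIV (grad h)"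

definition lipschitz_lower :: "problem_consts \<Rightarrow> ((real^'p) \<times> (real^'q) \<Rightarrow> real) \<Rightarrow> bool" where
  "lipschitz_lower c h \<longleftrightarrow>
     (L_g c)-lipschitz_on UNIV (grad h) \<and>
     spectral_lipschitz (L_gxy c) (jac_xy h) \<and>
     spectral_lipschitz (L_gyy c) (hess_y h)"

definition assumption_A2 ::
    "problem_consts \<Rightarrow> ((real^'p) \<times> (real^'q) \<Rightarrow> real) \<Rightarrow> ((real^'p) \<times> (real^'q) \<Rightarrow> real) \<Rightarrow> bool" where
  "assumption_A2 c f g \<longleftrightarrow> lipschitz_upper c f \<and> lipschitz_lower c g"

definition assumption_A3 ::
    "problem_consts \<Rightarrow> 'xi measure \<Rightarrow> 'zeta measure \<Rightarrow>
     ((real^'p) \<times> (real^'q) \<Rightarrow> real) \<Rightarrow> ((real^'p) \<times> (real^'q) \<Rightarrow> real) \<Rightarrow>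
     ('xi \<Rightarrow> (real^'p) \<times> (real^'q) \<Rightarrow> real) \<Rightarrow> ('zeta \<Rightarrow> (real^'p) \<times> (real^'q) \<Rightarrow> real) \<Rightarrow> bool" where
  "assumption_A3 c P\<xi> P\<zeta> f g F G \<longleftrightarrow> (\<forall>z.
     has_bochner_integral P\<xi> (\<lambda>\<xi>. grad (F \<xi>) z) (grad f z) \<and>
     has_bochner_integral P\<zeta> (\<lambda>\<zeta>. grad (G \<zeta>) z) (grad g z) \<and>
     has_bochner_integral P\<zeta> (\<lambda>\<zeta>. jac_xy (G \<zeta>) z) (jac_xy g z) \<and>
     has_bochner_integral P\<zeta> (\<lambda>\<zeta>. hess_y (G \<zeta>) z) (hess_y g z) \<and>
     mean_le P\<xi> (\<lambda>\<xi>. (norm (grad (F \<xi>) z - grad f z))\<^sup>2) ((sigma_f c)\<^sup>2) \<and>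
     mean_le P\<zeta> (\<lambda>\<zeta>. (norm (grad (G \<zeta>) z - grad g z))\<^sup>2) ((sigma_g c)\<^sup>2) \<and>
     mean_le P\<zeta> (\<lambda>\<zeta>. (spectral_norm (jac_xy (G \<zeta>) z - jac_xy g z))\<^sup>2) ((sigma_gxy c)\<^sup>2) \<and>
     mean_le P\<zeta> (\<lambda>\<zeta>. (spectral_norm (hess_y (G \<zeta>) z - hess_y g z))\<^sup>2) ((sigma_gyy c)\<^sup>2))"

definition assumption_A4 ::
    "problem_consts \<Rightarrow> 'xi measure \<Rightarrow> 'zeta measure \<Rightarrow>
     ('xi \<Rightarrow> (real^'p) \<times> (real^'q) \<Rightarrow> real) \<Rightarrow> ('zeta \<Rightarrow> (real^'p) \<times> (real^'q) \<Rightarrow> real) \<Rightarrow> bool" where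
  "assumption_A4 c P\<xi> P\<zeta> F G \<longleftrightarrow>
     (\<forall>\<xi>\<in>space P\<xi>. lipschitz_upper c (F \<xi>)) \<and> (\<forall>\<zeta>\<in>space P\<zeta>. lipschitz_lower c (G \<zeta>))"


section \<open>Search directions\<close>

definition dir_y :: "((real^'p) \<times> (real^'q) \<Rightarrow> real) \<Rightarrow> (real^'p) \<times> (real^'q) \<Rightarrow> real^'q" where
  "dir_y g z = grad_y g z"

definition dir_v ::
    "((real^'p) \<times> (real^'q) \<Rightarrow> real) \<Rightarrow> ((real^'p) \<times> (real^'q) \<Rightarrow> real) \<Rightarrow>
     (real^'p) \<times> (real^'q) \<times> (real^'q) \<Rightarrow> real^'q" where
  "dir_v f g = (\<lambda>(x, y, v). hess_y g (x, y) *v v - grad_y f (x, y))"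

definition dir_x ::
    "((real^'p) \<times> (real^'q) \<Rightarrow> real) \<Rightarrow> ((real^'p) \<times> (real^'q) \<Rightarrow> real) \<Rightarrow>
     (real^'p) \<times> (real^'q) \<times> (real^'q) \<Rightarrow> real^'p" where
  "dir_x f g = (\<lambda>(x, y, v). grad_x f (x, y) - jac_xy g (x, y) *v v)"

text \<open>
  A sample set of size \<^term>\<open>n\<close> is given by a sequence of samples \<open>(\<xi>\<^sub>i, \<zeta>\<^sub>i)\<close>,
  of which the entries \<open>i < n\<close> are used.
\<close>

definition batch_mean :: "nat \<Rightarrow> (nat \<Rightarrow> 'a::real_vector) \<Rightarrow> 'a" where
  "batch_mean n h = (1 / real n) *\<^sub>R (\<Sum>i<n. h i)"

definition batch_y ::
    "('zeta \<Rightarrow> (real^'p) \<times> (real^'q) \<Rightarrow> real) \<Rightarrow> nat \<Rightarrow> (nat \<Rightarrow> 'xi \<times> 'zeta) \<Rightarrow>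
     (real^'p) \<times> (real^'q) \<Rightarrow> real^'q" where
  "batch_y G n s z = batch_mean n (\<lambda>i. dir_y (G (snd (s i))) z)"

definition batch_v ::
    "('xi \<Rightarrow> (real^'p) \<times> (real^'q) \<Rightarrow> real) \<Rightarrow> ('zeta \<Rightarrow> (real^'p) \<times> (real^'q) \<Rightarrow> real) \<Rightarrow>
     nat \<Rightarrow> (nat \<Rightarrow> 'xi \<times> 'zeta) \<Rightarrow> (real^'p) \<times> (real^'q) \<times> (real^'q) \<Rightarrow> real^'q" where
  "batch_v F G n s u = batch_mean n (\<lambda>i. dir_v (F (fst (s i))) (G (snd (s i))) u)"

definition batch_x ::
    "('xi \<Rightarrow> (real^'p) \<times> (real^'q) \<Rightarrow> real) \<Rightarrow> ('zeta \<Rightarrow> (real^'p) \<times> (real^'q) \<Rightarrow> real) \<Rightarrow>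
     nat \<Rightarrow> (nat \<Rightarrow> 'xi \<times> 'zeta) \<Rightarrow> (real^'p) \<times> (real^'q) \<times> (real^'q) \<Rightarrow> real^'p" where
  "batch_x F G n s u = batch_mean n (\<lambda>i. dir_x (F (fst (s i))) (G (snd (s i))) u)"

text \<open>
  Oracle calls for one evaluation on a sample set of size \<^term>\<open>n\<close>. Per sample, \<^const>\<open>dir_y\<close>
  needs one call (\<open>\<nabla>\<^sub>y G\<close>), \<^const>\<open>dir_v\<close> two (a Hessian-vector product and \<open>\<nabla>\<^sub>y F\<close>), and
  \<^const>\<open>dir_x\<close> two (\<open>\<nabla>\<^sub>x F\<close> and a Jacobian-vector product).
\<close>

definition calls_y :: "nat \<Rightarrow> nat" where "calls_y n = n"
definition calls_v :: "nat \<Rightarrow> nat" where "calls_v n = 2 * n"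
definition calls_x :: "nat \<Rightarrow> nat" where "calls_x n = 2 * n"


section \<open>The algorithm\<close>

record alg_params =
  n_T :: nat
  n_J :: nat
  period :: nat     \<comment> \<open>\<open>q\<^sub>1\<close>\<close>
  size_1 :: nat     \<comment> \<open>\<open>S\<^sub>1\<close>\<close>
  size_2 :: nat     \<comment> \<open>\<open>S\<^sub>2\<close>\<close>
  step_lambda1 :: real
  step_lambda2 :: real
  step_alpha :: real
  step_beta :: real
  step_eta :: real
  tau_x :: real
  tau_y :: real
  tau_v :: real
  radius :: real    \<comment> \<open>\<open>M\<close>, the radius of \<open>\<Omega>\<close>\<close>

text \<open>
  One label for every sample set the algorithm may draw: by outer iteration \<open>k\<close> and, for the
  inner loops, by \<open>t\<close> or \<open>j\<close>.
\<close>

datatype draw =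
    Outer_x nat | Outer_y nat | Outer_v nat
  | Inner_y nat nat | Inner_x nat nat | Inner_v nat nat

record ('p, 'q) alg_state =
  st_x :: "real^'p"
  st_y :: "real^'q"
  st_v :: "real^'q"
  st_Dx :: "real^'p"
  st_Dy :: "real^'q"
  st_Dv :: "real^'q"
  st_calls :: nat   \<comment> \<open>number of oracle calls made so far\<close>

text \<open>
  \<open>y_loop P G s k x' w n\<close> is \<open>(z, D\<^sup>y\<^sub>k\<^sub>,\<^sub>t, calls)\<close> for \<open>t = n - 1\<close>, where \<open>z\<close> is the
  current point of the \<open>y\<close>-iteration; the start
  \<open>w\<close> has index \<open>t = -1\<close>. Likewise \<open>v_loop\<close> yields \<open>(u\<^sub>k\<^sub>,\<^sub>j, D\<^sup>x\<^sub>k\<^sub>,\<^sub>j, D\<^sup>v\<^sub>k\<^sub>,\<^sub>j, calls)\<close> for \<open>j = n - 1\<close>.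
\<close>

primrec y_loop ::
    "alg_params \<Rightarrow> ('zeta \<Rightarrow> (real^'p) \<times> (real^'q) \<Rightarrow> real) \<Rightarrow> (draw \<Rightarrow> nat \<Rightarrow> 'xi \<times> 'zeta) \<Rightarrow>
     nat \<Rightarrow> real^'p \<Rightarrow> ((real^'p) \<times> (real^'q)) \<times> (real^'q) \<times> nat \<Rightarrow> nat \<Rightarrow>
     ((real^'p) \<times> (real^'q)) \<times> (real^'q) \<times> nat" where
  "y_loop P G s k x' w 0 = w"
| "y_loop P G s k x' w (Suc t) =
     (let (z, D, N) = y_loop P G s k x' w t;
          z' = (x', snd z - (step_lambda1 P * step_beta P) *\<^sub>R D);
          B = batch_y G (size_2 P) (s (Inner_y k t))
      in (z', B z' + (1 - tau_y P) *\<^sub>R (D - B z), N + 2 * calls_y (size_2 P)))"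

primrec v_loop ::
    "alg_params \<Rightarrow> ('xi \<Rightarrow> (real^'p) \<times> (real^'q) \<Rightarrow> real) \<Rightarrow> ('zeta \<Rightarrow> (real^'p) \<times> (real^'q) \<Rightarrow> real) \<Rightarrow>
     (draw \<Rightarrow> nat \<Rightarrow> 'xi \<times> 'zeta) \<Rightarrow> nat \<Rightarrow> real^'p \<Rightarrow> real^'q \<Rightarrow>
     ((real^'p) \<times> (real^'q) \<times> (real^'q)) \<times> (real^'p) \<times> (real^'q) \<times> nat \<Rightarrow> nat \<Rightarrow>
     ((real^'p) \<times> (real^'q) \<times> (real^'q)) \<times> (real^'p) \<times> (real^'q) \<times> nat" where
  "v_loop P F G s k x' y' w 0 = w"
| "v_loop P F G s k x' y' w (Suc j) =
     (let (u, Dx, Dv, N) = v_loop P F G s k x' y' w j;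
          v = snd (snd u);
          u' = (x', y', closest_point (cball 0 (radius P))
                          (v - (step_lambda2 P * step_eta P) *\<^sub>R Dv));
          Bx = batch_x F G (size_2 P) (s (Inner_x k j));
          Bv = batch_v F G (size_2 P) (s (Inner_v k j))
      in (u', Bx u' + (1 - tau_x P) *\<^sub>R (Dx - Bx u), Bv u' + (1 - tau_v P) *\<^sub>R (Dv - Bv u),
          N + 2 * calls_x (size_2 P) + 2 * calls_v (size_2 P)))"

definition alg_step ::
    "alg_params \<Rightarrow> ('xi \<Rightarrow> (real^'p) \<times> (real^'q) \<Rightarrow> real) \<Rightarrow> ('zeta \<Rightarrow> (real^'p) \<times> (real^'q) \<Rightarrow> real) \<Rightarrow>
     (draw \<Rightarrow> nat \<Rightarrow> 'xi \<times> 'zeta) \<Rightarrow> nat \<Rightarrow> ('p, 'q) alg_state \<Rightarrow> ('p, 'q) alg_state" where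
  "alg_step P F G s k st =
     (let x = st_x st; y = st_y st; v = st_v st;
          (Dx, Dy, Dv, N0) =
            (if period P dvd k
             then (batch_x F G (size_1 P) (s (Outer_x k)) (x, y, v),
                   batch_y G (size_1 P) (s (Outer_y k)) (x, y),
                   batch_v F G (size_1 P) (s (Outer_v k)) (x, y, v),
                   st_calls st + calls_x (size_1 P) + calls_y (size_1 P) + calls_v (size_1 P))
             else (st_Dx st, st_Dy st, st_Dv st, st_calls st));
          x' = x - step_alpha P *\<^sub>R Dx;
          (z, Dy', N1) = y_loop P G s k x' ((x, y), Dy, N0) (n_T P);
          y' = snd z;
          (u, Dx', Dv', N2) = v_loop P F G s k x' y' ((x, y, v), Dx, Dv, N1) (n_J P)
      in \<lparr>st_x = x', st_y = y', st_v = snd (snd u),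
          st_Dx = Dx', st_Dy = Dy', st_Dv = Dv', st_calls = N2\<rparr>)"

text \<open>
  State at the beginning of iteration \<^term>\<open>k\<close>. The initial directions are never read, as every
  period divides \<open>0\<close>.
\<close>

primrec alg_run ::
    "alg_params \<Rightarrow> ('xi \<Rightarrow> (real^'p) \<times> (real^'q) \<Rightarrow> real) \<Rightarrow> ('zeta \<Rightarrow> (real^'p) \<times> (real^'q) \<Rightarrow> real) \<Rightarrow>
     real^'p \<Rightarrow> real^'q \<Rightarrow> real^'q \<Rightarrow> (draw \<Rightarrow> nat \<Rightarrow> 'xi \<times> 'zeta) \<Rightarrow> nat \<Rightarrow> ('p, 'q) alg_state" where
  "alg_run P F G x0 y0 v0 s 0 =
     \<lparr>st_x = x0, st_y = y0, st_v = v0, st_Dx = 0, st_Dy = 0, st_Dv = 0, st_calls = 0\<rparr>"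
| "alg_run P F G x0 y0 v0 s (Suc k) = alg_step P F G s k (alg_run P F G x0 y0 v0 s k)"

text \<open>
  All samples of all sample sets are mutually independent copies of \<open>\<xi>\<close> and \<open>\<zeta>\<close>; no condition is
  imposed on the joint law of the two components \<open>\<xi>\<^sub>i\<close>, \<open>\<zeta>\<^sub>i\<close> of a single sample.
\<close>

definition fresh_samples ::
    "'w measure \<Rightarrow> 'xi measure \<Rightarrow> 'zeta measure \<Rightarrow> (draw \<Rightarrow> nat \<Rightarrow> 'w \<Rightarrow> 'xi \<times> 'zeta) \<Rightarrow> bool" where
  "fresh_samples \<P> P\<xi> P\<zeta> s \<longleftrightarrow>
     prob_space \<P> \<and>
     prob_space.indep_vars \<P> (\<lambda>_. P\<xi> \<Otimes>\<^sub>M P\<zeta>) (\<lambda>(d, i). s d i) UNIV \<and>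
     (\<forall>d i. distr \<P> P\<xi> (fst \<circ> s d i) = P\<xi> \<and> distr \<P> P\<zeta> (snd \<circ> s d i) = P\<zeta>)"

text \<open>
  The output \<open>x\<^sub>\<kappa>\<close> lives on the product of the sample space with the uniform distribution of
  the index \<open>\<kappa>\<close> on \<open>{0, \<dots>, K - 1}\<close>.
\<close>

definition output_space :: "'w measure \<Rightarrow> nat \<Rightarrow> ('w \<times> nat) measure" where
  "output_space \<P> K = \<P> \<Otimes>\<^sub>M measure_pmf (pmf_of_set {..<K})"

definition alg_output ::
    "alg_params \<Rightarrow> ('xi \<Rightarrow> (real^'p) \<times> (real^'q) \<Rightarrow> real) \<Rightarrow> ('zeta \<Rightarrow> (real^'p) \<times> (real^'q) \<Rightarrow> real) \<Rightarrow>
     real^'p \<Rightarrow> real^'q \<Rightarrow> real^'q \<Rightarrow> (draw \<Rightarrow> nat \<Rightarrow> 'w \<Rightarrow> 'xi \<times> 'zeta) \<Rightarrow> 'w \<times> nat \<Rightarrow> real^'p" where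
  "alg_output P F G x0 y0 v0 s = (\<lambda>(\<omega>, \<kappa>). st_x (alg_run P F G x0 y0 v0 (\<lambda>d i. s d i \<omega>) \<kappa>))"


section \<open>Constants and step sizes\<close>

definition L_gg :: "problem_consts \<Rightarrow> real" where
  "L_gg c = max (L_gxy c) (L_gyy c)"

definition M1_bar :: "problem_consts \<Rightarrow> real \<Rightarrow> real" where
  "M1_bar c M = 4 * (L_f c)\<^sup>2 + 4 * M\<^sup>2 * (L_gg c)\<^sup>2"

definition C_y :: "problem_consts \<Rightarrow> real" where
  "C_y c = L_g c / c_mu c"

definition C_v :: "problem_consts \<Rightarrow> real" where
  "C_v c = (L_f c / c_mu c + c_f c * L_gg c / (c_mu c)\<^sup>2) * (1 + L_g c / c_mu c)"

definition L_Phi :: "problem_consts \<Rightarrow> real" where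
  "L_Phi c = L_f c + (2 * L_f c * L_g c + c_f c * L_gg c) / c_mu c
     + (L_f c * (L_g c)\<^sup>2 + 2 * c_f c * L_g c * L_gg c) / (c_mu c)\<^sup>2
     + c_f c * (L_g c)\<^sup>2 * L_gg c / (c_mu c)^3"

definition C_3 :: "real \<Rightarrow> nat \<Rightarrow> nat \<Rightarrow> real" where
  "C_3 M T J = (real J)\<^sup>2 + (real J)\<^sup>2 * M\<^sup>2 + 2 * (real T)\<^sup>2"

definition spider_lambda1 :: "problem_consts \<Rightarrow> real \<Rightarrow> nat \<Rightarrow> nat \<Rightarrow> real \<Rightarrow> real \<Rightarrow> real" where
  "spider_lambda1 c M T J \<beta> r =
     min (1 / (2 * L_g c + 2 * c_mu c))
         ((1/2)^(2*T + 5) * c_mu c * r / (real T * (L_g c)\<^sup>2 * \<beta>\<^sup>2 * C_3 M T J))"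

definition spider_lambda2 ::
    "problem_consts \<Rightarrow> real \<Rightarrow> nat \<Rightarrow> nat \<Rightarrow> real \<Rightarrow> real \<Rightarrow> real \<Rightarrow> real" where
  "spider_lambda2 c M T J \<beta> \<eta> r = Min
     {1 / (2 * L_g c + 2 * c_mu c),
      (c_mu c)\<^sup>2 * spider_lambda1 c M T J \<beta> r * \<beta> / (128 * M1_bar c M * real J * \<eta>),
      (1/2)^(2*(T + J) + 6) * c_mu c * r
        / (real J * ((L_g c)\<^sup>2 * \<eta>\<^sup>2 + real T * M1_bar c M * \<beta> * \<eta>))}"

definition C_4 :: "problem_consts \<Rightarrow> real \<Rightarrow> nat \<Rightarrow> nat \<Rightarrow> real \<Rightarrow> real \<Rightarrow> real" where
  "C_4 c M T J \<beta> r =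
     192 * spider_lambda1 c M T J \<beta> r * \<beta> * (L_g c)\<^sup>2 * (1 + inverse r * C_3 M T J)"

definition C_5 :: "problem_consts \<Rightarrow> real \<Rightarrow> nat \<Rightarrow> nat \<Rightarrow> real \<Rightarrow> real \<Rightarrow> real \<Rightarrow> real" where
  "C_5 c M T J \<beta> \<eta> r =
     192 * spider_lambda2 c M T J \<beta> \<eta> r * \<eta> * M1_bar c M * (1 + (C_y c)\<^sup>2 + inverse r * real J)"

text \<open>
  No denominator below or above vanishes under the assumptions: strong convexity forces
  \<open>\<mu> \<le> L\<^sub>g\<close>, and since \<open>\<Phi>\<close> is not convex, it is not affine, so that the Lipschitz constant
  \<open>L\<^sub>\<Phi>\<close> of its gradient, \<open>C\<^sub>f\<close> and \<^const>\<open>M1_bar\<close> are positive.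
\<close>

definition spider_alpha ::
    "problem_consts \<Rightarrow> real \<Rightarrow> nat \<Rightarrow> nat \<Rightarrow> real \<Rightarrow> real \<Rightarrow> real \<Rightarrow> real" where
  "spider_alpha c M T J \<beta> \<eta> r = Min
     {c_mu c * spider_lambda1 c M T J \<beta> r * \<beta> / (96 * (C_y c)\<^sup>2 + 8 * M1_bar c M),
      c_mu c * spider_lambda2 c M T J \<beta> \<eta> r * \<eta> / (48 * ((L_g c)\<^sup>2 + (C_v c)\<^sup>2)),
      1 / (6 * L_Phi c),
      sqrt r / (12 * sqrt (M1_bar c M)),
      c_mu c / C_4 c M T J \<beta> r,
      c_mu c / C_5 c M T J \<beta> \<eta> r,
      (1/2)^(2*(T + J) + 3) * r / (M1_bar c M * real T * \<beta> + (L_g c)\<^sup>2 * \<eta>)}"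

definition als_spider ::
    "problem_consts \<Rightarrow> real \<Rightarrow> nat \<Rightarrow> nat \<Rightarrow> real \<Rightarrow> real \<Rightarrow> nat \<Rightarrow> nat \<Rightarrow> nat \<Rightarrow> alg_params" where
  "als_spider c M T J \<beta> \<eta> q1 S1 S2 =
     (let r = real S2 / real q1
      in \<lparr>n_T = T, n_J = J, period = q1, size_1 = S1, size_2 = S2,
          step_lambda1 = spider_lambda1 c M T J \<beta> r,
          step_lambda2 = spider_lambda2 c M T J \<beta> \<eta> r,
          step_alpha = spider_alpha c M T J \<beta> \<eta> r,
          step_beta = \<beta>, step_eta = \<eta>, tau_x = 0, tau_y = 0, tau_v = 0, radius = M\<rparr>)"

end

theory Submission
  imports Defs
begin

text \<open>
  The implicit function theorem is avoided: with \<open>v*\<close> solving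
  \<open>\<nabla>\<^sub>y\<^sup>2g(x, y*(x)) v* = \<nabla>\<^sub>yf(x, y*(x))\<close>, the Taylor estimates for \<open>f\<close> and \<open>g\<close> directly give
  \<open>\<nabla>\<Phi> = \<nabla>\<^sub>xf - \<nabla>\<^sub>x\<nabla>\<^sub>yg v*\<close>, so a bound on the tracking errors \<open>|y - y*|\<close>, \<open>|v - v*|\<close> and on the error of
  the estimator of \<open>D\<^sub>x\<close> turns an \<open>x\<close>-step into a descent step for \<open>\<Phi>\<close>.

  The potential is \<open>\<Phi> - inf \<Phi> + |y - y*|\<^sup>2 + |v - v*|\<^sup>2\<close> plus \<open>n\<close> times a weighted sum of the squared
  estimation errors, where \<open>n\<close> is the number of iterations left in the current epoch. A fresh
  sample is integrated out by resampling one coordinate of the product law of all samples, which is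
  independent of the state reached so far; hence a recursive update adds to the squared
  error of an estimator at most \<open>1/S\<^sub>2\<close> times the squared movement of the iterate. Since
  \<open>n \<le> q\<^sub>1 = S\<^sub>2\<close>, the step sizes let the gains of the gradient steps pay for this drift. A restart
  contributes \<open>O(q\<^sub>1/S\<^sub>1)\<close> once per epoch, so with \<open>K = S\<^sub>1 = q\<^sub>1\<^sup>2\<close> the mean squared gradient is
  \<open>O(1/q\<^sub>1\<^sup>2)\<close>, at a total cost of \<open>q\<^sub>1\<^sup>3 (5 + 2T + 8J)\<close>.
\<close>

section \<open>Gradients and second derivatives\<close>

text \<open>The multiplicity \<open>n\<close> reflects that errors of the estimators persist: an
  error made now is charged again in every remaining iteration of the epoch. If \<open>Ax\<close>,
  \<open>Ay\<close>, \<open>Av\<close> bound what one iteration pays per unit of squared error,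
  lowering the multiplicity from \<open>Suc m\<close> to \<open>m\<close> releases that amount,
  while newly created drift, divided by the batch size \<open>q\<close>, enters with weight at most
  \<open>Ax\<close>, \<open>Ay\<close> or \<open>Av\<close>. Inside an iteration the multiplicity is
  lowered gradually, along the inner steps. The obstacle is the coupling of the loops: the v-steps
  are biased by the y-error, and the first of them sees the total displacement of y. Two provisional
  terms handle this, a surplus \<open>kap\<close> on the y-error and a reserve \<open>theta\<close>
  times the squared y-movements; both are used up when the iteration ends. All expectations are
  extended nonnegative integrals, so no moment of an iterate has to be known to be finite
  beforehand.\<close>

lemma GDERIV_unique:
  assumes "GDERIV h z :> D" "GDERIV h z :> D'"
  shows "D = D'"
proof -
  have "(\<lambda>w. w \<bullet> D) = (\<lambda>w. w \<bullet> D')"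
    using assms unfolding gderiv_def by (rule has_derivative_unique)
  then have "(D - D') \<bullet> (D - D') = 0"
    by (metis diff_self inner_diff_right)
  then show ?thesis by simp
qed

lemma grad_eqI: "GDERIV h z :> D \<Longrightarrow> grad h z = D"
  unfolding grad_def by (rule the_equality) (auto intro: GDERIV_unique)

lemma linear_functional_inner:
  fixes \<phi> :: "'a::euclidean_space \<Rightarrow> real"
  assumes "linear \<phi>"
  shows "\<phi> w = w \<bullet> (\<Sum>b\<in>Basis. \<phi> b *\<^sub>R b)"
proof -
  have "\<phi> w = \<phi> (\<Sum>b\<in>Basis. (w \<bullet> b) *\<^sub>R b)" by (simp add: euclidean_representation)
  also have "\<dots> = (\<Sum>b\<in>Basis. (w \<bullet> b) * \<phi> b)"
    using assms by (simp add: linear_sum linear_scale)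
  finally show ?thesis by (simp add: inner_sum_right mult.commute)
qed

lemma has_derivative_GDERIV:
  fixes h :: "'a::euclidean_space \<Rightarrow> real"
  assumes "(h has_derivative \<phi>) (at z)"
  shows "GDERIV h z :> (\<Sum>b\<in>Basis. \<phi> b *\<^sub>R b)"
proof -
  have "\<phi> = (\<lambda>w. w \<bullet> (\<Sum>b\<in>Basis. \<phi> b *\<^sub>R b))"
    using linear_functional_inner[OF has_derivative_linear[OF assms]] by blast
  then show ?thesis using assms unfolding gderiv_def by metis
qed

lemma C1_GDERIV:
  fixes h :: "'a::euclidean_space \<Rightarrow> real"
  assumes "C1 h"
  shows "GDERIV h z :> grad h z"
proof -
  obtain D where "GDERIV h z :> D"
    using assms has_derivative_GDERIV unfolding C1_def by blast
  then show ?thesis using grad_eqI by blast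
qed

lemma GDERIV_fst:
  assumes "GDERIV h z :> D"
  shows "GDERIV (\<lambda>x. h (x, snd z)) (fst z) :> fst D"
proof -
  have h: "(h has_derivative (\<lambda>w. w \<bullet> D)) (at (fst z, snd z))"
    using assms by (simp add: gderiv_def)
  have "((\<lambda>x. h (x, snd z)) has_derivative (\<lambda>w. (w, 0) \<bullet> D)) (at (fst z))"
    by (rule has_derivative_compose[where f = "\<lambda>x. (x, snd z)" and g = h])
       (use h in \<open>auto intro!: derivative_eq_intros\<close>)
  then show ?thesis by (simp add: gderiv_def inner_prod_def)
qed

lemma GDERIV_snd:
  assumes "GDERIV h z :> D"
  shows "GDERIV (\<lambda>y. h (fst z, y)) (snd z) :> snd D"
proof -
  have h: "(h has_derivative (\<lambda>w. w \<bullet> D)) (at (fst z, snd z))"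
    using assms by (simp add: gderiv_def)
  have "((\<lambda>y. h (fst z, y)) has_derivative (\<lambda>w. (0, w) \<bullet> D)) (at (snd z))"
    by (rule has_derivative_compose[where f = "\<lambda>y. (fst z, y)" and g = h])
       (use h in \<open>auto intro!: derivative_eq_intros\<close>)
  then show ?thesis by (simp add: gderiv_def inner_prod_def)
qed

lemma grad_x_eq_fst: "C1 h \<Longrightarrow> grad_x h z = fst (grad h z)"
  unfolding grad_x_def by (intro grad_eqI GDERIV_fst C1_GDERIV)

lemma grad_y_eq_snd: "C1 h \<Longrightarrow> grad_y h z = snd (grad h z)"
  unfolding grad_y_def by (intro grad_eqI GDERIV_snd C1_GDERIV)

section \<open>Descent and convexity inequalities for gradients\<close>

lemma GDERIV_along_line:
  assumes "\<And>z. GDERIV h z :> G z"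
  shows "((\<lambda>t. h (x + t *\<^sub>R d)) has_real_derivative (G (x + t *\<^sub>R d) \<bullet> d)) (at t within S)"
proof -
  have "((\<lambda>t. h (x + t *\<^sub>R d)) has_derivative (\<lambda>s. (s *\<^sub>R d) \<bullet> G (x + t *\<^sub>R d))) (at t)"
    by (rule has_derivative_compose[where g = h and f = "\<lambda>t. x + t *\<^sub>R d"])
       (use assms in \<open>auto intro!: derivative_eq_intros simp: gderiv_def\<close>)
  moreover have "(\<lambda>s. (s *\<^sub>R d) \<bullet> G (x + t *\<^sub>R d)) = (*) (G (x + t *\<^sub>R d) \<bullet> d)"
    by (simp add: fun_eq_iff inner_commute)
  ultimately show ?thesis
    by (metis has_field_derivative_def has_field_derivative_at_within)
qed

text \<open>Descent lemma. \<open>\<psi>\<close> is \<open>h\<close> along the segment minus a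
  quadratic upper model; its derivative is nonpositive by Cauchy-Schwarz and the Lipschitz
  bound.\<close>

lemma Lipschitz_gradient_upper_bound:
  fixes h :: "'a::real_inner \<Rightarrow> real"
  assumes G: "\<And>z. GDERIV h z :> G z" and L: "L-lipschitz_on UNIV G"
  shows "h (x + d) \<le> h x + G x \<bullet> d + L / 2 * (norm d)\<^sup>2"
proof -
  define \<psi> where "\<psi> t = h (x + t *\<^sub>R d) - t * (G x \<bullet> d) - L * t\<^sup>2 / 2 * (norm d)\<^sup>2" for t
  have "\<psi> 1 \<le> \<psi> 0"
  proof (rule DERIV_nonpos_imp_nonincreasing[where f = \<psi>])
    fix t :: real assume t: "0 \<le> t" "t \<le> 1"
    have "(\<psi> has_real_derivative (G (x + t *\<^sub>R d) \<bullet> d - G x \<bullet> d - L * t * (norm d)\<^sup>2)) (at t)"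
      unfolding \<psi>_def
      by (auto intro!: derivative_eq_intros GDERIV_along_line[OF G] simp: power2_eq_square)
    moreover have "G (x + t *\<^sub>R d) \<bullet> d - G x \<bullet> d - L * t * (norm d)\<^sup>2 \<le> 0"
    proof -
      have "(G (x + t *\<^sub>R d) - G x) \<bullet> d \<le> norm (G (x + t *\<^sub>R d) - G x) * norm d"
        by (rule norm_cauchy_schwarz)
      also have "\<dots> \<le> (L * norm (t *\<^sub>R d)) * norm d"
        using lipschitz_onD[OF L, of "x + t *\<^sub>R d" x] by (intro mult_right_mono) (auto simp: dist_norm)
      finally show ?thesis using t by (simp add: inner_diff_left power2_eq_square)
    qed
    ultimately show "\<exists>y. (\<psi> has_real_derivative y) (at t) \<and> y \<le> 0" by blast
  qed simp
  then show ?thesis by (simp add: \<psi>_def)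
qed

text \<open>The convexity inequality on the segment from \<open>u\<close> to \<open>w\<close> is
  divided by \<open>t\<close>; the limit from the right turns the quotient into a directional
  derivative.\<close>

lemma strongly_convex_lower_bound:
  fixes h :: "'a::real_inner \<Rightarrow> real"
  assumes sc: "strongly_convex mu h" and G: "GDERIV h u :> D"
  shows "h u + D \<bullet> (w - u) + mu / 2 * (norm (w - u))\<^sup>2 \<le> h w"
proof -
  have "((\<lambda>t. h (u + t *\<^sub>R (w - u))) has_derivative (\<lambda>s. (s *\<^sub>R (w - u)) \<bullet> D)) (at 0)"
    by (rule has_derivative_compose[where g = h and f = "\<lambda>t. u + t *\<^sub>R (w - u)"])
       (use G in \<open>auto intro!: derivative_eq_intros simp: gderiv_def\<close>)
  moreover have "(\<lambda>s. (s *\<^sub>R (w - u)) \<bullet> D) = (*) (D \<bullet> (w - u))"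
    by (simp add: fun_eq_iff inner_commute)
  ultimately have "((\<lambda>t. h (u + t *\<^sub>R (w - u))) has_real_derivative (D \<bullet> (w - u))) (at 0)"
    by (simp add: has_field_derivative_def)
  then have "((\<lambda>t. (h (u + t *\<^sub>R (w - u)) - h u) / t) \<longlongrightarrow> D \<bullet> (w - u)) (at 0)"
    by (simp add: DERIV_def)
  then have lim: "((\<lambda>t. (h (u + t *\<^sub>R (w - u)) - h u) / t) \<longlongrightarrow> D \<bullet> (w - u)) (at_right 0)"
    by (rule filterlim_mono) (auto simp: at_le)
  have lim2: "((\<lambda>t. h w - h u - mu / 2 * (1 - t) * (norm (u - w))\<^sup>2) \<longlongrightarrow>
      h w - h u - mu / 2 * (1 - 0) * (norm (u - w))\<^sup>2) (at_right (0::real))"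
    by (intro tendsto_intros)
  have "D \<bullet> (w - u) \<le> h w - h u - mu / 2 * (1 - 0) * (norm (u - w))\<^sup>2"
  proof (rule tendsto_le[OF _ lim2 lim])
    show "\<forall>\<^sub>F t in at_right 0. (h (u + t *\<^sub>R (w - u)) - h u) / t
            \<le> h w - h u - mu / 2 * (1 - t) * (norm (u - w))\<^sup>2"
    proof (rule eventually_at_rightI[of 0 1])
      fix t :: real assume t: "t \<in> {0<..<1}"
      have "h ((1 - t) *\<^sub>R u + t *\<^sub>R w) \<le>
          (1 - t) * h u + t * h w - mu / 2 * t * (1 - t) * (norm (u - w))\<^sup>2"
        using sc t unfolding strongly_convex_def by auto
      moreover have "(1 - t) *\<^sub>R u + t *\<^sub>R w = u + t *\<^sub>R (w - u)" by (simp add: algebra_simps)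
      ultimately have "h (u + t *\<^sub>R (w - u)) - h u
          \<le> t * (h w - h u - mu / 2 * (1 - t) * (norm (u - w))\<^sup>2)"
        by (simp add: algebra_simps)
      then show "(h (u + t *\<^sub>R (w - u)) - h u) / t
            \<le> h w - h u - mu / 2 * (1 - t) * (norm (u - w))\<^sup>2"
        using t by (simp add: divide_le_eq mult.commute)
    qed simp
  qed simp
  then show ?thesis by (simp add: norm_minus_commute)
qed

lemma strongly_monotone_gradient:
  fixes h :: "'a::real_inner \<Rightarrow> real"
  assumes sc: "strongly_convex mu h" and G: "\<And>z. GDERIV h z :> G z"
  shows "mu * (norm (a - b))\<^sup>2 \<le> (G a - G b) \<bullet> (a - b)"
  using strongly_convex_lower_bound[OF sc G, of a b] strongly_convex_lower_bound[OF sc G, of b a]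
  by (simp add: inner_diff_left inner_diff_right norm_minus_commute)

text \<open>
  The terms of strong convexity and of co-coercivity (Baillon--Haddad) are available
  simultaneously, each with half of its usual constant.
\<close>

lemma strongly_convex_cocoercive:
  fixes h :: "'a::real_inner \<Rightarrow> real"
  assumes sc: "strongly_convex mu h" and mu: "0 \<le> mu"
    and G: "\<And>z. GDERIV h z :> G z" and L: "L-lipschitz_on UNIV G" "0 < L"
  shows "mu / 2 * (norm (a - b))\<^sup>2 + 1 / (2 * L) * (norm (G a - G b))\<^sup>2 \<le> (G a - G b) \<bullet> (a - b)"
proof -
  define d where "d = G a - G b"
  \<comment> \<open>The minimiser of the quadratic upper model at \<open>a\<close> of
    \<open>h\<close> minus the linear function with slope \<open>G b\<close>, whose gradient at
    \<open>a\<close> is \<open>d\<close>. The value there produces the co-coercive term.\<close>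
  define y where "y = a + (- (1 / L)) *\<^sub>R d"
  have "h b + G b \<bullet> (y - b) \<le> h y"
    using strongly_convex_lower_bound[OF sc G, of b y] mu by (smt (verit) mult_nonneg_nonneg divide_nonneg_nonneg zero_le_power2)
  also have "h y \<le> h a + G a \<bullet> ((- (1 / L)) *\<^sub>R d) + L / 2 * (norm ((- (1 / L)) *\<^sub>R d))\<^sup>2"
    unfolding y_def by (rule Lipschitz_gradient_upper_bound[OF G L(1)])
  finally have "h b + G b \<bullet> (a - b) - (1 / L) * (G b \<bullet> d) \<le>
      h a - (1 / L) * (G a \<bullet> d) + 1 / (2 * L) * (norm d)\<^sup>2"
    using L(2) by (simp add: y_def inner_diff_right inner_add_right power_mult_distrib power2_eq_square field_simps)
  moreover have "(1 / L) * (G a \<bullet> d) - (1 / L) * (G b \<bullet> d) = (1 / L) * (norm d)\<^sup>2"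
    by (simp add: d_def power2_norm_eq_inner inner_diff_left algebra_simps)
  ultimately have "h b + G b \<bullet> (a - b) + 1 / (2 * L) * (norm d)\<^sup>2 \<le> h a"
    by (simp add: field_simps)
  moreover have "h a + G a \<bullet> (b - a) + mu / 2 * (norm (b - a))\<^sup>2 \<le> h b"
    by (rule strongly_convex_lower_bound[OF sc G])
  ultimately show ?thesis
    by (simp add: d_def inner_diff_left inner_diff_right norm_minus_commute)
qed

section \<open>Difference quotients and symmetry of second derivatives\<close>

lemma has_derivative_quotient_tendsto:
  fixes G :: "'a::real_normed_vector \<Rightarrow> 'b::real_normed_vector"
  assumes "(G has_derivative H) (at b)"
  shows "((\<lambda>t. (1 / t) *\<^sub>R (G (b + t *\<^sub>R w) - G b)) \<longlongrightarrow> H w) (at_right 0)"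
proof -
  have "((\<lambda>t. G (b + t *\<^sub>R w)) has_derivative (\<lambda>s. H (s *\<^sub>R w))) (at 0)"
    by (rule has_derivative_compose[where g = G and f = "\<lambda>t. b + t *\<^sub>R w"])
       (use assms in \<open>auto intro!: derivative_eq_intros\<close>)
  then have "((\<lambda>t. G (b + t *\<^sub>R w)) has_derivative (\<lambda>s. s *\<^sub>R H w)) (at_right 0)"
    using linear_scale[OF has_derivative_linear[OF assms]] by (simp add: has_derivative_at_withinI)
  then have "((\<lambda>t. norm (G (b + t *\<^sub>R w) - G b - t *\<^sub>R H w) / norm t) \<longlongrightarrow> 0) (at_right 0)"
    by (simp add: has_derivative_iff_norm)
  moreover have "\<forall>\<^sub>F t in at_right 0. norm (G (b + t *\<^sub>R w) - G b - t *\<^sub>R H w) / norm t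
      = norm ((1 / t) *\<^sub>R (G (b + t *\<^sub>R w) - G b) - H w)"
  proof (rule eventually_at_rightI[of 0 1])
    fix t :: real assume t: "t \<in> {0<..<1}"
    have "norm (G (b + t *\<^sub>R w) - G b - t *\<^sub>R H w) / norm t
        = norm ((1 / t) *\<^sub>R (G (b + t *\<^sub>R w) - G b - t *\<^sub>R H w))"
      using t by (simp only: norm_scaleR) simp
    also have "\<dots> = norm ((1 / t) *\<^sub>R (G (b + t *\<^sub>R w) - G b) - H w)"
      using t by (simp only: scaleR_diff_right[of _ _ "t *\<^sub>R H w"] scaleR_scaleR) simp
    finally show "norm (G (b + t *\<^sub>R w) - G b - t *\<^sub>R H w) / norm t
        = norm ((1 / t) *\<^sub>R (G (b + t *\<^sub>R w) - G b) - H w)" .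
  qed simp
  ultimately have "((\<lambda>t. norm ((1 / t) *\<^sub>R (G (b + t *\<^sub>R w) - G b) - H w)) \<longlongrightarrow> 0) (at_right 0)"
    by (rule Lim_transform_eventually)
  then show ?thesis
    by (subst Lim_null) (rule tendsto_norm_zero_cancel)
qed

text \<open>Mean value theorem twice, for the increment in direction \<open>a\<close> and then in
  direction \<open>b\<close>. The second difference is symmetric in \<open>a\<close> and
  \<open>b\<close>, while the right-hand side singles out one order of differentiation.\<close>

lemma second_difference_mean_value:
  fixes h :: "'a::real_inner \<Rightarrow> real"
  assumes G: "\<And>z. GDERIV h z :> G z" and B: "\<And>z. (G has_derivative B z) (at z)" and t: "0 < t"
  shows "\<exists>s r. 0 < s \<and> s < t \<and> 0 < r \<and> r < t \<and>
    h (z + t *\<^sub>R b + t *\<^sub>R a) - h (z + t *\<^sub>R a) - h (z + t *\<^sub>R b) + h z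
      = t\<^sup>2 * (B (z + s *\<^sub>R a + r *\<^sub>R b) b \<bullet> a)"
proof -
  define \<psi> where "\<psi> s = h (z + t *\<^sub>R b + s *\<^sub>R a) - h (z + s *\<^sub>R a)" for s
  have "\<exists>s. 0 < s \<and> s < t \<and> \<psi> t - \<psi> 0 = (t - 0) * ((G (z + t *\<^sub>R b + s *\<^sub>R a) - G (z + s *\<^sub>R a)) \<bullet> a)"
  proof (rule MVT2[OF t])
    fix s show "(\<psi> has_real_derivative ((G (z + t *\<^sub>R b + s *\<^sub>R a) - G (z + s *\<^sub>R a)) \<bullet> a)) (at s)"
      unfolding \<psi>_def inner_diff_left by (intro DERIV_diff GDERIV_along_line[OF G])
  qed
  then obtain s where s: "0 < s" "s < t"
    and \<psi>: "\<psi> t - \<psi> 0 = t * ((G (z + t *\<^sub>R b + s *\<^sub>R a) - G (z + s *\<^sub>R a)) \<bullet> a)" by auto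
  define \<kappa> where "\<kappa> r = G (z + s *\<^sub>R a + r *\<^sub>R b) \<bullet> a" for r
  have "\<exists>r. 0 < r \<and> r < t \<and> \<kappa> t - \<kappa> 0 = (t - 0) * (B (z + s *\<^sub>R a + r *\<^sub>R b) b \<bullet> a)"
  proof (rule MVT2[OF t])
    fix r
    have "((\<lambda>r. G (z + s *\<^sub>R a + r *\<^sub>R b)) has_derivative (\<lambda>u. B (z + s *\<^sub>R a + r *\<^sub>R b) (u *\<^sub>R b))) (at r)"
      by (rule has_derivative_compose[where g = G and f = "\<lambda>r. z + s *\<^sub>R a + r *\<^sub>R b"])
         (use B in \<open>auto intro!: derivative_eq_intros\<close>)
    then have "((\<lambda>r. G (z + s *\<^sub>R a + r *\<^sub>R b) \<bullet> a) has_derivative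
        (\<lambda>u. B (z + s *\<^sub>R a + r *\<^sub>R b) (u *\<^sub>R b) \<bullet> a)) (at r)"
      by (rule has_derivative_inner_left)
    moreover have "(\<lambda>u. B (z + s *\<^sub>R a + r *\<^sub>R b) (u *\<^sub>R b) \<bullet> a) = (*) (B (z + s *\<^sub>R a + r *\<^sub>R b) b \<bullet> a)"
      using linear_scale[OF has_derivative_linear[OF B]] by (simp add: fun_eq_iff mult.commute)
    ultimately show "(\<kappa> has_real_derivative (B (z + s *\<^sub>R a + r *\<^sub>R b) b \<bullet> a)) (at r)"
      unfolding \<kappa>_def has_field_derivative_def by metis
  qed
  then obtain r where r: "0 < r" "r < t"
    and \<kappa>: "\<kappa> t - \<kappa> 0 = t * (B (z + s *\<^sub>R a + r *\<^sub>R b) b \<bullet> a)" by auto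
  have "(G (z + t *\<^sub>R b + s *\<^sub>R a) - G (z + s *\<^sub>R a)) \<bullet> a = \<kappa> t - \<kappa> 0"
    by (simp add: \<kappa>_def inner_diff_left add_ac)
  then have "h (z + t *\<^sub>R b + t *\<^sub>R a) - h (z + t *\<^sub>R a) - h (z + t *\<^sub>R b) + h z
      = t\<^sup>2 * (B (z + s *\<^sub>R a + r *\<^sub>R b) b \<bullet> a)"
    using \<psi> \<kappa> by (simp add: \<psi>_def power2_eq_square)
  then show ?thesis using s r by blast
qed

text \<open>The same quotient \<open>q\<close> converges to both mixed second derivatives, because
  the intermediate points contract to \<open>z\<close>, where the derivative is continuous.\<close>

lemma second_derivative_symmetric:
  fixes h :: "'a::real_inner \<Rightarrow> real"
  assumes G: "\<And>z. GDERIV h z :> G z" and B: "\<And>z. (G has_derivative B z) (at z)"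
    and cont: "\<And>w. isCont (\<lambda>z. B z w) z"
  shows "B z a \<bullet> b = B z b \<bullet> a"
proof -
  define \<tau> where "\<tau> n = 1 / real (Suc n)" for n
  define q where "q n = (h (z + \<tau> n *\<^sub>R b + \<tau> n *\<^sub>R a) - h (z + \<tau> n *\<^sub>R a) - h (z + \<tau> n *\<^sub>R b) + h z) / (\<tau> n)\<^sup>2" for n
  have \<tau>: "\<tau> n > 0" for n by (simp add: \<tau>_def)
  have \<tau>0: "\<tau> \<longlonglongrightarrow> 0" unfolding \<tau>_def by (rule LIMSEQ_Suc) (rule lim_1_over_n)
  have lim: "q \<longlonglongrightarrow> B z d \<bullet> c"
    if ex: "\<And>n. \<exists>s r. 0 < s \<and> s < \<tau> n \<and> 0 < r \<and> r < \<tau> n \<and>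
      q n = B (z + s *\<^sub>R c + r *\<^sub>R d) d \<bullet> c" for c d
  proof -
    obtain s r where sr: "\<And>n. 0 < s n \<and> s n < \<tau> n \<and> 0 < r n \<and> r n < \<tau> n \<and>
      q n = B (z + s n *\<^sub>R c + r n *\<^sub>R d) d \<bullet> c" using ex by metis
    have "s \<longlonglongrightarrow> 0" "r \<longlonglongrightarrow> 0"
      by (rule tendsto_sandwich[OF _ _ tendsto_const \<tau>0]; use sr in \<open>auto intro!: always_eventually less_imp_le\<close>)+
    then have "(\<lambda>n. z + s n *\<^sub>R c + r n *\<^sub>R d) \<longlonglongrightarrow> z + 0 *\<^sub>R c + 0 *\<^sub>R d"
      by (intro tendsto_intros)
    then have "(\<lambda>n. B (z + s n *\<^sub>R c + r n *\<^sub>R d) d) \<longlonglongrightarrow> B z d"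
      using isCont_tendsto_compose[OF cont[of d]] by simp
    then have "(\<lambda>n. B (z + s n *\<^sub>R c + r n *\<^sub>R d) d \<bullet> c) \<longlonglongrightarrow> B z d \<bullet> c"
      by (intro tendsto_intros)
    moreover have "q = (\<lambda>n. B (z + s n *\<^sub>R c + r n *\<^sub>R d) d \<bullet> c)" using sr by blast
    ultimately show ?thesis by simp
  qed
  have "q \<longlonglongrightarrow> B z b \<bullet> a"
  proof (rule lim)
    fix n show "\<exists>s r. 0 < s \<and> s < \<tau> n \<and> 0 < r \<and> r < \<tau> n \<and> q n = B (z + s *\<^sub>R a + r *\<^sub>R b) b \<bullet> a"
      using second_difference_mean_value[OF G B \<tau>[of n], of z b a] \<tau>[of n] unfolding q_def
      by (smt (verit) nonzero_mult_div_cancel_left power_not_zero)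
  qed
  moreover have "q \<longlonglongrightarrow> B z a \<bullet> b"
  proof (rule lim)
    fix n show "\<exists>s r. 0 < s \<and> s < \<tau> n \<and> 0 < r \<and> r < \<tau> n \<and> q n = B (z + s *\<^sub>R b + r *\<^sub>R a) a \<bullet> b"
    proof -
      have "h (z + \<tau> n *\<^sub>R b + \<tau> n *\<^sub>R a) - h (z + \<tau> n *\<^sub>R a) - h (z + \<tau> n *\<^sub>R b) + h z
          = h (z + \<tau> n *\<^sub>R a + \<tau> n *\<^sub>R b) - h (z + \<tau> n *\<^sub>R b) - h (z + \<tau> n *\<^sub>R a) + h z"
        by (simp add: add_ac)
      then show ?thesis
        using second_difference_mean_value[OF G B \<tau>[of n], of z a b] \<tau>[of n] unfolding q_def
        by (smt (verit) nonzero_mult_div_cancel_left power_not_zero)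
    qed
  qed
  ultimately show ?thesis by (rule LIMSEQ_unique[symmetric])
qed

text \<open>Kept on the whole product space, since symmetry there is what relates the mixed block to
  its transpose; \<open>jac_xy\<close> and \<open>hess_y\<close> describe its action on vectors
  \<open>(0, w)\<close>.\<close>

definition hess :: "('a::euclidean_space \<Rightarrow> real) \<Rightarrow> 'a \<Rightarrow> 'a \<Rightarrow> 'a" where
  "hess h z = frechet_derivative (grad h) (at z)"

lemma C2_imp_C1: "C2 h \<Longrightarrow> C1 h"
  unfolding C2_def C1_def
  using has_derivative_continuous by (meson continuous_at_imp_continuous_on)

lemma C2_hess:
  fixes h :: "'a::euclidean_space \<Rightarrow> real"
  assumes "C2 h"
  shows "(grad h has_derivative hess h z) (at z)" "isCont (\<lambda>z. hess h z w) z"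
proof -
  obtain h' :: "'a \<Rightarrow> 'a \<Rightarrow>\<^sub>L real" and h'' :: "'a \<Rightarrow> 'a \<Rightarrow>\<^sub>L ('a \<Rightarrow>\<^sub>L real)"
    where h': "\<And>z. (h has_derivative blinfun_apply (h' z)) (at z)"
      and h'': "\<And>z. (h' has_derivative blinfun_apply (h'' z)) (at z)" and c: "continuous_on UNIV h''"
    using assms unfolding C2_def C1_def by blast
  have g: "grad h = (\<lambda>z. \<Sum>b\<in>Basis. blinfun_apply (h' z) b *\<^sub>R b)"
    using grad_eqI[OF has_derivative_GDERIV[OF h']] by blast
  have d: "(grad h has_derivative (\<lambda>w. \<Sum>b\<in>Basis. blinfun_apply (blinfun_apply (h'' z) w) b *\<^sub>R b)) (at z)" for z
    unfolding g
    by (intro has_derivative_sum has_derivative_scaleR_left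
        bounded_linear.has_derivative[OF blinfun.bounded_linear_left] h'')
  then have H: "hess h z = (\<lambda>w. \<Sum>b\<in>Basis. blinfun_apply (blinfun_apply (h'' z) w) b *\<^sub>R b)" for z
    unfolding hess_def using frechet_derivative_at[OF d] by simp
  show "(grad h has_derivative hess h z) (at z)" using d H by simp
  show "isCont (\<lambda>z. hess h z w) z"
    unfolding H using c
    by (intro continuous_sum continuous_scaleR blinfun.continuous continuous_const)
       (auto simp: continuous_on_eq_continuous_at)
qed

lemma hess_symmetric:
  assumes "C2 h"
  shows "hess h z a \<bullet> b = hess h z b \<bullet> a"
  by (rule second_derivative_symmetric[where h = h and G = "grad h"])
     (use assms C2_hess C1_GDERIV C2_imp_C1 in blast)+

lemma linear_hess: "C2 h \<Longrightarrow> linear (hess h z)"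
  using C2_hess(1) has_derivative_linear by blast

lemma jac_xy_mult:
  assumes "C2 g"
  shows "jac_xy g z *v w = fst (hess g z (0, w))"
proof -
  have H: "(grad g has_derivative hess g z) (at (fst z, snd z))"
    using C2_hess(1)[OF assms] by simp
  have "((\<lambda>y. grad g (fst z, y)) has_derivative (\<lambda>w. hess g z (0, w))) (at (snd z))"
    by (rule has_derivative_compose[where f = "\<lambda>y. (fst z, y)" and g = "grad g"])
       (use H in \<open>auto intro!: derivative_eq_intros\<close>)
  then have d: "((\<lambda>y. grad_x g (fst z, y)) has_derivative (\<lambda>w. fst (hess g z (0, w)))) (at (snd z))"
    unfolding grad_x_eq_fst[OF C2_imp_C1[OF assms]] by (rule has_derivative_fst)
  then have "jac_xy g z = matrix (\<lambda>w. fst (hess g z (0, w)))"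
    unfolding jac_xy_def jacobian_def using frechet_derivative_at by metis
  then show ?thesis using has_derivative_linear[OF d] by (simp add: matrix_works)
qed

lemma hess_y_mult:
  assumes "C2 g"
  shows "hess_y g z *v w = snd (hess g z (0, w))"
    and "((\<lambda>y. grad_y g (fst z, y)) has_derivative (\<lambda>w. hess_y g z *v w)) (at (snd z))"
proof -
  have H: "(grad g has_derivative hess g z) (at (fst z, snd z))"
    using C2_hess(1)[OF assms] by simp
  have "((\<lambda>y. grad g (fst z, y)) has_derivative (\<lambda>w. hess g z (0, w))) (at (snd z))"
    by (rule has_derivative_compose[where f = "\<lambda>y. (fst z, y)" and g = "grad g"])
       (use H in \<open>auto intro!: derivative_eq_intros\<close>)
  then have d: "((\<lambda>y. grad_y g (fst z, y)) has_derivative (\<lambda>w. snd (hess g z (0, w)))) (at (snd z))"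
    unfolding grad_y_eq_snd[OF C2_imp_C1[OF assms]] by (rule has_derivative_snd)
  then have "hess_y g z = matrix (\<lambda>w. snd (hess g z (0, w)))"
    unfolding hess_y_def jacobian_def using frechet_derivative_at by metis
  then show e: "hess_y g z *v w = snd (hess g z (0, w))" for w
    using has_derivative_linear[OF d] by (simp add: matrix_works)
  show "((\<lambda>y. grad_y g (fst z, y)) has_derivative (\<lambda>w. hess_y g z *v w)) (at (snd z))"
    using d by (simp add: e)
qed

lemma hess_y_symmetric:
  assumes "C2 g"
  shows "(hess_y g z *v a) \<bullet> b = (hess_y g z *v b) \<bullet> a"
  using hess_symmetric[OF assms, of z "(0, a)" "(0, b)"]
  by (simp add: hess_y_mult[OF assms] inner_prod_def)

text \<open>Symmetry of the full Hessian identifies the x-derivative of \<open>grad_y g\<close> with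
  the transpose of \<open>jac_xy\<close>; this is how the Jacobian enters the gradient of
  \<open>Phi\<close>.\<close>

lemma jac_xy_adjoint:
  assumes "C2 g"
  shows "snd (hess g z (a, 0)) \<bullet> b = (jac_xy g z *v b) \<bullet> a"
  using hess_symmetric[OF assms, of z "(a, 0)" "(0, b)"]
  by (simp add: jac_xy_mult[OF assms] inner_prod_def)

lemma norm_derivative_le_lipschitz:
  assumes H: "(G has_derivative H) (at z)" and L: "L-lipschitz_on UNIV G"
  shows "norm (H w) \<le> L * norm w"
proof (rule tendsto_upperbound[OF tendsto_norm[OF has_derivative_quotient_tendsto[OF H]]])
  show "\<forall>\<^sub>F t in at_right 0. norm ((1 / t) *\<^sub>R (G (z + t *\<^sub>R w) - G z)) \<le> L * norm w"
  proof (rule eventually_at_rightI[of 0 1])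
    fix t :: real assume t: "t \<in> {0<..<1}"
    have "norm (G (z + t *\<^sub>R w) - G z) \<le> L * norm (t *\<^sub>R w)"
      using lipschitz_onD[OF L, of "z + t *\<^sub>R w" z] by (simp add: dist_norm)
    then show "norm ((1 / t) *\<^sub>R (G (z + t *\<^sub>R w) - G z)) \<le> L * norm w"
      using t by (simp add: divide_simps mult_ac)
  qed simp
qed simp

text \<open>The hypothesis is quadratic in the increment: taken at \<open>z + t *\<^sub>R w\<close>
  and divided by t^2, it becomes in the limit a statement on the derivative. Strong monotonicity and
  co-coercivity of a gradient pass to its Hessian this way.\<close>

lemma derivative_inner_lower_bound:
  fixes G :: "'a::real_inner \<Rightarrow> 'a"
  assumes H: "(G has_derivative H) (at z)"
    and ineq: "\<And>a. p * (norm (a - z))\<^sup>2 + q * (norm (G a - G z))\<^sup>2 \<le> (G a - G z) \<bullet> (a - z)"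
  shows "p * (norm w)\<^sup>2 + q * (norm (H w))\<^sup>2 \<le> H w \<bullet> w"
proof -
  note lim = has_derivative_quotient_tendsto[OF H, of w]
  have l1: "((\<lambda>t. p * (norm w)\<^sup>2 + q * (norm ((1 / t) *\<^sub>R (G (z + t *\<^sub>R w) - G z)))\<^sup>2) \<longlongrightarrow>
      p * (norm w)\<^sup>2 + q * (norm (H w))\<^sup>2) (at_right 0)"
    by (intro tendsto_intros lim)
  have l2: "((\<lambda>t. ((1 / t) *\<^sub>R (G (z + t *\<^sub>R w) - G z)) \<bullet> w) \<longlongrightarrow> H w \<bullet> w) (at_right 0)"
    by (intro tendsto_intros lim)
  show ?thesis
  proof (rule tendsto_le[OF _ l2 l1])
    show "\<forall>\<^sub>F t in at_right 0. p * (norm w)\<^sup>2 + q * (norm ((1 / t) *\<^sub>R (G (z + t *\<^sub>R w) - G z)))\<^sup>2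
        \<le> ((1 / t) *\<^sub>R (G (z + t *\<^sub>R w) - G z)) \<bullet> w"
    proof (rule eventually_at_rightI[of 0 1])
      fix t :: real assume t: "t \<in> {0<..<1}"
      let ?d = "G (z + t *\<^sub>R w) - G z"
      have "p * (t\<^sup>2 * (norm w)\<^sup>2) + q * (norm ?d)\<^sup>2 \<le> t * (?d \<bullet> w)"
        using ineq[of "z + t *\<^sub>R w"] by (simp add: power_mult_distrib)
      then have "(p * (t\<^sup>2 * (norm w)\<^sup>2) + q * (norm ?d)\<^sup>2) / t\<^sup>2 \<le> t * (?d \<bullet> w) / t\<^sup>2"
        by (rule divide_right_mono) simp
      then show "p * (norm w)\<^sup>2 + q * (norm ((1 / t) *\<^sub>R ?d))\<^sup>2 \<le> ((1 / t) *\<^sub>R ?d) \<bullet> w"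
        using t by (simp add: power_mult_distrib power_divide add_divide_distrib power2_eq_square[of t])
    qed simp
  qed simp
qed

section \<open>One inexact gradient step\<close>

lemma power2_norm_add_le:
  fixes a b :: "'a::real_inner"
  assumes "0 < s"
  shows "(norm (a + b))\<^sup>2 \<le> (1 + s) * (norm a)\<^sup>2 + (1 + 1 / s) * (norm b)\<^sup>2"
proof -
  have "0 \<le> (sqrt s * norm a - norm b / sqrt s)\<^sup>2" by simp
  then have "2 * (norm a * norm b) \<le> s * (norm a)\<^sup>2 + (norm b)\<^sup>2 / s"
    using assms by (simp add: power2_diff power_mult_distrib power_divide)
  moreover have "(norm (a + b))\<^sup>2 \<le> (norm a + norm b)\<^sup>2"
    by (intro power_mono norm_triangle_ineq) simp
  ultimately show ?thesis by (simp add: power2_sum algebra_simps)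
qed

lemma sum_power2_le: "(a + b)\<^sup>2 \<le> 2 * a\<^sup>2 + 2 * b\<^sup>2" for a b :: real
  using zero_le_power2[of "a - b"] by (simp add: power2_eq_square algebra_simps)

text \<open>Expand the square. The \<open>u\<close>-part of twice the coercivity is split between
  the contraction and the cross term with \<open>e\<close>; the \<open>G\<close>-part, rewritten in
  terms of \<open>D\<close>, covers the quadratic term of the step and leaves a negative multiple of
  the squared norm of \<open>D\<close>. That surplus later pays for the drift of the
  estimators.\<close>

lemma gradient_step_contraction:
  fixes u G e D :: "'a::real_inner"
  assumes coer: "mu / 2 * (norm u)\<^sup>2 + 1 / (2 * L) * (norm G)\<^sup>2 \<le> G \<bullet> u"
    and D: "D = G + e" and mu: "0 < mu" "mu \<le> L" and \<beta>: "0 < \<beta>" "\<beta> < 1"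
    and l: "0 < l" "l \<le> 1 / (2 * L + 2 * mu)"
  shows "(norm (u - (l * \<beta>) *\<^sub>R D))\<^sup>2
    \<le> (1 - l * \<beta> * mu / 2) * (norm u)\<^sup>2 - l * \<beta> * l / 2 * (norm D)\<^sup>2 + 4 * (l * \<beta>) / mu * (norm e)\<^sup>2"
proof -
  define lam where "lam = l * \<beta>"
  have lam: "0 < lam" "lam \<le> l" using l \<beta> by (auto simp: lam_def)
  have lL: "2 * l \<le> 1 / L"
  proof -
    have "2 * l \<le> 2 / (2 * L + 2 * mu)" using l(2) by simp
    also have "\<dots> \<le> 1 / L" using mu by (simp add: field_simps)
    finally show ?thesis .
  qed
  have lmu: "4 * l \<le> 1 / mu"
  proof -
    have "4 * l \<le> 4 / (2 * L + 2 * mu)" using l(2) by simp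
    also have "\<dots> \<le> 1 / mu" using mu by (simp add: field_simps)
    finally show ?thesis .
  qed
  have "(norm (u - lam *\<^sub>R D))\<^sup>2 = (norm u)\<^sup>2 - 2 * lam * (G \<bullet> u) - 2 * lam * (e \<bullet> u) + lam\<^sup>2 * (norm D)\<^sup>2"
    unfolding power2_norm_eq_inner
    by (simp add: D inner_diff_left inner_diff_right inner_add_left inner_add_right inner_commute power2_eq_square
        algebra_simps)
  moreover have "lam * mu * (norm u)\<^sup>2 + 2 * lam * l * (norm G)\<^sup>2 \<le> 2 * lam * (G \<bullet> u)"
  proof -
    have "mu * (norm u)\<^sup>2 + 2 * l * (norm G)\<^sup>2 \<le> mu * (norm u)\<^sup>2 + 1 / L * (norm G)\<^sup>2"
      using lL by (intro add_left_mono mult_right_mono) auto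
    also have "\<dots> \<le> 2 * (G \<bullet> u)" using coer by simp
    finally have "lam * (mu * (norm u)\<^sup>2 + 2 * l * (norm G)\<^sup>2) \<le> lam * (2 * (G \<bullet> u))"
      using lam by (intro mult_left_mono) auto
    then show ?thesis by (simp add: algebra_simps)
  qed
  moreover have "- 2 * lam * (e \<bullet> u) \<le> lam * mu / 2 * (norm u)\<^sup>2 + 2 * lam / mu * (norm e)\<^sup>2"
  proof -
    have "0 \<le> (norm ((mu / 2) *\<^sub>R u + e))\<^sup>2" by simp
    also have "\<dots> = (mu / 2)\<^sup>2 * (norm u)\<^sup>2 + mu * (e \<bullet> u) + (norm e)\<^sup>2"
      unfolding power2_norm_eq_inner
      by (simp add: inner_add_left inner_add_right inner_commute power2_eq_square algebra_simps)
    finally have "- (mu * (e \<bullet> u)) \<le> (mu / 2)\<^sup>2 * (norm u)\<^sup>2 + (norm e)\<^sup>2" by simp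
    then have "(2 * lam / mu) * (- (mu * (e \<bullet> u))) \<le> (2 * lam / mu) * ((mu / 2)\<^sup>2 * (norm u)\<^sup>2 + (norm e)\<^sup>2)"
      using lam mu by (intro mult_left_mono) auto
    then show ?thesis using mu by (simp add: field_simps power2_eq_square)
  qed
  \<comment> \<open>Young with parameter 1/3 has factor 4/3, so 2 becomes 3/2: one unit is spent on
    \<open>lam\<^sup>2\<close>, as \<open>lam \<le> l\<close>, and 1/2 is left over. The error
    factors 2 and 3/2 add up to at most 4.\<close>
  moreover have "2 * lam * l * (norm G)\<^sup>2 \<ge> 3 / 2 * lam * l * (norm D)\<^sup>2 - 3 / 2 * lam / mu * (norm e)\<^sup>2"
  proof -
    have "(norm D)\<^sup>2 \<le> (1 + 1/3) * (norm G)\<^sup>2 + (1 + 1 / (1/3)) * (norm e)\<^sup>2"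
      unfolding D by (rule power2_norm_add_le) simp
    then have "3 / 2 * lam * l * (norm D)\<^sup>2 \<le> 3 / 2 * lam * l * (4/3 * (norm G)\<^sup>2 + 4 * (norm e)\<^sup>2)"
      using lam l by (intro mult_left_mono) auto
    moreover have "6 * lam * l * (norm e)\<^sup>2 \<le> 3 / 2 * lam / mu * (norm e)\<^sup>2"
    proof -
      have "(3 / 2 * lam) * (4 * l) \<le> (3 / 2 * lam) * (1 / mu)" using lmu lam by (intro mult_left_mono) auto
      then show ?thesis by (intro mult_right_mono) (simp_all add: mult_ac)
    qed
    moreover have "3 / 2 * lam * l * (4/3 * (norm G)\<^sup>2 + 4 * (norm e)\<^sup>2)
        = 2 * lam * l * (norm G)\<^sup>2 + 6 * lam * l * (norm e)\<^sup>2" by (simp add: distrib_left)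
    ultimately show ?thesis by linarith
  qed
  moreover have "lam\<^sup>2 * (norm D)\<^sup>2 \<le> lam * l * (norm D)\<^sup>2"
    using lam by (intro mult_right_mono) (auto simp: power2_eq_square)
  moreover have "0 \<le> lam / mu * (norm e)\<^sup>2" using lam mu by simp
  moreover have "(1 - lam * mu / 2) * (norm u)\<^sup>2 = (norm u)\<^sup>2 - lam * mu / 2 * (norm u)\<^sup>2"
    "lam * mu / 2 * (norm u)\<^sup>2 = (lam * mu * (norm u)\<^sup>2) / 2"
    "lam * l / 2 * (norm D)\<^sup>2 = (lam * l * (norm D)\<^sup>2) / 2"
    "3 / 2 * lam * l * (norm D)\<^sup>2 = 3 / 2 * (lam * l * (norm D)\<^sup>2)"
    "4 * lam / mu * (norm e)\<^sup>2 = 4 * (lam / mu * (norm e)\<^sup>2)"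
    "2 * lam / mu * (norm e)\<^sup>2 = 2 * (lam / mu * (norm e)\<^sup>2)"
    "3 / 2 * lam / mu * (norm e)\<^sup>2 = 3 / 2 * (lam / mu * (norm e)\<^sup>2)"
    by (simp_all add: algebra_simps)
  ultimately have "(norm (u - lam *\<^sub>R D))\<^sup>2
    \<le> (1 - lam * mu / 2) * (norm u)\<^sup>2 - lam * l / 2 * (norm D)\<^sup>2 + 4 * lam / mu * (norm e)\<^sup>2"
    by linarith
  then show ?thesis by (simp add: lam_def)
qed

section \<open>Lipschitz estimates for the search directions\<close>

lemma norm_fst_snd_le: "norm (fst z) \<le> norm z" "norm (snd z) \<le> norm z"
  using norm_fst_le[of "fst z" "snd z"] norm_snd_le[of "snd z" "fst z"] by simp_all

lemma norm_matrix_vector_spectral: "norm (A *v w) \<le> spectral_norm A * norm w"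
  unfolding spectral_norm_def by (rule onorm[OF matrix_vector_mul_bounded_linear])

lemma norm_grad_le_lipschitz:
  fixes h :: "'a::real_inner \<Rightarrow> real"
  assumes G: "GDERIV h z :> D" and L: "L-lipschitz_on UNIV h"
  shows "norm D \<le> L"
proof -
  have "norm (D \<bullet> D) \<le> L * norm D"
    by (rule norm_derivative_le_lipschitz[OF _ L]) (use G in \<open>simp add: gderiv_def\<close>)
  then have "norm D * norm D \<le> L * norm D" by (simp flip: power2_norm_eq_inner add: power2_eq_square)
  then show ?thesis using lipschitz_on_nonneg[OF L] by (cases "norm D = 0") auto
qed

lemma lipschitz_constants_nonneg:
  assumes "lipschitz_upper c h" "lipschitz_lower c g"
  shows "0 \<le> c_f c" "0 \<le> L_f c" "0 \<le> L_g c" "0 \<le> L_gxy c" "0 \<le> L_gyy c" "0 \<le> L_gg c"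
  using assms lipschitz_on_nonneg
  by (auto simp: lipschitz_upper_def lipschitz_lower_def spectral_lipschitz_def L_gg_def)

lemma jac_hess_bounds:
  assumes C2: "C2 g" and L: "lipschitz_lower c g"
  shows "norm (jac_xy g z *v w) \<le> L_g c * norm w" "norm (hess_y g z *v w) \<le> L_g c * norm w"
    and "norm (jac_xy g z *v w - jac_xy g z' *v w) \<le> L_gg c * dist z z' * norm w"
    and "norm (hess_y g z *v w - hess_y g z' *v w) \<le> L_gg c * dist z z' * norm w"
proof -
  have Lg: "(L_g c)-lipschitz_on UNIV (grad g)" using L by (simp add: lipschitz_lower_def)
  have h: "norm (hess g z (0, w)) \<le> L_g c * norm w"
    using norm_derivative_le_lipschitz[OF C2_hess(1)[OF C2] Lg, of z "(0, w)"] by simp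
  show "norm (jac_xy g z *v w) \<le> L_g c * norm w" "norm (hess_y g z *v w) \<le> L_g c * norm w"
    unfolding jac_xy_mult[OF C2] hess_y_mult(1)[OF C2]
    using h norm_fst_snd_le[of "hess g z (0, w)"] by linarith+
  have *: "norm (A z *v w - A z' *v w) \<le> L_gg c * dist z z' * norm w"
    if A: "spectral_lipschitz l A" "l \<le> L_gg c" for A :: "_ \<Rightarrow> real^'n^'m" and l and w :: "real^'n"
  proof -
    have "norm (A z *v w - A z' *v w) \<le> spectral_norm (A z - A z') * norm w"
      using norm_matrix_vector_spectral[of "A z - A z'" w] by (simp add: matrix_vector_mult_diff_rdistrib)
    also have "\<dots> \<le> (l * dist z z') * norm w"
      by (intro mult_right_mono) (use A(1) in \<open>unfold spectral_lipschitz_def, blast, simp\<close>)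
    also have "\<dots> \<le> (L_gg c * dist z z') * norm w"
      using A(2) by (intro mult_right_mono) auto
    finally show ?thesis .
  qed
  show "norm (jac_xy g z *v w - jac_xy g z' *v w) \<le> L_gg c * dist z z' * norm w"
    by (rule *[of "L_gxy c"]) (use L in \<open>auto simp: lipschitz_lower_def L_gg_def\<close>)
  show "norm (hess_y g z *v w - hess_y g z' *v w) \<le> L_gg c * dist z z' * norm w"
    by (rule *[of "L_gyy c"]) (use L in \<open>auto simp: lipschitz_lower_def L_gg_def\<close>)
qed

lemma grad_components_lipschitz:
  fixes h :: "(real^'p) \<times> (real^'q) \<Rightarrow> real"
  assumes "C1 h" and L: "L-lipschitz_on UNIV (grad h)"
  shows "norm (grad_x h z - grad_x h z') \<le> L * dist z z'" "norm (grad_y h z - grad_y h z') \<le> L * dist z z'"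
  using lipschitz_onD[OF L, of z z'] norm_fst_snd_le[of "grad h z - grad h z'"]
  by (simp_all add: grad_x_eq_fst[OF assms(1)] grad_y_eq_snd[OF assms(1)] dist_norm)

text \<open>The matrix difference is applied to \<open>v\<close> and the matrix at the second point
  to \<open>v - v'\<close>, so that only the first of the two vectors has to lie in the
  ball.\<close>

lemma dir_diff:
  assumes f: "C1 f" "lipschitz_upper c f" and g: "C2 g" "lipschitz_lower c g" and v: "norm v \<le> M"
  shows "norm (dir_x f g (x, y, v) - dir_x f g (x', y', v'))
      \<le> (L_f c + M * L_gg c) * dist (x, y) (x', y') + L_g c * norm (v - v')"
    and "norm (dir_v f g (x, y, v) - dir_v f g (x', y', v'))
      \<le> (L_f c + M * L_gg c) * dist (x, y) (x', y') + L_g c * norm (v - v')"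
proof -
  let ?d = "dist (x, y) (x', y')"
  have fL: "(L_f c)-lipschitz_on UNIV (grad f)" using f(2) by (simp add: lipschitz_upper_def)
  have lv: "L_gg c * ?d * norm v \<le> M * L_gg c * ?d"
    using mult_left_mono[OF v, of "L_gg c * ?d"] lipschitz_constants_nonneg[OF f(2) g(2)] by (simp add: mult_ac)
  have "dir_x f g (x, y, v) - dir_x f g (x', y', v') = (grad_x f (x, y) - grad_x f (x', y'))
     - (jac_xy g (x, y) *v v - jac_xy g (x', y') *v v) - jac_xy g (x', y') *v (v - v')"
    by (simp add: dir_x_def matrix_vector_mult_diff_distrib)
  then have "norm (dir_x f g (x, y, v) - dir_x f g (x', y', v')) \<le> norm (grad_x f (x, y) - grad_x f (x', y'))
     + norm (jac_xy g (x, y) *v v - jac_xy g (x', y') *v v) + norm (jac_xy g (x', y') *v (v - v'))"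
    using norm_triangle_ineq4 by (smt (verit))
  also have "\<dots> \<le> L_f c * ?d + M * L_gg c * ?d + L_g c * norm (v - v')"
    by (intro add_mono grad_components_lipschitz[OF f(1) fL] jac_hess_bounds[OF g]
          order_trans[OF jac_hess_bounds(3)[OF g] lv])
  finally show "norm (dir_x f g (x, y, v) - dir_x f g (x', y', v'))
      \<le> (L_f c + M * L_gg c) * ?d + L_g c * norm (v - v')" by (simp add: algebra_simps)
  have "dir_v f g (x, y, v) - dir_v f g (x', y', v') = (hess_y g (x, y) *v v - hess_y g (x', y') *v v)
     + hess_y g (x', y') *v (v - v') - (grad_y f (x, y) - grad_y f (x', y'))"
    by (simp add: dir_v_def matrix_vector_mult_diff_distrib)
  then have "norm (dir_v f g (x, y, v) - dir_v f g (x', y', v')) \<le> norm (grad_y f (x, y) - grad_y f (x', y'))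
     + norm (hess_y g (x, y) *v v - hess_y g (x', y') *v v) + norm (hess_y g (x', y') *v (v - v'))"
    using norm_triangle_ineq4 norm_triangle_ineq by (smt (verit))
  also have "\<dots> \<le> L_f c * ?d + M * L_gg c * ?d + L_g c * norm (v - v')"
    by (intro add_mono grad_components_lipschitz[OF f(1) fL] jac_hess_bounds[OF g]
          order_trans[OF jac_hess_bounds(4)[OF g] lv])
  finally show "norm (dir_v f g (x, y, v) - dir_v f g (x', y', v'))
      \<le> (L_f c + M * L_gg c) * ?d + L_g c * norm (v - v')" by (simp add: algebra_simps)
qed

text \<open>Explains the 4 in \<open>M1_bar\<close>: one factor 2 comes from splitting
  \<open>L_f\<close> and \<open>M * L_gg\<close>, the other from separating the (x, y)-part of a
  difference from its v-part.\<close>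

lemma M1_bar_ge:
  assumes "0 \<le> d"
  shows "2 * ((L_f c + M * L_gg c) * d)\<^sup>2 \<le> M1_bar c M * d\<^sup>2"
proof -
  have "2 * (L_f c + M * L_gg c)\<^sup>2 \<le> M1_bar c M"
    using sum_power2_le[of "L_f c" "M * L_gg c"] by (simp add: M1_bar_def power_mult_distrib)
  then show ?thesis using mult_right_mono[of _ _ "d\<^sup>2"] by (fastforce simp: power_mult_distrib)
qed

lemma le_add_imp_power2_le: "0 \<le> n \<Longrightarrow> n \<le> a + b \<Longrightarrow> n\<^sup>2 \<le> 2 * a\<^sup>2 + 2 * b\<^sup>2" for a b n :: real
  using sum_power2_le[of a b] power_mono[of n "a + b" 2] by linarith

lemma dir_diff_power2:
  assumes f: "C1 f" "lipschitz_upper c f" and g: "C2 g" "lipschitz_lower c g" and v: "norm v \<le> M"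
  shows "(norm (dir_x f g (x, y, v) - dir_x f g (x', y', v')))\<^sup>2
      \<le> M1_bar c M * ((norm (x - x'))\<^sup>2 + (norm (y - y'))\<^sup>2) + 2 * (L_g c)\<^sup>2 * (norm (v - v'))\<^sup>2"
    and "(norm (dir_v f g (x, y, v) - dir_v f g (x', y', v')))\<^sup>2
      \<le> M1_bar c M * ((norm (x - x'))\<^sup>2 + (norm (y - y'))\<^sup>2) + 2 * (L_g c)\<^sup>2 * (norm (v - v'))\<^sup>2"
proof -
  have d: "(dist (x, y) (x', y'))\<^sup>2 = (norm (x - x'))\<^sup>2 + (norm (y - y'))\<^sup>2"
    by (simp add: dist_norm norm_Pair)
  have m: "2 * ((L_f c + M * L_gg c) * dist (x, y) (x', y'))\<^sup>2 \<le> M1_bar c M * ((norm (x - x'))\<^sup>2 + (norm (y - y'))\<^sup>2)"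
    using M1_bar_ge[of "dist (x, y) (x', y')" c M] by (simp only: d) simp
  note le_add_imp_power2_le[OF norm_ge_zero dir_diff(1)[OF f g v, of x y x' y' v']]
    le_add_imp_power2_le[OF norm_ge_zero dir_diff(2)[OF f g v, of x y x' y' v']]
  with m show "(norm (dir_x f g (x, y, v) - dir_x f g (x', y', v')))\<^sup>2
      \<le> M1_bar c M * ((norm (x - x'))\<^sup>2 + (norm (y - y'))\<^sup>2) + 2 * (L_g c)\<^sup>2 * (norm (v - v'))\<^sup>2"
    and "(norm (dir_v f g (x, y, v) - dir_v f g (x', y', v')))\<^sup>2
      \<le> M1_bar c M * ((norm (x - x'))\<^sup>2 + (norm (y - y'))\<^sup>2) + 2 * (L_g c)\<^sup>2 * (norm (v - v'))\<^sup>2"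
    by (simp_all add: power_mult_distrib)
qed

lemma dir_y_diff_power2:
  assumes g: "C2 g" "lipschitz_lower c g"
  shows "(norm (dir_y g (x, y) - dir_y g (x', y')))\<^sup>2 \<le> (L_g c)\<^sup>2 * ((norm (x - x'))\<^sup>2 + (norm (y - y'))\<^sup>2)"
proof -
  have "norm (dir_y g (x, y) - dir_y g (x', y')) \<le> L_g c * dist (x, y) (x', y')"
    unfolding dir_y_def
    by (rule grad_components_lipschitz[OF C2_imp_C1[OF g(1)]]) (use g in \<open>simp add: lipschitz_lower_def\<close>)
  then have "(norm (dir_y g (x, y) - dir_y g (x', y')))\<^sup>2 \<le> (L_g c * dist (x, y) (x', y'))\<^sup>2"
    by (intro power_mono) auto
  then show ?thesis by (simp add: dist_norm norm_Pair power_mult_distrib)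
qed

section \<open>The lower-level solution and the gradient of the objective\<close>

lemma affine_imp_convex_on:
  fixes \<phi> :: "'a::real_inner \<Rightarrow> real"
  assumes "\<And>x. \<phi> x = a + D \<bullet> x"
  shows "convex_on UNIV \<phi>"
proof (rule convex_onI)
  fix t :: real and x y assume "0 < t" "t < 1"
  show "\<phi> ((1 - t) *\<^sub>R x + t *\<^sub>R y) \<le> (1 - t) * \<phi> x + t * \<phi> y"
    unfolding assms by (simp add: inner_add_right algebra_simps)
qed simp

text \<open>With constant 0 the upper bound holds for \<open>\<phi>\<close> and for its negative,
  and the two meet.\<close>

lemma zero_lipschitz_gradient_imp_affine:
  fixes \<phi> :: "'a::real_inner \<Rightarrow> real"
  assumes G: "\<And>z. GDERIV \<phi> z :> G z" and L: "0-lipschitz_on UNIV G"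
  shows "\<phi> x = \<phi> 0 + G 0 \<bullet> x"
proof -
  have "\<And>z. GDERIV (\<lambda>z. - \<phi> z) z :> - G z" using G by (rule GDERIV_minus)
  moreover have "0-lipschitz_on UNIV (\<lambda>z. - G z)"
    using L by (simp add: lipschitz_on_def)
  ultimately show ?thesis
    using Lipschitz_gradient_upper_bound[OF G L, of 0 x]
      Lipschitz_gradient_upper_bound[of "\<lambda>z. - \<phi> z" "\<lambda>z. - G z" 0 0 x] by simp
qed

text \<open>The sample-free part of the assumptions. Nonconvexity is what makes \<open>L_Phi\<close>
  and \<open>M1_bar\<close> positive, and with them the step sizes.\<close>

locale bilevel =
  fixes c :: problem_consts and f g :: "(real^'p) \<times> (real^'q) \<Rightarrow> real" and M :: real
  assumes C1_f: "C1 f" and C2_g: "C2 g" and mu_pos: "0 < c_mu c"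
    and sc: "\<And>x. strongly_convex (c_mu c) (\<lambda>y. g (x, y))"
    and nonconvex: "\<not> convex_on UNIV (Phi f g)" and bdd: "bdd_below (range (Phi f g))"
    and upper: "lipschitz_upper c f" and lower: "lipschitz_lower c g"
    and M_ge: "c_f c / c_mu c \<le> M"
begin

abbreviation mu where "mu \<equiv> c_mu c"
abbreviation Lg where "Lg \<equiv> L_g c"
abbreviation M1 where "M1 \<equiv> M1_bar c M"

lemmas consts_nonneg = lipschitz_constants_nonneg[OF upper lower]

lemma M_nonneg: "0 \<le> M"
  using M_ge mu_pos consts_nonneg(1) by (smt (verit) divide_nonneg_pos)

lemma GDERIV_g: "GDERIV (\<lambda>y. g (x, y)) y :> grad_y g (x, y)"
  using GDERIV_snd[OF C1_GDERIV[OF C2_imp_C1[OF C2_g]], of "(x, y)"] grad_y_eq_snd[OF C2_imp_C1[OF C2_g]]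
  by simp

lemma grad_y_lipschitz: "(Lg)-lipschitz_on UNIV (\<lambda>y. grad_y g (x, y))"
  using grad_components_lipschitz(2)[OF C2_imp_C1[OF C2_g], of "Lg" "(x, _)" "(x, _)"] lower consts_nonneg
  by (auto simp: lipschitz_lower_def lipschitz_on_def dist_norm norm_Pair)

lemma grad_y_lipschitz_x: "norm (grad_y g (x, y) - grad_y g (x', y)) \<le> Lg * norm (x - x')"
  using grad_components_lipschitz(2)[OF C2_imp_C1[OF C2_g], of "Lg" "(x, y)" "(x', y)"] lower
  by (auto simp: lipschitz_lower_def dist_norm norm_Pair)

text \<open>Strong monotonicity and the Lipschitz bound are compared at 0 and a unit vector, which
  exists since an index type is never empty.\<close>

lemma mu_le_Lg: "mu \<le> Lg"
proof -
  let ?e = "axis undefined 1 :: real^'q"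
  have "mu * (norm (?e - 0))\<^sup>2 \<le> (grad_y g (0, ?e) - grad_y g (0, 0)) \<bullet> (?e - 0)"
    by (rule strongly_monotone_gradient[OF sc GDERIV_g])
  also have "\<dots> \<le> norm (grad_y g (0, ?e) - grad_y g (0, 0)) * norm (?e - 0)"
    by (rule norm_cauchy_schwarz)
  also have "\<dots> \<le> (Lg * norm (?e - 0)) * norm (?e - 0)"
    using lipschitz_onD[OF grad_y_lipschitz, of ?e 0 0] by (intro mult_right_mono) (auto simp: dist_norm)
  finally show ?thesis by (simp add: norm_axis_1)
qed

lemma Lg_pos: "0 < Lg" using mu_le_Lg mu_pos by simp

section \<open>The lower-level minimiser\<close>

abbreviation ys :: "real^'p \<Rightarrow> real^'q" where "ys \<equiv> y_star g"

text \<open>\<open>arg_min\<close> is a choice, so a minimiser has to exist first: outside a large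
  ball strong convexity keeps \<open>g\<close> above its value at y = 0, and on the ball compactness
  applies.\<close>

lemma ys_minimizer: "g (x, ys x) \<le> g (x, y)"
proof -
  define D where "D = grad_y g (x, 0)"
  \<comment> \<open>From this radius on the quadratic term of the lower bound at 0 dominates the
    linear one.\<close>
  define R where "R = 2 * norm D / mu"
  have R: "0 \<le> R" using mu_pos by (simp add: R_def)
  have "continuous_on (cball 0 R) (\<lambda>y. g (x, y))"
    using GDERIV_g unfolding gderiv_def
    by (meson continuous_at_imp_continuous_on has_derivative_continuous)
  then have "\<exists>y0\<in>cball 0 R. \<forall>y\<in>cball 0 R. g (x, y0) \<le> g (x, y)"
    using R by (intro continuous_attains_inf) auto
  then obtain y0 where y0: "\<And>y. y \<in> cball 0 R \<Longrightarrow> g (x, y0) \<le> g (x, y)" by blast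
  have min: "g (x, y0) \<le> g (x, y)" for y
  proof (cases "norm y \<le> R")
    case False
    have "g (x, 0) + D \<bullet> (y - 0) + mu / 2 * (norm (y - 0))\<^sup>2 \<le> g (x, y)"
      unfolding D_def by (rule strongly_convex_lower_bound[OF sc GDERIV_g])
    moreover have "0 \<le> D \<bullet> y + mu / 2 * (norm y)\<^sup>2"
    proof -
      have "norm D * norm y \<le> (mu / 2 * norm y) * norm y"
        using False mu_pos by (intro mult_right_mono) (auto simp: R_def field_simps)
      moreover have "- (D \<bullet> y) \<le> norm D * norm y"
        using norm_cauchy_schwarz[of "- D" y] by simp
      ultimately show ?thesis by (simp add: power2_eq_square)
    qed
    ultimately have "g (x, 0) \<le> g (x, y)" by simp
    then show ?thesis using y0[of 0] R by simp
  qed (use y0 in auto)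
  then have "is_arg_min (\<lambda>y. g (x, y)) (\<lambda>_. True) y0" by (auto simp: is_arg_min_def not_less)
  then have "is_arg_min (\<lambda>y. g (x, y)) (\<lambda>_. True) (ys x)"
    unfolding y_star_def arg_min_def by (rule someI)
  then show ?thesis by (auto simp: is_arg_min_def not_less)
qed

text \<open>Otherwise a gradient step of length \<open>1 / Lg\<close> would take \<open>g\<close>
  below its minimum.\<close>

lemma grad_y_ys [simp]: "grad_y g (x, ys x) = 0"
proof -
  define D where "D = grad_y g (x, ys x)"
  have "g (x, ys x) \<le> g (x, ys x + (- (1 / Lg)) *\<^sub>R D)" by (rule ys_minimizer)
  also have "\<dots> \<le> g (x, ys x) + D \<bullet> ((- (1 / Lg)) *\<^sub>R D) + Lg / 2 * (norm ((- (1 / Lg)) *\<^sub>R D))\<^sup>2"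
    unfolding D_def by (rule Lipschitz_gradient_upper_bound[OF GDERIV_g grad_y_lipschitz])
  also have "\<dots> = g (x, ys x) - 1 / (2 * Lg) * (norm D)\<^sup>2"
    using Lg_pos by (simp add: power_mult_distrib power_divide power2_norm_eq_inner power2_eq_square[of "Lg"] field_simps)
  finally have "1 / (2 * Lg) * (norm D)\<^sup>2 \<le> 0" by simp
  then have "(norm D)\<^sup>2 \<le> 0" using Lg_pos by (simp add: mult_le_0_iff divide_le_0_iff)
  then show ?thesis by (simp add: D_def)
qed

lemma coercive_y:
  "mu / 2 * (norm (y - ys x))\<^sup>2 + 1 / (2 * Lg) * (norm (grad_y g (x, y)))\<^sup>2 \<le> grad_y g (x, y) \<bullet> (y - ys x)"
  using strongly_convex_cocoercive[OF sc[of x] _ GDERIV_g grad_y_lipschitz Lg_pos, of y "ys x"] mu_pos by simp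

lemma norm_le_of_coercive:
  fixes w :: "'z::real_inner"
  assumes "mu * (norm w)\<^sup>2 \<le> b \<bullet> w" "norm b \<le> B"
  shows "norm w \<le> B / mu"
proof (cases "w = 0")
  case True then show ?thesis using order_trans[OF norm_ge_zero assms(2)] mu_pos by simp
next
  case False
  have "mu * norm w * norm w \<le> norm b * norm w"
    using assms(1) norm_cauchy_schwarz[of b w] by (simp add: power2_eq_square mult.assoc)
  then have "mu * norm w \<le> norm b" using False by simp
  then show ?thesis using assms(2) mu_pos by (simp add: field_simps)
qed

lemma ys_lipschitz: "norm (ys x - ys x') \<le> C_y c * norm (x - x')"
proof -
  have "mu * (norm (ys x - ys x'))\<^sup>2 \<le> (grad_y g (x, ys x) - grad_y g (x, ys x')) \<bullet> (ys x - ys x')"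
    by (rule strongly_monotone_gradient[OF sc GDERIV_g])
  \<comment> \<open>Both gradients at the minimisers vanish, so one may replace the other; the
    remaining difference is in x alone.\<close>
  then have "mu * (norm (ys x - ys x'))\<^sup>2 \<le> (grad_y g (x', ys x') - grad_y g (x, ys x')) \<bullet> (ys x - ys x')"
    by (simp add: inner_diff_left)
  from norm_le_of_coercive[OF this grad_y_lipschitz_x] show ?thesis
    by (simp add: C_y_def norm_minus_commute)
qed

lemma C_y_nonneg: "0 \<le> C_y c" using consts_nonneg mu_pos by (simp add: C_y_def)

text \<open>The two parts are added rather than combined in quadrature: the factor
  \<open>1 + L_g c / c_mu c\<close> in \<open>C_v\<close> has this origin.\<close>

lemma dist_ys: "dist (x, ys x) (x', ys x') \<le> (1 + C_y c) * norm (x - x')"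
proof -
  have "dist (x, ys x) (x', ys x') \<le> norm (x - x') + norm (ys x - ys x')"
    using norm_triangle_ineq[of "(x - x', 0)" "(0, ys x - ys x')"] by (simp add: dist_norm)
  then show ?thesis using ys_lipschitz[of x x'] by (simp add: distrib_right)
qed

lemma hess_coercive:
  "mu * (norm w)\<^sup>2 \<le> (hess_y g z *v w) \<bullet> w"
  "mu / 2 * (norm w)\<^sup>2 + 1 / (2 * Lg) * (norm (hess_y g z *v w))\<^sup>2 \<le> (hess_y g z *v w) \<bullet> w"
proof -
  note d = hess_y_mult(2)[OF C2_g, of z]
  have "mu * (norm w)\<^sup>2 + 0 * (norm (hess_y g z *v w))\<^sup>2 \<le> (hess_y g z *v w) \<bullet> w"
    using strongly_monotone_gradient[OF sc[of "fst z"] GDERIV_g, of _ "snd z"]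
    by (intro derivative_inner_lower_bound[OF d]) simp
  then show "mu * (norm w)\<^sup>2 \<le> (hess_y g z *v w) \<bullet> w" by simp
  show "mu / 2 * (norm w)\<^sup>2 + 1 / (2 * Lg) * (norm (hess_y g z *v w))\<^sup>2 \<le> (hess_y g z *v w) \<bullet> w"
    using mu_pos
    by (intro derivative_inner_lower_bound[OF d] strongly_convex_cocoercive[OF sc[of "fst z"] _ GDERIV_g grad_y_lipschitz Lg_pos]) simp
qed

section \<open>The adjoint vector\<close>

definition vs :: "real^'p \<Rightarrow> real^'q" where
  "vs x = inv (\<lambda>w. hess_y g (x, ys x) *v w) (grad_y f (x, ys x))"

text \<open>Coercivity makes the Hessian injective, hence surjective in finite dimension.\<close>

lemma hess_vs: "hess_y g (x, ys x) *v vs x = grad_y f (x, ys x)"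
proof -
  have "inj (\<lambda>w. hess_y g (x, ys x) *v w)"
  proof (rule injI)
    fix a b assume "hess_y g (x, ys x) *v a = hess_y g (x, ys x) *v b"
    then have "mu * (norm (a - b))\<^sup>2 \<le> 0"
      using hess_coercive(1)[of "a - b" "(x, ys x)"] by (simp add: matrix_vector_mult_diff_distrib)
    then show "a = b" using mu_pos by (simp add: mult_le_0_iff)
  qed
  then have "surj (\<lambda>w. hess_y g (x, ys x) *v w)"
    by (intro linear_injective_imp_surjective) auto
  then show ?thesis unfolding vs_def by (rule surj_f_inv_f)
qed

lemma norm_grad_f: "norm (grad_x f z) \<le> c_f c" "norm (grad_y f z) \<le> c_f c"
  using norm_grad_le_lipschitz[OF C1_GDERIV[OF C1_f], of "c_f c" z] upper norm_fst_snd_le[of "grad f z"]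
  by (auto simp: lipschitz_upper_def grad_x_eq_fst[OF C1_f] grad_y_eq_snd[OF C1_f])

lemma norm_vs: "norm (vs x) \<le> c_f c / mu"
  using hess_coercive(1)[of "vs x" "(x, ys x)"] by (intro norm_le_of_coercive[OF _ norm_grad_f(2)]) (simp add: hess_vs)

lemma norm_vs_le_M: "norm (vs x) \<le> M" using norm_vs M_ge by (rule order_trans)

lemma vs_lipschitz: "norm (vs x - vs x') \<le> C_v c * norm (x - x')"
proof -
  let ?H = "hess_y g (x, ys x)" and ?H' = "hess_y g (x', ys x')"
  let ?B = "(L_f c + L_gg c * (c_f c / mu)) * ((1 + C_y c) * norm (x - x'))"
  let ?d = "dist (x, ys x) (x', ys x')"
  \<comment> \<open>Difference of the two linear systems, arranged so that the Hessian difference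
    acts on \<open>vs x'\<close>, whose norm is at most \<open>c_f c / mu\<close>.\<close>
  have eq: "?H *v (vs x - vs x') = (grad_y f (x, ys x) - grad_y f (x', ys x')) - (?H *v vs x' - ?H' *v vs x')"
    by (simp add: matrix_vector_mult_diff_distrib hess_vs)
  have "norm (?H *v (vs x - vs x')) \<le> L_f c * ?d + L_gg c * ?d * norm (vs x')"
    unfolding eq using upper
    by (intro order_trans[OF norm_triangle_ineq4] add_mono grad_components_lipschitz[OF C1_f] jac_hess_bounds[OF C2_g lower])
       (simp add: lipschitz_upper_def)
  also have "\<dots> \<le> L_f c * ?d + L_gg c * ?d * (c_f c / mu)"
    using consts_nonneg norm_vs by (intro add_left_mono mult_left_mono) auto
  also have "\<dots> = (L_f c + L_gg c * (c_f c / mu)) * ?d" by (simp add: algebra_simps)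
  also have "\<dots> \<le> ?B"
    using consts_nonneg mu_pos by (intro mult_left_mono dist_ys) auto
  finally have b: "norm (?H *v (vs x - vs x')) \<le> ?B" .
  have "norm (vs x - vs x') \<le> ?B / mu"
    by (rule norm_le_of_coercive[OF hess_coercive(1) b])
  also have "\<dots> = C_v c * norm (x - x')"
    using mu_pos by (simp add: C_v_def C_y_def power2_eq_square field_simps)
  finally show ?thesis .
qed

section \<open>The gradient of the objective and its Lipschitz constant\<close>

definition gradPhi :: "real^'p \<Rightarrow> real^'p" where "gradPhi x = dir_x f g (x, ys x, vs x)"

lemma gradPhi_eq: "gradPhi x = grad_x f (x, ys x) - jac_xy g (x, ys x) *v vs x"
  by (simp add: gradPhi_def dir_x_def)

lemma has_derivative_remainder:
  assumes "(h has_derivative h') (at z)" "0 < e"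
  obtains d where "0 < d" "\<And>z'. norm (z' - z) < d \<Longrightarrow> norm (h z' - h z - h' (z' - z)) \<le> e * norm (z' - z)"
  using assms unfolding has_derivative_at_alt by blast

lemma GDERIV_Phi: "GDERIV (Phi f g) x :> gradPhi x"
  unfolding gderiv_def has_derivative_at_alt
proof (intro conjI allI impI)
  show "bounded_linear (\<lambda>w. w \<bullet> gradPhi x)" by (rule bounded_linear_inner_left)
  fix e :: real assume e: "0 < e"
  let ?z = "(x, ys x)"
  \<comment> \<open>Lipschitz factor of the map from x to \<open>(x, ys x)\<close>: remainders small
    relative to the move along this graph are then small relative to \<open>dx\<close>.\<close>
  define k where "k = 1 + C_y c"
  have k: "0 < k" using C_y_nonneg by (simp add: k_def)
  define e' where "e' = e / (k * (1 + norm (vs x)))"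
  have e': "0 < e'" using e k by (simp add: e'_def add_pos_nonneg)
  obtain d1 where d1: "0 < d1" "\<And>z'. norm (z' - ?z) < d1 \<Longrightarrow>
      norm (f z' - f ?z - (z' - ?z) \<bullet> grad f ?z) \<le> e' * norm (z' - ?z)"
    using has_derivative_remainder[OF C1_GDERIV[OF C1_f, of ?z, unfolded gderiv_def] e'] by blast
  obtain d2 where d2: "0 < d2" "\<And>z'. norm (z' - ?z) < d2 \<Longrightarrow>
      norm (grad g z' - grad g ?z - hess g ?z (z' - ?z)) \<le> e' * norm (z' - ?z)"
    using has_derivative_remainder[OF C2_hess(1)[OF C2_g] e'] by blast
  show "\<exists>d>0. \<forall>x'. norm (x' - x) < d \<longrightarrow>
      norm (Phi f g x' - Phi f g x - (x' - x) \<bullet> gradPhi x) \<le> e * norm (x' - x)"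
  proof (intro exI[of _ "min d1 d2 / k"] conjI allI impI)
    show "0 < min d1 d2 / k" using d1 d2 k by simp
    fix x' assume x': "norm (x' - x) < min d1 d2 / k"
    define dx dy where "dx = x' - x" and "dy = ys x' - ys x"
    have z: "(x', ys x') - ?z = (dx, dy)" by (simp add: dx_def dy_def)
    have nz: "norm (dx, dy) \<le> k * norm dx"
      using dist_ys[of x' x] by (simp add: k_def dx_def dy_def dist_norm)
    have "k * norm dx < min d1 d2" using x' k by (simp add: dx_def field_simps)
    then have small: "norm ((x', ys x') - ?z) < d1" "norm ((x', ys x') - ?z) < d2" using nz z by auto
    define rf where "rf = f (x', ys x') - f ?z - (dx, dy) \<bullet> grad f ?z"
    \<comment> \<open>Remainder of the y-gradient. As that gradient vanishes at both points of the
      graph, the expansion becomes a linear equation for \<open>dy\<close> with error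
      \<open>rg\<close>.\<close>
    define rg where "rg = snd (grad g (x', ys x') - grad g ?z - hess g ?z (dx, dy))"
    have rf: "\<bar>rf\<bar> \<le> e' * norm (dx, dy)" using d1(2)[OF small(1)] by (simp add: rf_def dx_def dy_def)
    have rg: "norm rg \<le> e' * norm (dx, dy)"
      using d2(2)[OF small(2)] norm_fst_snd_le(2)[of "grad g (x', ys x') - grad g ?z - hess g ?z (dx, dy)"]
      unfolding z rg_def by linarith
    have "hess g ?z (dx, dy) = hess g ?z (dx, 0) + hess g ?z (0, dy)"
      using linear_add[OF linear_hess[OF C2_g], of ?z "(dx, 0)" "(0, dy)"] by simp
    moreover have "snd (grad g (x', ys x')) = 0" "snd (grad g ?z) = 0"
      using grad_y_ys by (simp_all add: grad_y_eq_snd[OF C2_imp_C1[OF C2_g], symmetric])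
    ultimately have H: "hess_y g ?z *v dy = - rg - snd (hess g ?z (dx, 0))"
      by (simp add: rg_def hess_y_mult(1)[OF C2_g])
    \<comment> \<open>Here \<open>dy\<close> is eliminated: \<open>grad_y f\<close> is the Hessian
      applied to \<open>vs x\<close>, symmetry moves the Hessian onto \<open>dy\<close>, and the
      linear equation leaves only \<open>dx\<close> and the remainder.\<close>
    have "dy \<bullet> grad_y f ?z = (hess_y g ?z *v dy) \<bullet> vs x"
      using hess_y_symmetric[OF C2_g, of ?z "vs x" dy] by (simp add: hess_vs inner_commute)
    also have "\<dots> = - (rg \<bullet> vs x) - dx \<bullet> (jac_xy g ?z *v vs x)"
      unfolding H inner_diff_left jac_xy_adjoint[OF C2_g] by (simp add: inner_commute)
    finally have dy: "dy \<bullet> grad_y f ?z = - (rg \<bullet> vs x) - dx \<bullet> (jac_xy g ?z *v vs x)" .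
    have "Phi f g x' - Phi f g x - (x' - x) \<bullet> gradPhi x = rf - rg \<bullet> vs x"
      using dy by (simp add: Phi_def rf_def gradPhi_eq inner_prod_def grad_x_eq_fst[OF C1_f, symmetric]
          grad_y_eq_snd[OF C1_f, symmetric] dx_def[symmetric] inner_diff_right)
    moreover have "\<bar>rg \<bullet> vs x\<bar> \<le> e' * norm (dx, dy) * norm (vs x)"
      using Cauchy_Schwarz_ineq2[of rg "vs x"] mult_right_mono[OF rg norm_ge_zero[of "vs x"]] by linarith
    ultimately have "norm (Phi f g x' - Phi f g x - (x' - x) \<bullet> gradPhi x) \<le> e' * (1 + norm (vs x)) * norm (dx, dy)"
      using rf by (simp add: algebra_simps)
    also have "\<dots> \<le> e' * (1 + norm (vs x)) * (k * norm dx)"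
      using e' nz by (intro mult_left_mono) (auto simp: add_nonneg_nonneg)
    also have "\<dots> = e * norm (x' - x)"
    proof -
      have "k * (1 + norm (vs x)) \<noteq> 0" using k by (smt (verit) mult_eq_0_iff norm_ge_zero)
      then show ?thesis by (simp add: e'_def dx_def field_simps)
    qed
    finally show "norm (Phi f g x' - Phi f g x - (x' - x) \<bullet> gradPhi x) \<le> e * norm (x' - x)" .
  qed
qed

lemma grad_Phi: "grad (Phi f g) x = gradPhi x"
  by (rule grad_eqI[OF GDERIV_Phi])

lemma L_Phi_nonneg: "0 \<le> L_Phi c"
  using consts_nonneg mu_pos unfolding L_Phi_def by simp

lemma gradPhi_lipschitz: "(L_Phi c)-lipschitz_on UNIV gradPhi"
proof (rule lipschitz_onI)
  fix x x' :: "real^'p"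
  let ?z = "(x, ys x)" and ?z' = "(x', ys x')" and ?d = "(1 + C_y c) * norm (x - x')"
  have "gradPhi x - gradPhi x' = (grad_x f ?z - grad_x f ?z')
     - (jac_xy g ?z *v vs x - jac_xy g ?z' *v vs x) - jac_xy g ?z' *v (vs x - vs x')"
    by (simp add: gradPhi_eq matrix_vector_mult_diff_distrib)
  then have "norm (gradPhi x - gradPhi x') \<le> norm (grad_x f ?z - grad_x f ?z')
     + norm (jac_xy g ?z *v vs x - jac_xy g ?z' *v vs x) + norm (jac_xy g ?z' *v (vs x - vs x'))"
    using norm_triangle_ineq4 by (smt (verit))
  also have "\<dots> \<le> L_f c * dist ?z ?z' + L_gg c * dist ?z ?z' * norm (vs x) + Lg * norm (vs x - vs x')"
    using upper by (intro add_mono grad_components_lipschitz[OF C1_f] jac_hess_bounds[OF C2_g lower])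
      (auto simp: lipschitz_upper_def)
  also have "\<dots> \<le> L_f c * ?d + L_gg c * ?d * (c_f c / mu) + Lg * (C_v c * norm (x - x'))"
    using consts_nonneg C_y_nonneg
    by (intro add_mono mult_left_mono mult_mono dist_ys norm_vs vs_lipschitz) auto
  \<comment> \<open>\<open>L_Phi\<close> is this sum of constants, ordered by powers of
    \<open>1 / mu\<close>.\<close>
  also have "\<dots> = L_Phi c * norm (x - x')"
    using mu_pos by (simp add: L_Phi_def C_v_def C_y_def divide_simps power2_eq_square power3_eq_cube) (simp add: algebra_simps)
  finally show "dist (gradPhi x) (gradPhi x') \<le> L_Phi c * dist x x'" by (simp add: dist_norm)
qed (rule L_Phi_nonneg)

lemma L_Phi_pos: "0 < L_Phi c"
proof (rule ccontr)
  assume "\<not> 0 < L_Phi c"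
  then have "0-lipschitz_on UNIV gradPhi" using gradPhi_lipschitz L_Phi_nonneg by simp
  then have "convex_on UNIV (Phi f g)"
    using zero_lipschitz_gradient_imp_affine[OF GDERIV_Phi] affine_imp_convex_on by metis
  then show False using nonconvex by simp
qed

lemma M1_pos: "0 < M1"
proof (rule ccontr)
  assume "\<not> 0 < M1"
  moreover have "0 \<le> (L_f c)\<^sup>2" "0 \<le> M\<^sup>2 * (L_gg c)\<^sup>2" by simp_all
  ultimately have "(L_f c)\<^sup>2 = 0" "M\<^sup>2 * (L_gg c)\<^sup>2 = 0" unfolding M1_bar_def by linarith+
  then have Lf: "L_f c = 0" and "M = 0 \<or> L_gg c = 0" by simp_all
  moreover have "M = 0 \<Longrightarrow> c_f c = 0"
    using M_ge mu_pos consts_nonneg(1) by (simp add: divide_le_0_iff)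
  ultimately have "c_f c * L_gg c = 0" "c_f c = 0 \<or> L_gg c = 0" by auto
  \<comment> \<open>Every term of \<open>L_Phi\<close> contains \<open>L_f\<close> or the product of
    \<open>c_f\<close> and \<open>L_gg\<close>.\<close>
  then have "L_Phi c = 0" using Lf by (auto simp: L_Phi_def)
  then show False using L_Phi_pos by simp
qed

lemma Phi_descent:
  "Phi f g (x + d) \<le> Phi f g x + gradPhi x \<bullet> d + L_Phi c / 2 * (norm d)\<^sup>2"
  by (rule Lipschitz_gradient_upper_bound[OF GDERIV_Phi gradPhi_lipschitz])

section \<open>Bias of the search directions, and single steps towards the solutions\<close>

lemma dir_x_gradPhi:
  assumes "norm v \<le> M"
  shows "(norm (dir_x f g (x, y, v) - gradPhi x))\<^sup>2
    \<le> M1 * (norm (y - ys x))\<^sup>2 + 2 * (Lg)\<^sup>2 * (norm (v - vs x))\<^sup>2"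
  using dir_diff_power2(1)[OF C1_f upper C2_g lower assms, of x y x "ys x" "vs x"] by (simp add: gradPhi_def)

text \<open>Only y changes, so the v-term of \<open>dir_diff\<close> vanishes and a factor 2 of
  \<open>M1_bar\<close> is free for the 2 in front.\<close>

lemma dir_v_bias:
  assumes "norm v \<le> M"
  shows "2 * (norm (dir_v f g (x, y, v) - dir_v f g (x, ys x, v)))\<^sup>2 \<le> M1 * (norm (y - ys x))\<^sup>2"
proof -
  have "norm (dir_v f g (x, y, v) - dir_v f g (x, ys x, v)) \<le> (L_f c + M * L_gg c) * norm (y - ys x)"
    using dir_diff(2)[OF C1_f upper C2_g lower assms, of x y x "ys x" v] by (simp add: dist_norm norm_Pair)
  then have "(norm (dir_v f g (x, y, v) - dir_v f g (x, ys x, v)))\<^sup>2 \<le> ((L_f c + M * L_gg c) * norm (y - ys x))\<^sup>2"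
    by (intro power_mono) auto
  then show ?thesis using M1_bar_ge[OF norm_ge_zero[of "y - ys x"], of c M] by simp
qed

lemma dir_v_ys: "dir_v f g (x, ys x, v) = hess_y g (x, ys x) *v (v - vs x)"
  by (simp add: dir_v_def matrix_vector_mult_diff_distrib hess_vs)

lemma y_step:
  assumes "0 < \<beta>" "\<beta> < 1" "0 < l" "l \<le> 1 / (2 * Lg + 2 * mu)"
  shows "(norm (y - (l * \<beta>) *\<^sub>R D - ys x))\<^sup>2 \<le> (1 - l * \<beta> * mu / 2) * (norm (y - ys x))\<^sup>2
     - l * \<beta> * l / 2 * (norm D)\<^sup>2 + 4 * (l * \<beta>) / mu * (norm (D - dir_y g (x, y)))\<^sup>2"
proof -
  have "(norm (y - ys x - (l * \<beta>) *\<^sub>R D))\<^sup>2 \<le> (1 - l * \<beta> * mu / 2) * (norm (y - ys x))\<^sup>2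
     - l * \<beta> * l / 2 * (norm D)\<^sup>2 + 4 * (l * \<beta>) / mu * (norm (D - dir_y g (x, y)))\<^sup>2"
    by (rule gradient_step_contraction[OF coercive_y _ mu_pos mu_le_Lg assms]) (simp add: dir_y_def)
  then show ?thesis by (simp add: algebra_simps)
qed

text \<open>The projection is nonexpansive and fixes the ball, in particular \<open>vs x\<close>,
  which lies in it because \<open>c_f c / c_mu c \<le> M\<close>; as it also fixes \<open>v\<close>,
  the movement is at most the step. The contraction belongs to the direction at \<open>ys x\<close>;
  using y instead costs the bias term and doubles the error factor 4 to 8.\<close>

lemma v_step:
  assumes step: "0 < \<eta>" "\<eta> < 1" "0 < l" "l \<le> 1 / (2 * Lg + 2 * mu)" and v: "norm v \<le> M"
    and v': "v' = closest_point (cball 0 M) (v - (l * \<eta>) *\<^sub>R D)"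
  shows "(norm (v' - vs x))\<^sup>2 \<le> (1 - l * \<eta> * mu / 2) * (norm (v - vs x))\<^sup>2
     - l * \<eta> * l / 2 * (norm D)\<^sup>2
     + 8 * (l * \<eta>) / mu * (norm (D - dir_v f g (x, y, v)))\<^sup>2
     + 4 * (l * \<eta>) / mu * (M1 * (norm (y - ys x))\<^sup>2)"
    and "norm (v' - v) \<le> l * \<eta> * norm D" and "norm v' \<le> M"
proof -
  have S: "convex (cball 0 M :: (real^'q) set)" "closed (cball 0 M :: (real^'q) set)" "cball 0 M \<noteq> ({} :: (real^'q) set)"
    using M_nonneg by auto
  have cp: "norm (v' - w) \<le> norm (v - (l * \<eta>) *\<^sub>R D - w)" if "norm w \<le> M" for w
    using closest_point_lipschitz[OF S, of "v - (l * \<eta>) *\<^sub>R D" w] closest_point_self[of w "cball 0 M"] that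
    by (simp add: v' dist_norm)
  show "norm v' \<le> M"
    using closest_point_in_set[OF S(2,3)] by (simp add: v')
  show "norm (v' - v) \<le> l * \<eta> * norm D"
    using cp[OF v] step by simp
  let ?D = "dir_v f g (x, y, v)" and ?D' = "dir_v f g (x, ys x, v)"
  have "(norm (v' - vs x))\<^sup>2 \<le> (norm (v - vs x - (l * \<eta>) *\<^sub>R D))\<^sup>2"
    using cp[OF norm_vs_le_M, of x] by (intro power_mono) (auto simp: algebra_simps)
  also have "\<dots> \<le> (1 - l * \<eta> * mu / 2) * (norm (v - vs x))\<^sup>2
     - l * \<eta> * l / 2 * (norm D)\<^sup>2 + 4 * (l * \<eta>) / mu * (norm (D - ?D'))\<^sup>2"
    by (rule gradient_step_contraction[OF _ _ mu_pos mu_le_Lg step, where G = ?D'])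
       (use hess_coercive(2)[of "v - vs x" "(x, ys x)"] in \<open>simp_all add: dir_v_ys\<close>)
  also have "(norm (D - ?D'))\<^sup>2 \<le> 2 * (norm (D - ?D))\<^sup>2 + M1 * (norm (y - ys x))\<^sup>2"
    using power2_norm_add_le[of 1 "D - ?D" "?D - ?D'"] dir_v_bias[OF v, of x y] by simp
  finally show "(norm (v' - vs x))\<^sup>2 \<le> (1 - l * \<eta> * mu / 2) * (norm (v - vs x))\<^sup>2
     - l * \<eta> * l / 2 * (norm D)\<^sup>2 + 8 * (l * \<eta>) / mu * (norm (D - dir_v f g (x, y, v)))\<^sup>2
     + 4 * (l * \<eta>) / mu * (M1 * (norm (y - ys x))\<^sup>2)"
    using step mu_pos by (simp add: algebra_simps mult_left_mono divide_right_mono)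
qed

end

section \<open>Resampling one coordinate of a product measure\<close>

text \<open>Drawing coordinate \<open>j\<close> anew does not change the product law. The inner
  integral acts as a conditional expectation given all other samples.\<close>

lemma nn_integral_PiM_resample:
  fixes N :: "'i \<Rightarrow> 'a measure"
  assumes N: "\<And>i. prob_space (N i)" and h [measurable]: "h \<in> borel_measurable (PiM UNIV N)"
  shows "(\<integral>\<^sup>+ w. h w \<partial>PiM UNIV N) = (\<integral>\<^sup>+ w. \<integral>\<^sup>+ z. h (w(j := z)) \<partial>N j \<partial>PiM UNIV N)"
proof -
  interpret Nj: prob_space "N j" by (rule N)
  interpret Q: prob_space "PiM UNIV N" by (rule prob_space_PiM) (rule N)
  interpret P: pair_sigma_finite "N j" "PiM UNIV N" ..
  have eq: "distr (N j \<Otimes>\<^sub>M PiM UNIV N) (PiM UNIV N) (\<lambda>(x, X). X(j := x)) = PiM UNIV N"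
    using distr_pair_PiM_eq_PiM[of UNIV N j] N by simp
  have upd [measurable]: "(\<lambda>(x, X). X(j := x)) \<in> N j \<Otimes>\<^sub>M PiM UNIV N \<rightarrow>\<^sub>M PiM UNIV N"
  proof (rule measurable_PiM_single')
    fix i :: 'i
    show "(\<lambda>p. (case p of (x, X) \<Rightarrow> X(j := x)) i) \<in> N j \<Otimes>\<^sub>M PiM UNIV N \<rightarrow>\<^sub>M N i"
      by (cases "i = j") (simp_all add: split_beta')
  qed (auto simp: space_pair_measure space_PiM PiE_iff)
  have "(\<integral>\<^sup>+ w. h w \<partial>PiM UNIV N) = (\<integral>\<^sup>+ w. h w \<partial>distr (N j \<Otimes>\<^sub>M PiM UNIV N) (PiM UNIV N) (\<lambda>(x, X). X(j := x)))"
    by (simp add: eq)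
  also have "\<dots> = (\<integral>\<^sup>+ p. h ((\<lambda>(x, X). X(j := x)) p) \<partial>(N j \<Otimes>\<^sub>M PiM UNIV N))"
    by (rule nn_integral_distr) measurable
  also have "\<dots> = (\<integral>\<^sup>+ w. \<integral>\<^sup>+ z. h (w(j := z)) \<partial>N j \<partial>PiM UNIV N)"
    by (subst P.nn_integral_snd[symmetric]) (rule measurable_compose[OF upd h], simp)
  finally show ?thesis .
qed

text \<open>The cross term integrates to zero. \<open>R\<close> carries the rest of the potential,
  so that a single noise term can be integrated out in place.\<close>

lemma (in prob_space) nn_integral_centered_noise:
  fixes X :: "'a \<Rightarrow> 'b::euclidean_space"
  assumes X: "has_bochner_integral M X 0" and C: "mean_le M (\<lambda>z. (norm (X z))\<^sup>2) C"
    and R: "0 \<le> R" and k: "0 \<le> k"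
  shows "(\<integral>\<^sup>+ z. ennreal (R + k * (norm (a + X z))\<^sup>2) \<partial>M) \<le> ennreal (R + k * ((norm a)\<^sup>2 + C))"
proof -
  have iX: "integrable M X" "integral\<^sup>L M X = 0"
    using X by (auto simp: has_bochner_integral_iff)
  have i2: "integrable M (\<lambda>z. (norm (X z))\<^sup>2)" "integral\<^sup>L M (\<lambda>z. (norm (X z))\<^sup>2) \<le> C"
    using C by (auto simp: mean_le_def)
  have eq: "R + k * (norm (a + X z))\<^sup>2 = (R + k * (norm a)\<^sup>2) + (2 * k) * (a \<bullet> X z) + k * (norm (X z))\<^sup>2" for z
    unfolding power2_norm_eq_inner by (simp add: inner_add_left inner_add_right inner_commute algebra_simps)
  have "(\<integral>\<^sup>+ z. ennreal (R + k * (norm (a + X z))\<^sup>2) \<partial>M) = ennreal (\<integral>z. R + k * (norm (a + X z))\<^sup>2 \<partial>M)"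
  proof (rule nn_integral_eq_integral)
    show "integrable M (\<lambda>z. R + k * (norm (a + X z))\<^sup>2)" unfolding eq using iX i2 by simp
  qed (use R k in auto)
  also have "(\<integral>z. R + k * (norm (a + X z))\<^sup>2 \<partial>M) = R + k * (norm a)\<^sup>2 + k * (\<integral>z. (norm (X z))\<^sup>2 \<partial>M)"
    unfolding eq using iX i2 by (simp add: prob_space)
  also have "\<dots> \<le> R + k * ((norm a)\<^sup>2 + C)"
    using mult_left_mono[OF i2(2) k] by (simp add: distrib_left)
  finally show ?thesis by (simp add: ennreal_leI)
qed

lemma (in prob_space) has_bochner_integral_centered:
  fixes Y :: "'a \<Rightarrow> 'b::euclidean_space"
  shows "has_bochner_integral M Y m \<Longrightarrow> has_bochner_integral M (\<lambda>z. Y z - m) 0"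
  by (simp add: has_bochner_integral_iff prob_space)

lemma (in prob_space) centered_second_moment_le:
  fixes Y :: "'a \<Rightarrow> 'b::euclidean_space"
  assumes Y: "has_bochner_integral M Y m" and B: "\<And>z. z \<in> space M \<Longrightarrow> (norm (Y z))\<^sup>2 \<le> B"
  shows "mean_le M (\<lambda>z. (norm (Y z - m))\<^sup>2) B"
proof -
  have iY: "integrable M Y" "integral\<^sup>L M Y = m"
    using Y by (auto simp: has_bochner_integral_iff)
  have meas: "Y \<in> borel_measurable M" using iY by auto
  have i2: "integrable M (\<lambda>z. (norm (Y z))\<^sup>2)"
  proof (rule integrable_const_bound)
    show "AE z in M. norm ((norm (Y z))\<^sup>2) \<le> B" using B by (intro AE_I2) auto
  qed (use meas in measurable)
  have eq: "(norm (Y z - m))\<^sup>2 = (norm (Y z))\<^sup>2 - 2 * (Y z \<bullet> m) + (norm m)\<^sup>2" for z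
    unfolding power2_norm_eq_inner by (simp add: inner_diff_left inner_diff_right inner_commute)
  have "(\<integral>z. (norm (Y z))\<^sup>2 \<partial>M) \<le> (\<integral>z. B \<partial>M)"
    using B i2 by (intro integral_mono) auto
  then have "(\<integral>z. (norm (Y z - m))\<^sup>2 \<partial>M) \<le> B"
    unfolding eq using iY i2 inner_ge_zero[of m]
    by (simp add: prob_space power2_norm_eq_inner del: inner_ge_zero)
  moreover have "integrable M (\<lambda>z. (norm (Y z - m))\<^sup>2)"
    unfolding eq using iY i2 by simp
  ultimately show "mean_le M (\<lambda>z. (norm (Y z - m))\<^sup>2) B" by (simp add: mean_le_def)
qed

text \<open>The samples of one block are resampled one at a time, the last first; each contributes
  \<open>C w / (real n)\<^sup>2\<close>. The noise \<open>X\<close> may depend on the history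
  through \<open>w\<close>, but not on block \<open>d\<close> itself.\<close>

lemma nn_integral_batch_noise:
  fixes N :: "'d \<times> nat \<Rightarrow> 'a measure" and A :: "('d \<times> nat \<Rightarrow> 'a) \<Rightarrow> 'b::euclidean_space"
    and X :: "('d \<times> nat \<Rightarrow> 'a) \<Rightarrow> 'a \<Rightarrow> 'b"
  assumes N: "\<And>i. prob_space (N i)"
    and meas [measurable]: "A \<in> borel_measurable (PiM UNIV N)" "R \<in> borel_measurable (PiM UNIV N)"
      "C \<in> borel_measurable (PiM UNIV N)" "\<And>i. (\<lambda>w. X w (w (d, i))) \<in> borel_measurable (PiM UNIV N)"
    and inv: "\<And>w i z. A (w((d, i) := z)) = A w" "\<And>w i z. R (w((d, i) := z)) = R w"
      "\<And>w i z. C (w((d, i) := z)) = C w" "\<And>w i z. X (w((d, i) := z)) = X w"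
    and X: "\<And>w i. w \<in> space (PiM UNIV N) \<Longrightarrow> has_bochner_integral (N (d, i)) (X w) 0"
      "\<And>w i. w \<in> space (PiM UNIV N) \<Longrightarrow> mean_le (N (d, i)) (\<lambda>z. (norm (X w z))\<^sup>2) (C w)"
    and R: "\<And>w. 0 \<le> R w" and C: "\<And>w. 0 \<le> C w" and k: "0 \<le> k" and n: "0 < n"
  shows "(\<integral>\<^sup>+ w. ennreal (R w + k * (norm (A w + batch_mean n (\<lambda>i. X w (w (d, i)))))\<^sup>2) \<partial>PiM UNIV N)
    \<le> (\<integral>\<^sup>+ w. ennreal (R w + k * ((norm (A w))\<^sup>2 + C w / real n)) \<partial>PiM UNIV N)"
proof -
  define S where "S m w = A w + (1 / real n) *\<^sub>R (\<Sum>i<m. X w (w (d, i)))" for m :: nat and w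
  have S_meas [measurable]: "S m \<in> borel_measurable (PiM UNIV N)" for m unfolding S_def by measurable
  have *: "(\<integral>\<^sup>+ w. ennreal (R w + k * (norm (S m w))\<^sup>2) \<partial>PiM UNIV N)
    \<le> (\<integral>\<^sup>+ w. ennreal (R w + k * ((norm (A w))\<^sup>2 + real m * (C w / (real n)\<^sup>2))) \<partial>PiM UNIV N)"
    if "R \<in> borel_measurable (PiM UNIV N)" "\<And>w i z. R (w((d, i) := z)) = R w" "\<And>w. 0 \<le> R w" for R m
    using that
  proof (induction m arbitrary: R)
    case 0
    then show ?case by (simp add: S_def)
  next
    case (Suc m)
    note [measurable] = Suc.prems(1)
    have inv_S: "S m (w((d, m) := z)) = S m w" for w z by (simp add: S_def inv)
    have step: "S (Suc m) w = S m w + (1 / real n) *\<^sub>R X w (w (d, m))" for w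
      by (simp add: S_def scaleR_add_right)
    have "(\<integral>\<^sup>+ w. ennreal (R w + k * (norm (S (Suc m) w))\<^sup>2) \<partial>PiM UNIV N)
      = (\<integral>\<^sup>+ w. \<integral>\<^sup>+ z. ennreal (R w + k * (norm (S m w + (1 / real n) *\<^sub>R X w z))\<^sup>2) \<partial>N (d, m) \<partial>PiM UNIV N)"
      by (subst nn_integral_PiM_resample[OF N, where j = "(d, m)"], measurable)
         (simp add: step inv_S inv Suc.prems(2))
    also have "\<dots> \<le> (\<integral>\<^sup>+ w. ennreal (R w + k * ((norm (S m w))\<^sup>2 + C w / (real n)\<^sup>2)) \<partial>PiM UNIV N)"
    proof (intro nn_integral_mono prob_space.nn_integral_centered_noise[OF N] Suc.prems k)
      fix w assume w: "w \<in> space (PiM UNIV N)"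
      show "has_bochner_integral (N (d, m)) (\<lambda>z. (1 / real n) *\<^sub>R X w z) 0"
        using has_bochner_integral_scaleR_right[OF X(1)[OF w, of m], of "1 / real n"] by simp
      have "mean_le (N (d, m)) (\<lambda>z. (1 / real n)\<^sup>2 * (norm (X w z))\<^sup>2) (C w / (real n)\<^sup>2)"
        using X(2)[OF w, of m] n by (auto simp: mean_le_def power_divide divide_right_mono)
      then show "mean_le (N (d, m)) (\<lambda>z. (norm ((1 / real n) *\<^sub>R X w z))\<^sup>2) (C w / (real n)\<^sup>2)"
        by (simp add: power_mult_distrib power_divide)
    qed
    \<comment> \<open>The variance already paid moves into \<open>R\<close>, which is why the
      induction generalises over \<open>R\<close>.\<close>
    also have "\<dots> = (\<integral>\<^sup>+ w. ennreal ((R w + k * (C w / (real n)\<^sup>2)) + k * (norm (S m w))\<^sup>2) \<partial>PiM UNIV N)"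
      by (simp add: algebra_simps)
    also have "\<dots> \<le> (\<integral>\<^sup>+ w. ennreal ((R w + k * (C w / (real n)\<^sup>2))
        + k * ((norm (A w))\<^sup>2 + real m * (C w / (real n)\<^sup>2))) \<partial>PiM UNIV N)"
      by (rule Suc.IH) (measurable, use Suc.prems k C in \<open>simp_all only: inv, simp\<close>)
    finally show ?case by (simp add: algebra_simps add_divide_distrib)
  qed
  have "S n w = A w + batch_mean n (\<lambda>i. X w (w (d, i)))" for w by (simp add: S_def batch_mean_def)
  moreover have "real n * (C w / (real n)\<^sup>2) = C w / real n" for w
    using n by (simp add: power2_eq_square)
  ultimately show ?thesis using *[OF meas(2) inv(2) R, of n] by simp
qed

text \<open>Measurability in the sample is given only at each fixed point, but the algorithm
  evaluates at random points. The point is replaced by the first member of a dense sequence within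
  \<open>1 / real (Suc n)\<close>, which takes countably many values; continuity gives the
  limit.\<close>

lemma borel_measurable_Caratheodory:
  fixes h :: "'a \<Rightarrow> 'b::{second_countable_topology,metric_space} \<Rightarrow> 'c::metric_space"
  assumes meas: "\<And>y. (\<lambda>x. h x y) \<in> borel_measurable M"
    and cont: "\<And>x. x \<in> space M \<Longrightarrow> continuous_on UNIV (h x)"
  shows "(\<lambda>p. h (fst p) (snd p)) \<in> borel_measurable (M \<Otimes>\<^sub>M borel)"
proof -
  obtain D :: "'b set" where D: "countable D" "\<And>X. open X \<Longrightarrow> X \<noteq> {} \<Longrightarrow> \<exists>d\<in>D. d \<in> X"
    using countable_dense_exists by blast
  have "D \<noteq> {}" using D(2)[of UNIV] by auto
  define e where "e = from_nat_into D"
  define N where "N n y = (LEAST i. dist (e i) y < 1 / real (Suc n))" for n y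
  have N: "dist (e (N n y)) y < 1 / real (Suc n)" for n y
    unfolding N_def
  proof (rule LeastI_ex)
    obtain d where "d \<in> D" "d \<in> ball y (1 / real (Suc n))"
      using D(2)[of "ball y (1 / real (Suc n))"] by auto
    moreover obtain i where "from_nat_into D i = d" using from_nat_into_surj[OF D(1) \<open>d \<in> D\<close>] by blast
    ultimately have "dist (e i) y < 1 / real (Suc n)" by (simp add: e_def dist_commute)
    then show "\<exists>i. dist (e i) y < 1 / real (Suc n)" ..
  qed
  have N_meas: "N n \<in> measurable borel (count_space UNIV)" for n
    unfolding N_def by measurable
  show ?thesis
  proof (rule borel_measurable_LIMSEQ_metric[where f = "\<lambda>n p. h (fst p) (e (N n (snd p)))"])
    fix n show "(\<lambda>p. h (fst p) (e (N n (snd p)))) \<in> borel_measurable (M \<Otimes>\<^sub>M borel)"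
      by (rule measurable_compose_countable[where f = "\<lambda>i p. h (fst p) (e i)" and g = "\<lambda>p. N n (snd p)"])
         (use meas N_meas in \<open>auto intro: measurable_compose[OF measurable_fst] measurable_compose[OF measurable_snd]\<close>)
  next
    fix p :: "'a \<times> 'b" assume "p \<in> space (M \<Otimes>\<^sub>M borel)"
    then have "fst p \<in> space M" by (auto simp: space_pair_measure)
    have "(\<lambda>n. e (N n (snd p))) \<longlonglongrightarrow> snd p"
    proof (rule tendstoI)
      fix r :: real assume "0 < r"
      then obtain n0 where n0: "1 / real (Suc n0) < r" using reals_Archimedean by (auto simp: inverse_eq_divide)
      show "\<forall>\<^sub>F n in sequentially. dist (e (N n (snd p))) (snd p) < r"
      proof (rule eventually_sequentiallyI[of n0])
        fix n assume "n0 \<le> n"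
        then have "1 / real (Suc n) \<le> 1 / real (Suc n0)" by (simp add: frac_le)
        then show "dist (e (N n (snd p))) (snd p) < r" using N[of n "snd p"] n0 by linarith
      qed
    qed
    then show "(\<lambda>n. h (fst p) (e (N n (snd p)))) \<longlonglongrightarrow> h (fst p) (snd p)"
      using cont[OF \<open>fst p \<in> space M\<close>] continuous_on_tendsto_compose[of UNIV "h (fst p)"] by auto
  qed
qed

section \<open>Stochastic directions\<close>

lemma mean_le_mono:
  assumes "mean_le \<P> h' b" "h \<in> borel_measurable \<P>" "\<And>z. z \<in> space \<P> \<Longrightarrow> 0 \<le> h z \<and> h z \<le> h' z"
  shows "mean_le \<P> h b"
proof -
  have h': "integrable \<P> h'" "integral\<^sup>L \<P> h' \<le> b" using assms(1) by (auto simp: mean_le_def)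
  have i: "integrable \<P> h"
    by (rule Bochner_Integration.integrable_bound[OF h'(1) assms(2)]) (use assms(3) in \<open>fastforce intro: AE_I2\<close>)
  have "integral\<^sup>L \<P> h \<le> integral\<^sup>L \<P> h'" using i h'(1) assms(3) by (intro integral_mono) auto
  then show ?thesis using i h' by (simp add: mean_le_def)
qed

lemma bounded_linear_matrix_vector_mult_left: "bounded_linear (\<lambda>A :: real^'n^'m. A *v w)"
  by (intro linear_conv_bounded_linear[THEN iffD1] linearI)
     (auto simp: matrix_vector_mult_add_rdistrib scaleR_matrix_vector_assoc)

lemma continuous_on_dir_y:
  assumes "C2 g" "lipschitz_lower c g"
  shows "continuous_on UNIV (dir_y g)"
  unfolding dir_y_def[abs_def] grad_y_eq_snd[OF C2_imp_C1[OF assms(1)], abs_def]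
  using assms(2) unfolding lipschitz_lower_def
  by (intro continuous_on_snd lipschitz_on_continuous_on) auto

text \<open>At a point \<open>u\<close> the bound of \<open>dir_diff\<close> is used with the norm
  of the v-component of \<open>u\<close> in the place of \<open>M\<close>, which gives continuity
  beyond any fixed ball.\<close>

lemma continuous_on_dir:
  fixes f g :: "(real^'p) \<times> (real^'q) \<Rightarrow> real"
  assumes f: "C1 f" "lipschitz_upper c f" and g: "C2 g" "lipschitz_lower c g"
  shows "continuous_on UNIV (dir_x f g)" "continuous_on UNIV (dir_v f g)"
proof -
  have *: "continuous_on UNIV D"
    if D: "\<And>M x y v x' y' v'. norm v \<le> M \<Longrightarrow> norm (D (x, y, v) - D (x', y', v'))
        \<le> (L_f c + M * L_gg c) * dist (x, y) (x', y') + L_g c * norm (v - v')"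
    for D :: "(real^'p) \<times> (real^'q) \<times> (real^'q) \<Rightarrow> real^'m"
  proof (rule continuous_at_imp_continuous_on, rule ballI)
    fix u :: "(real^'p) \<times> (real^'q) \<times> (real^'q)"
    let ?b = "\<lambda>u'. (L_f c + norm (snd (snd u)) * L_gg c) * dist (fst u, fst (snd u)) (fst u', fst (snd u'))
        + L_g c * norm (snd (snd u) - snd (snd u'))"
    have "(?b \<longlongrightarrow> ?b u) (at u)" by (intro tendsto_intros)
    then have "(?b \<longlongrightarrow> 0) (at u)" by simp
    then have "((\<lambda>u'. D u - D u') \<longlongrightarrow> 0) (at u)"
      by (rule Lim_null_comparison[rotated])
         (use D[where v = "snd (snd u)" and x = "fst u" and y = "fst (snd u)", OF order_refl] in \<open>auto intro!: always_eventually\<close>)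
    then have "((\<lambda>u'. D u - (D u - D u')) \<longlongrightarrow> D u - 0) (at u)" by (intro tendsto_intros)
    then show "isCont D u" by (simp add: isCont_def)
  qed
  show "continuous_on UNIV (dir_x f g)" "continuous_on UNIV (dir_v f g)"
    by (rule *, rule dir_diff[OF f g], assumption)+
qed

text \<open>\<open>N\<close> holds the law of each single sample. Only its marginals are prescribed,
  so the two components may be dependent and their joint law may vary with the index, as in
  \<open>fresh_samples\<close>.\<close>

locale stochastic_bilevel = bilevel c f g M
  for c and f g :: "(real^'p) \<times> (real^'q) \<Rightarrow> real" and M +
  fixes P\<xi> :: "'xi measure" and P\<zeta> :: "'zeta measure"
    and F :: "'xi \<Rightarrow> (real^'p) \<times> (real^'q) \<Rightarrow> real" and G :: "'zeta \<Rightarrow> (real^'p) \<times> (real^'q) \<Rightarrow> real"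
    and N :: "draw \<times> nat \<Rightarrow> ('xi \<times> 'zeta) measure"
  assumes C1_F: "\<And>\<xi>. \<xi> \<in> space P\<xi> \<Longrightarrow> C1 (F \<xi>)" and C2_G: "\<And>\<zeta>. \<zeta> \<in> space P\<zeta> \<Longrightarrow> C2 (G \<zeta>)"
    and A3: "assumption_A3 c P\<xi> P\<zeta> f g F G" and A4: "assumption_A4 c P\<xi> P\<zeta> F G"
    and prob_N: "\<And>i. prob_space (N i)" and sets_N: "\<And>i. sets (N i) = sets (P\<xi> \<Otimes>\<^sub>M P\<zeta>)"
    and N_fst: "\<And>i. distr (N i) P\<xi> fst = P\<xi>" and N_snd: "\<And>i. distr (N i) P\<zeta> snd = P\<zeta>"
begin

abbreviation Q where "Q \<equiv> PiM UNIV N"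

abbreviation rv :: "((draw \<times> nat \<Rightarrow> 'xi \<times> 'zeta) \<Rightarrow> 'b::topological_space) \<Rightarrow> bool" where
  "rv h \<equiv> h \<in> borel_measurable Q"
text \<open>Extended nonnegative values: comparisons along the run then ask only for measurability,
  and integrability is deduced at the end from a finite bound.\<close>

abbreviation E :: "((draw \<times> nat \<Rightarrow> 'xi \<times> 'zeta) \<Rightarrow> real) \<Rightarrow> ennreal" where
  "E h \<equiv> \<integral>\<^sup>+ w. ennreal (h w) \<partial>Q"

lemma space_N: "space (N i) = space P\<xi> \<times> space P\<zeta>"
  using sets_eq_imp_space_eq[OF sets_N] by (simp add: space_pair_measure)

lemma measurable_N: "fst \<in> N i \<rightarrow>\<^sub>M P\<xi>" "snd \<in> N i \<rightarrow>\<^sub>M P\<zeta>"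
  by (simp_all add: measurable_cong_sets[OF sets_N refl])

lemma upper_F: "\<xi> \<in> space P\<xi> \<Longrightarrow> lipschitz_upper c (F \<xi>)"
  and lower_G: "\<zeta> \<in> space P\<zeta> \<Longrightarrow> lipschitz_lower c (G \<zeta>)"
  using A4 by (auto simp: assumption_A4_def)

lemma prob_Q: "prob_space Q" by (rule prob_space_PiM) (rule prob_N)

lemma has_bochner_integral_N_fst:
  fixes h :: "'xi \<Rightarrow> 'z::{banach,second_countable_topology}"
  assumes "has_bochner_integral P\<xi> h m"
  shows "has_bochner_integral (N i) (\<lambda>z. h (fst z)) m"
proof -
  have "has_bochner_integral (distr (N i) P\<xi> fst) h m" using assms by (simp add: N_fst)
  then show ?thesis
    using integrable_distr_eq[of fst "N i" P\<xi> h] integral_distr[of fst "N i" P\<xi> h] measurable_N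
    by (auto simp: has_bochner_integral_iff)
qed

lemma has_bochner_integral_N_snd:
  fixes h :: "'zeta \<Rightarrow> 'z::{banach,second_countable_topology}"
  assumes "has_bochner_integral P\<zeta> h m"
  shows "has_bochner_integral (N i) (\<lambda>z. h (snd z)) m"
proof -
  have "has_bochner_integral (distr (N i) P\<zeta> snd) h m" using assms by (simp add: N_snd)
  then show ?thesis
    using integrable_distr_eq[of snd "N i" P\<zeta> h] integral_distr[of snd "N i" P\<zeta> h] measurable_N
    by (auto simp: has_bochner_integral_iff)
qed

lemma mean_le_N: "mean_le P\<xi> h b \<Longrightarrow> mean_le (N i) (\<lambda>z. h (fst z)) b"
  "mean_le P\<zeta> h' b \<Longrightarrow> mean_le (N i) (\<lambda>z. h' (snd z)) b"
  using has_bochner_integral_N_fst[of h] has_bochner_integral_N_snd[of h']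
  by (auto simp: mean_le_def has_bochner_integral_iff)

lemma A3_means:
  "has_bochner_integral P\<xi> (\<lambda>\<xi>. grad (F \<xi>) z) (grad f z)"
  "has_bochner_integral P\<zeta> (\<lambda>\<zeta>. grad (G \<zeta>) z) (grad g z)"
  "has_bochner_integral P\<zeta> (\<lambda>\<zeta>. jac_xy (G \<zeta>) z) (jac_xy g z)"
  "has_bochner_integral P\<zeta> (\<lambda>\<zeta>. hess_y (G \<zeta>) z) (hess_y g z)"
  and A3_variances:
  "mean_le P\<xi> (\<lambda>\<xi>. (norm (grad (F \<xi>) z - grad f z))\<^sup>2) ((sigma_f c)\<^sup>2)"
  "mean_le P\<zeta> (\<lambda>\<zeta>. (norm (grad (G \<zeta>) z - grad g z))\<^sup>2) ((sigma_g c)\<^sup>2)"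
  "mean_le P\<zeta> (\<lambda>\<zeta>. (spectral_norm (jac_xy (G \<zeta>) z - jac_xy g z))\<^sup>2) ((sigma_gxy c)\<^sup>2)"
  "mean_le P\<zeta> (\<lambda>\<zeta>. (spectral_norm (hess_y (G \<zeta>) z - hess_y g z))\<^sup>2) ((sigma_gyy c)\<^sup>2)"
  using A3 unfolding assumption_A3_def by blast+

lemma sample_mean_y: "has_bochner_integral (N i) (\<lambda>z. dir_y (G (snd z)) w) (dir_y g w)"
proof -
  have "has_bochner_integral (N i) (\<lambda>z. snd (grad (G (snd z)) w)) (snd (grad g w))"
    using A3_means(2) by (intro has_bochner_integral_bounded_linear[OF bounded_linear_snd] has_bochner_integral_N_snd)
  then show ?thesis
    by (rule has_bochner_integral_cong[THEN iffD1, rotated 3])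
       (auto simp: dir_y_def grad_y_eq_snd C2_imp_C1 C2_G C2_g space_N)
qed

lemma sample_mean_x:
  "has_bochner_integral (N i) (\<lambda>z. dir_x (F (fst z)) (G (snd z)) u) (dir_x f g u)"
proof (cases u)
  case (fields x y v)
  have "has_bochner_integral (N i) (\<lambda>z. fst (grad (F (fst z)) (x, y)) - jac_xy (G (snd z)) (x, y) *v v)
      (fst (grad f (x, y)) - jac_xy g (x, y) *v v)"
    using A3_means(1) A3_means(3)
    by (intro has_bochner_integral_diff has_bochner_integral_bounded_linear[OF bounded_linear_fst]
        has_bochner_integral_bounded_linear[OF bounded_linear_matrix_vector_mult_left]
        has_bochner_integral_N_fst has_bochner_integral_N_snd)
  then show ?thesis unfolding fields
    by (rule has_bochner_integral_cong[THEN iffD1, rotated 3])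
       (auto simp: dir_x_def grad_x_eq_fst C1_F C1_f space_N)
qed

lemma sample_mean_v:
  "has_bochner_integral (N i) (\<lambda>z. dir_v (F (fst z)) (G (snd z)) u) (dir_v f g u)"
proof (cases u)
  case (fields x y v)
  have "has_bochner_integral (N i) (\<lambda>z. hess_y (G (snd z)) (x, y) *v v - snd (grad (F (fst z)) (x, y)))
      (hess_y g (x, y) *v v - snd (grad f (x, y)))"
    using A3_means(1) A3_means(4)
    by (intro has_bochner_integral_diff has_bochner_integral_bounded_linear[OF bounded_linear_snd]
        has_bochner_integral_bounded_linear[OF bounded_linear_matrix_vector_mult_left]
        has_bochner_integral_N_fst has_bochner_integral_N_snd)
  then show ?thesis unfolding fields
    by (rule has_bochner_integral_cong[THEN iffD1, rotated 3])
       (auto simp: dir_v_def grad_y_eq_snd C1_F C1_f space_N)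
qed

section \<open>Variance of one sample and of its increments\<close>

text \<open>The components of a sample may be correlated, so their variances are combined with
  factors 2 instead of being added; \<open>M\<^sup>2\<close> bounds the squared norm of
  \<open>v\<close>.\<close>

definition sig_x :: real where "sig_x = 2 * (sigma_f c)\<^sup>2 + 2 * (M\<^sup>2 * (sigma_gxy c)\<^sup>2)"
definition sig_y :: real where "sig_y = (sigma_g c)\<^sup>2"
definition sig_v :: real where "sig_v = 2 * (sigma_f c)\<^sup>2 + 2 * (M\<^sup>2 * (sigma_gyy c)\<^sup>2)"

lemma sig_nonneg: "0 \<le> sig_x" "0 \<le> sig_y" "0 \<le> sig_v"
  by (auto simp: sig_x_def sig_y_def sig_v_def)

lemma noise_y:
  "has_bochner_integral (N i) (\<lambda>z. dir_y (G (snd z)) w - dir_y g w) 0"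
  "mean_le (N i) (\<lambda>z. (norm (dir_y (G (snd z)) w - dir_y g w))\<^sup>2) sig_y"
proof -
  show "has_bochner_integral (N i) (\<lambda>z. dir_y (G (snd z)) w - dir_y g w) 0"
    by (rule prob_space.has_bochner_integral_centered[OF prob_N sample_mean_y])
  have [measurable]: "(\<lambda>z. dir_y (G (snd z)) w) \<in> borel_measurable (N i)"
    by (rule borel_measurable_has_bochner_integral[OF sample_mean_y])
  show "mean_le (N i) (\<lambda>z. (norm (dir_y (G (snd z)) w - dir_y g w))\<^sup>2) sig_y"
    unfolding sig_y_def
  proof (rule mean_le_mono[OF mean_le_N(2)[OF A3_variances(2)[of w]]])
    fix z assume "z \<in> space (N i)"
    then have "norm (dir_y (G (snd z)) w - dir_y g w) \<le> norm (grad (G (snd z)) w - grad g w)"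
      using norm_fst_snd_le(2)[of "grad (G (snd z)) w - grad g w"]
      by (auto simp: dir_y_def grad_y_eq_snd C2_imp_C1 C2_G C2_g space_N)
    then show "0 \<le> (norm (dir_y (G (snd z)) w - dir_y g w))\<^sup>2 \<and>
        (norm (dir_y (G (snd z)) w - dir_y g w))\<^sup>2 \<le> (norm (grad (G (snd z)) w - grad g w))\<^sup>2"
      by (auto intro: power_mono)
  qed measurable
qed

lemma spectral_variance:
  assumes "norm v \<le> M"
  shows "(norm (A *v v - B *v v))\<^sup>2 \<le> M\<^sup>2 * (spectral_norm (A - B))\<^sup>2"
proof -
  have "norm (A *v v - B *v v) \<le> spectral_norm (A - B) * norm v"
    using norm_matrix_vector_spectral[of "A - B" v] by (simp add: matrix_vector_mult_diff_rdistrib)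
  also have "\<dots> \<le> spectral_norm (A - B) * M"
    using assms onorm_pos_le[OF matrix_vector_mul_bounded_linear, of "A - B"]
    by (intro mult_left_mono) (auto simp: spectral_norm_def)
  finally have "(norm (A *v v - B *v v))\<^sup>2 \<le> (spectral_norm (A - B) * M)\<^sup>2" by (intro power_mono) auto
  then show ?thesis by (simp add: power_mult_distrib mult.commute)
qed

lemma mean_le_lin:
  assumes "mean_le P\<xi> a b" "mean_le P\<zeta> a' b'" "0 \<le> k"
  shows "mean_le (N i) (\<lambda>z. 2 * a (fst z) + 2 * (k * a' (snd z))) (2 * b + 2 * (k * b'))"
  using mean_le_N(1)[OF assms(1), of i] mean_le_N(2)[OF assms(2), of i] assms(3)
  by (auto simp: mean_le_def mult_left_mono add_mono)

lemma sample_variance: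
  fixes Y :: "'xi \<times> 'zeta \<Rightarrow> 'b::euclidean_space"
  assumes mean: "has_bochner_integral (N i) Y m" and v: "norm v \<le> M"
    and le: "\<And>z. z \<in> space (N i) \<Longrightarrow>
      norm (Y z - m) \<le> norm (grad (F (fst z)) p - grad f p) + norm (A (snd z) *v v - A0 *v v)"
    and var: "mean_le P\<zeta> (\<lambda>\<zeta>. (spectral_norm (A \<zeta> - A0))\<^sup>2) b"
  shows "mean_le (N i) (\<lambda>z. (norm (Y z - m))\<^sup>2) (2 * (sigma_f c)\<^sup>2 + 2 * (M\<^sup>2 * b))"
proof (rule mean_le_mono[OF mean_le_lin[OF A3_variances(1)[of p] var]])
  have [measurable]: "Y \<in> borel_measurable (N i)"
    by (rule borel_measurable_has_bochner_integral[OF mean])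
  show "(\<lambda>z. (norm (Y z - m))\<^sup>2) \<in> borel_measurable (N i)" by measurable
  fix z assume z: "z \<in> space (N i)"
  have "(norm (Y z - m))\<^sup>2 \<le> 2 * (norm (grad (F (fst z)) p - grad f p))\<^sup>2 + 2 * (norm (A (snd z) *v v - A0 *v v))\<^sup>2"
    by (rule le_add_imp_power2_le[OF norm_ge_zero le[OF z]])
  also have "\<dots> \<le> 2 * (norm (grad (F (fst z)) p - grad f p))\<^sup>2 + 2 * (M\<^sup>2 * (spectral_norm (A (snd z) - A0))\<^sup>2)"
    by (intro add_left_mono mult_left_mono spectral_variance v) simp
  finally show "0 \<le> (norm (Y z - m))\<^sup>2 \<and> (norm (Y z - m))\<^sup>2
      \<le> 2 * (norm (grad (F (fst z)) p - grad f p))\<^sup>2 + 2 * (M\<^sup>2 * (spectral_norm (A (snd z) - A0))\<^sup>2)" by simp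
qed simp

lemma noise_x:
  "has_bochner_integral (N i) (\<lambda>z. dir_x (F (fst z)) (G (snd z)) u - dir_x f g u) 0"
  "norm (snd (snd u)) \<le> M \<Longrightarrow> mean_le (N i) (\<lambda>z. (norm (dir_x (F (fst z)) (G (snd z)) u - dir_x f g u))\<^sup>2) sig_x"
proof -
  show "has_bochner_integral (N i) (\<lambda>z. dir_x (F (fst z)) (G (snd z)) u - dir_x f g u) 0"
    by (rule prob_space.has_bochner_integral_centered[OF prob_N sample_mean_x])
  obtain x y v where u: "u = (x, y, v)" by (cases u)
  assume "norm (snd (snd u)) \<le> M"
  then show "mean_le (N i) (\<lambda>z. (norm (dir_x (F (fst z)) (G (snd z)) u - dir_x f g u))\<^sup>2) sig_x"
    unfolding sig_x_def
  proof (rule sample_variance[OF sample_mean_x _ _ A3_variances(3)])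
    fix z assume "z \<in> space (N i)"
    then have "dir_x (F (fst z)) (G (snd z)) u - dir_x f g u = fst (grad (F (fst z)) (x, y) - grad f (x, y))
        - (jac_xy (G (snd z)) (x, y) *v v - jac_xy g (x, y) *v v)"
      by (auto simp: u dir_x_def grad_x_eq_fst C1_F C1_f space_N)
    then show "norm (dir_x (F (fst z)) (G (snd z)) u - dir_x f g u) \<le> norm (grad (F (fst z)) (x, y) - grad f (x, y))
        + norm (jac_xy (G (snd z)) (x, y) *v snd (snd u) - jac_xy g (x, y) *v snd (snd u))"
      using norm_fst_snd_le(1)[of "grad (F (fst z)) (x, y) - grad f (x, y)"] norm_triangle_ineq4
      by (smt (verit) u snd_conv)
  qed
qed

lemma noise_v:
  "has_bochner_integral (N i) (\<lambda>z. dir_v (F (fst z)) (G (snd z)) u - dir_v f g u) 0"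
  "norm (snd (snd u)) \<le> M \<Longrightarrow> mean_le (N i) (\<lambda>z. (norm (dir_v (F (fst z)) (G (snd z)) u - dir_v f g u))\<^sup>2) sig_v"
proof -
  show "has_bochner_integral (N i) (\<lambda>z. dir_v (F (fst z)) (G (snd z)) u - dir_v f g u) 0"
    by (rule prob_space.has_bochner_integral_centered[OF prob_N sample_mean_v])
  obtain x y v where u: "u = (x, y, v)" by (cases u)
  assume "norm (snd (snd u)) \<le> M"
  then show "mean_le (N i) (\<lambda>z. (norm (dir_v (F (fst z)) (G (snd z)) u - dir_v f g u))\<^sup>2) sig_v"
    unfolding sig_v_def
  proof (rule sample_variance[OF sample_mean_v _ _ A3_variances(4)])
    fix z assume "z \<in> space (N i)"
    then have "dir_v (F (fst z)) (G (snd z)) u - dir_v f g u = (hess_y (G (snd z)) (x, y) *v v - hess_y g (x, y) *v v)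
        - snd (grad (F (fst z)) (x, y) - grad f (x, y))"
      by (auto simp: u dir_v_def grad_y_eq_snd C1_F C1_f space_N)
    then show "norm (dir_v (F (fst z)) (G (snd z)) u - dir_v f g u) \<le> norm (grad (F (fst z)) (x, y) - grad f (x, y))
        + norm (hess_y (G (snd z)) (x, y) *v snd (snd u) - hess_y g (x, y) *v snd (snd u))"
      using norm_fst_snd_le(2)[of "grad (F (fst z)) (x, y) - grad f (x, y)"] norm_triangle_ineq4
      by (smt (verit) u snd_conv)
  qed
qed

text \<open>The right-hand side of \<open>dir_diff_power2\<close>: movement in the units in which it
  enlarges the squared error of an estimator.\<close>

definition drift :: "(real^'p) \<times> (real^'q) \<times> (real^'q) \<Rightarrow> (real^'p) \<times> (real^'q) \<times> (real^'q) \<Rightarrow> real" where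
  "drift u' u = M1 * ((norm (fst u' - fst u))\<^sup>2 + (norm (fst (snd u') - fst (snd u)))\<^sup>2)
     + 2 * (Lg)\<^sup>2 * (norm (snd (snd u') - snd (snd u)))\<^sup>2"

definition drift_y :: "(real^'p) \<times> (real^'q) \<Rightarrow> (real^'p) \<times> (real^'q) \<Rightarrow> real" where
  "drift_y z' z = (Lg)\<^sup>2 * ((norm (fst z' - fst z))\<^sup>2 + (norm (snd z' - snd z))\<^sup>2)"

lemma drift_nonneg: "0 \<le> drift u' u" "0 \<le> drift_y z' z"
  using M1_pos by (auto simp: drift_def drift_y_def)

text \<open>The Lipschitz condition on every sample bounds the squared increment pointwise, and
  centring does not raise the second moment. Hence the noise of a recursive update scales with the
  movement.\<close>

lemma increment_noise_y:
  "has_bochner_integral (N i) (\<lambda>z. (dir_y (G (snd z)) w' - dir_y (G (snd z)) w) - (dir_y g w' - dir_y g w)) 0"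
  "mean_le (N i) (\<lambda>z. (norm ((dir_y (G (snd z)) w' - dir_y (G (snd z)) w) - (dir_y g w' - dir_y g w)))\<^sup>2) (drift_y w' w)"
  by (rule prob_space.has_bochner_integral_centered[OF prob_N has_bochner_integral_diff[OF sample_mean_y sample_mean_y]])
     (rule prob_space.centered_second_moment_le[OF prob_N has_bochner_integral_diff[OF sample_mean_y sample_mean_y]],
      use dir_y_diff_power2[OF C2_G lower_G, of _ "fst w'" "snd w'" "fst w" "snd w"] in \<open>auto simp: drift_y_def space_N\<close>)

lemma increment_noise_x:
  "has_bochner_integral (N i) (\<lambda>z. (dir_x (F (fst z)) (G (snd z)) u' - dir_x (F (fst z)) (G (snd z)) u) - (dir_x f g u' - dir_x f g u)) 0"
  "norm (snd (snd u')) \<le> M \<Longrightarrow> mean_le (N i) (\<lambda>z. (norm ((dir_x (F (fst z)) (G (snd z)) u' - dir_x (F (fst z)) (G (snd z)) u) - (dir_x f g u' - dir_x f g u)))\<^sup>2) (drift u' u)"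
  by (rule prob_space.has_bochner_integral_centered[OF prob_N has_bochner_integral_diff[OF sample_mean_x sample_mean_x]])
     (rule prob_space.centered_second_moment_le[OF prob_N has_bochner_integral_diff[OF sample_mean_x sample_mean_x]],
      use dir_diff_power2(1)[OF C1_F upper_F C2_G lower_G, of _ _ "snd (snd u')" M
        "fst u'" "fst (snd u')" "fst u" "fst (snd u)" "snd (snd u)"] in \<open>auto simp: drift_def space_N\<close>)

lemma increment_noise_v:
  "has_bochner_integral (N i) (\<lambda>z. (dir_v (F (fst z)) (G (snd z)) u' - dir_v (F (fst z)) (G (snd z)) u) - (dir_v f g u' - dir_v f g u)) 0"
  "norm (snd (snd u')) \<le> M \<Longrightarrow> mean_le (N i) (\<lambda>z. (norm ((dir_v (F (fst z)) (G (snd z)) u' - dir_v (F (fst z)) (G (snd z)) u) - (dir_v f g u' - dir_v f g u)))\<^sup>2) (drift u' u)"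
  by (rule prob_space.has_bochner_integral_centered[OF prob_N has_bochner_integral_diff[OF sample_mean_v sample_mean_v]])
     (rule prob_space.centered_second_moment_le[OF prob_N has_bochner_integral_diff[OF sample_mean_v sample_mean_v]],
      use dir_diff_power2(2)[OF C1_F upper_F C2_G lower_G, of _ _ "snd (snd u')" M
        "fst u'" "fst (snd u')" "fst u" "fst (snd u)" "snd (snd u)"] in \<open>auto simp: drift_def space_N\<close>)

text \<open>The index \<open>(Outer_x 0, 0)\<close> is an arbitrary representative: all
  \<open>N i\<close> have the same measurable sets.\<close>

lemma measurable_sample_Caratheodory:
  fixes h :: "'xi \<times> 'zeta \<Rightarrow> 'b::{second_countable_topology,metric_space} \<Rightarrow> 'z::{banach,second_countable_topology}"
  assumes mean: "\<And>u. has_bochner_integral (N (Outer_x 0, 0)) (\<lambda>z. h z u) (h0 u)"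
    and cont: "\<And>z. z \<in> space P\<xi> \<times> space P\<zeta> \<Longrightarrow> continuous_on UNIV (h z)"
    and U: "rv U"
  shows "rv (\<lambda>w. h (w j) (U w))"
proof -
  have "(\<lambda>p. h (fst p) (snd p)) \<in> borel_measurable (N j \<Otimes>\<^sub>M borel)"
  proof (rule borel_measurable_Caratheodory)
    fix u
    have "sets (N j) = sets (N (Outer_x 0, 0))" by (simp only: sets_N)
    then have "(borel_measurable (N j) :: ('xi \<times> 'zeta \<Rightarrow> 'z) set) = borel_measurable (N (Outer_x 0, 0))"
      by (rule measurable_cong_sets) (rule refl)
    then show "(\<lambda>z. h z u) \<in> borel_measurable (N j)"
      using borel_measurable_has_bochner_integral[OF mean[of u]] by (simp only:)
  qed (use cont in \<open>simp add: space_N\<close>)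
  moreover have "(\<lambda>w. (w j, U w)) \<in> Q \<rightarrow>\<^sub>M N j \<Otimes>\<^sub>M borel"
    using U by (intro measurable_Pair measurable_component_singleton) auto
  ultimately have "rv (\<lambda>w. h (fst (w j, U w)) (snd (w j, U w)))"
    by (rule measurable_compose[rotated])
  then show ?thesis by simp
qed

lemma measurable_sample_dir [measurable (raw)]:
  "rv U \<Longrightarrow> rv (\<lambda>w. dir_x (F (fst (w j))) (G (snd (w j))) (U w))"
  "rv U \<Longrightarrow> rv (\<lambda>w. dir_v (F (fst (w j))) (G (snd (w j))) (U w))"
  "rv Z \<Longrightarrow> rv (\<lambda>w. dir_y (G (snd (w j))) (Z w))"
  by (rule measurable_sample_Caratheodory[OF sample_mean_x] measurable_sample_Caratheodory[OF sample_mean_v]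
        measurable_sample_Caratheodory[OF sample_mean_y];
      auto intro!: continuous_on_dir[OF C1_F upper_F C2_G lower_G] continuous_on_dir_y[OF C2_G lower_G])+

lemma measurable_dir [measurable]:
  "dir_x f g \<in> borel_measurable borel" "dir_v f g \<in> borel_measurable borel" "dir_y g \<in> borel_measurable borel"
  by (intro borel_measurable_continuous_onI continuous_on_dir[OF C1_f upper C2_g lower] continuous_on_dir_y[OF C2_g lower])+

lemma measurable_solutions [measurable]:
  "ys \<in> borel_measurable borel" "vs \<in> borel_measurable borel" "gradPhi \<in> borel_measurable borel"
  "Phi f g \<in> borel_measurable borel"
proof -
  have "(C_y c)-lipschitz_on UNIV ys" "(C_v c)-lipschitz_on UNIV vs"
    using ys_lipschitz vs_lipschitz consts_nonneg mu_pos
    by (auto intro!: lipschitz_onI simp: dist_norm C_y_def C_v_def)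
  then show "ys \<in> borel_measurable borel" "vs \<in> borel_measurable borel" "gradPhi \<in> borel_measurable borel"
    using gradPhi_lipschitz by (auto intro!: borel_measurable_continuous_onI lipschitz_on_continuous_on)
  have "continuous_on UNIV (Phi f g)"
    using GDERIV_Phi unfolding gderiv_def by (meson continuous_at_imp_continuous_on has_derivative_continuous)
  then show "Phi f g \<in> borel_measurable borel" by (rule borel_measurable_continuous_onI)
qed

end

section \<open>The run of the algorithm as a function of the samples\<close>

fun outer_iter :: "draw \<Rightarrow> nat" where
  "outer_iter (Outer_x k) = k"
| "outer_iter (Outer_y k) = k"
| "outer_iter (Outer_v k) = k"
| "outer_iter (Inner_y k t) = k"
| "outer_iter (Inner_x k j) = k"
| "outer_iter (Inner_v k j) = k"

lemma y_loop_cong: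
  "(\<And>t. t < n \<Longrightarrow> s (Inner_y k t) = s' (Inner_y k t)) \<Longrightarrow> y_loop P G s k x' w n = y_loop P G s' k x' w n"
  by (induction n) auto

lemma v_loop_cong:
  "(\<And>j. j < n \<Longrightarrow> s (Inner_x k j) = s' (Inner_x k j) \<and> s (Inner_v k j) = s' (Inner_v k j)) \<Longrightarrow>
    v_loop P F G s k x' y' w n = v_loop P F G s' k x' y' w n"
  by (induction n) auto

lemma alg_step_cong:
  assumes "\<And>d. outer_iter d = k \<Longrightarrow> s d = s' d"
  shows "alg_step P F G s k st = alg_step P F G s' k st"
proof -
  have loops: "y_loop P G s k = y_loop P G s' k" "v_loop P F G s k = v_loop P F G s' k"
    using assms by (intro ext y_loop_cong v_loop_cong; simp)+
  have outer: "s (Outer_x k) = s' (Outer_x k)" "s (Outer_y k) = s' (Outer_y k)" "s (Outer_v k) = s' (Outer_v k)"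
    by (rule assms, simp)+
  show ?thesis unfolding alg_step_def loops outer ..
qed

text \<open>The state before iteration \<open>k\<close> is a function of the draws of earlier
  iterations; together with \<open>nn_integral_PiM_resample\<close> this takes the place of a
  filtration.\<close>

lemma alg_run_cong:
  "(\<And>d. outer_iter d < k \<Longrightarrow> s d = s' d) \<Longrightarrow> alg_run P F G x0 y0 v0 s k = alg_run P F G x0 y0 v0 s' k"
  by (induction k) (auto intro: alg_step_cong)

definition samp :: "(draw \<times> nat \<Rightarrow> 'a) \<Rightarrow> draw \<Rightarrow> nat \<Rightarrow> 'a" where "samp w = (\<lambda>d i. w (d, i))"

lemma samp_upd_other: "d' \<noteq> d \<Longrightarrow> samp (w((d, i) := z)) d' = samp w d'"
  by (auto simp: samp_def)

lemma batch_mean_diff_const: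
  "0 < n \<Longrightarrow> batch_mean n (\<lambda>i. a i - b i - m) = batch_mean n a - batch_mean n b - m"
  "0 < n \<Longrightarrow> batch_mean n (\<lambda>i. a i - m) = batch_mean n a - m"
  by (simp_all add: batch_mean_def sum_subtractf scaleR_diff_right sum_constant_scaleR)

locale als_run = stochastic_bilevel c f g M P\<xi> P\<zeta> F G N
  for c and f g :: "(real^'p) \<times> (real^'q) \<Rightarrow> real" and M
    and P\<xi> :: "'xi measure" and P\<zeta> :: "'zeta measure"
    and F :: "'xi \<Rightarrow> (real^'p) \<times> (real^'q) \<Rightarrow> real" and G :: "'zeta \<Rightarrow> (real^'p) \<times> (real^'q) \<Rightarrow> real"
    and N :: "draw \<times> nat \<Rightarrow> ('xi \<times> 'zeta) measure" +
  fixes T J q S1 :: nat and \<beta> \<eta> l1 l2 al :: real and x0 :: "real^'p" and y0 v0 :: "real^'q"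
  assumes q_pos: "0 < q" and S1_pos: "0 < S1" and v0: "norm v0 \<le> M"
begin

definition P :: alg_params where
  "P = \<lparr>n_T = T, n_J = J, period = q, size_1 = S1, size_2 = q,
        step_lambda1 = l1, step_lambda2 = l2, step_alpha = al,
        step_beta = \<beta>, step_eta = \<eta>, tau_x = 0, tau_y = 0, tau_v = 0, radius = M\<rparr>"

definition st where "st k w = alg_run P F G x0 y0 v0 (samp w) k"
abbreviation xk where "xk k w \<equiv> st_x (st k w)"
abbreviation yk where "yk k w \<equiv> st_y (st k w)"
abbreviation vk where "vk k w \<equiv> st_v (st k w)"
abbreviation uk where "uk k w \<equiv> (xk k w, yk k w, vk k w)"

text \<open>The estimators used in iteration \<open>k\<close>, after a possible restart;
  \<open>st_Dx\<close> and its siblings are the values handed over by the preceding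
  iteration.\<close>

definition Dx0 where
  "Dx0 k w = (if q dvd k then batch_x F G S1 (samp w (Outer_x k)) (uk k w) else st_Dx (st k w))"
definition Dy0 where
  "Dy0 k w = (if q dvd k then batch_y G S1 (samp w (Outer_y k)) (xk k w, yk k w) else st_Dy (st k w))"
definition Dv0 where
  "Dv0 k w = (if q dvd k then batch_v F G S1 (samp w (Outer_v k)) (uk k w) else st_Dv (st k w))"
definition calls0 where
  "calls0 k w = (if q dvd k then st_calls (st k w) + calls_x S1 + calls_y S1 + calls_v S1 else st_calls (st k w))"

definition Yl where
  "Yl k w t = y_loop P G (samp w) k (xk k w - al *\<^sub>R Dx0 k w) ((xk k w, yk k w), Dy0 k w, calls0 k w) t"
definition Vl where
  "Vl k w j = v_loop P F G (samp w) k (xk k w - al *\<^sub>R Dx0 k w) (snd (fst (Yl k w T)))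
     (uk k w, Dx0 k w, Dv0 k w, snd (snd (Yl k w T))) j"

lemma st_0: "st 0 w = \<lparr>st_x = x0, st_y = y0, st_v = v0, st_Dx = 0, st_Dy = 0, st_Dv = 0, st_calls = 0\<rparr>"
  by (simp add: st_def)

lemma st_Suc: "st (Suc k) w = \<lparr>st_x = xk k w - al *\<^sub>R Dx0 k w, st_y = snd (fst (Yl k w T)),
   st_v = snd (snd (fst (Vl k w J))), st_Dx = fst (snd (Vl k w J)), st_Dy = fst (snd (Yl k w T)),
   st_Dv = fst (snd (snd (Vl k w J))), st_calls = snd (snd (snd (Vl k w J)))\<rparr>"
proof -
  have "st (Suc k) w = alg_step P F G (samp w) k (st k w)" by (simp add: st_def)
  then show ?thesis
    unfolding Vl_def Yl_def Dx0_def Dy0_def Dv0_def calls0_def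
    by (cases "q dvd k") (simp_all add: alg_step_def P_def Let_def case_prod_beta)
qed

text \<open>Position 0 is the starting point, which the algorithm numbers -1, so position
  \<open>Suc t\<close> is what it numbers \<open>t\<close>. The last iterates sit at
  \<open>T\<close> and \<open>J\<close>.\<close>

definition Yz where "Yz k w t = fst (Yl k w t)"
definition DY where "DY k w t = fst (snd (Yl k w t))"
definition U where "U k w j = fst (Vl k w j)"
definition DX where "DX k w j = fst (snd (Vl k w j))"
definition DV where "DV k w j = fst (snd (snd (Vl k w j)))"

lemma Yz_0: "Yz k w 0 = (xk k w, yk k w)" and DY_0: "DY k w 0 = Dy0 k w"
  and U_0: "U k w 0 = uk k w" and DX_0: "DX k w 0 = Dx0 k w" and DV_0: "DV k w 0 = Dv0 k w"
  by (simp_all add: Yz_def DY_def U_def DX_def DV_def Yl_def Vl_def)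

lemma xk_Suc: "xk (Suc k) w = xk k w - al *\<^sub>R Dx0 k w"
  and yk_Suc: "yk (Suc k) w = snd (Yz k w T)" and vk_Suc: "vk (Suc k) w = snd (snd (U k w J))"
  and st_Dx_Suc: "st_Dx (st (Suc k) w) = DX k w J" and st_Dy_Suc: "st_Dy (st (Suc k) w) = DY k w T"
  and st_Dv_Suc: "st_Dv (st (Suc k) w) = DV k w J"
  by (simp_all add: st_Suc Yz_def DY_def U_def DX_def DV_def)

lemma Yz_Suc: "Yz k w (Suc t) = (xk (Suc k) w, snd (Yz k w t) - (l1 * \<beta>) *\<^sub>R DY k w t)"
  by (simp add: Yz_def DY_def xk_Suc) (simp add: Yl_def P_def Let_def case_prod_beta)

lemma DY_Suc: "DY k w (Suc t) = batch_y G q (samp w (Inner_y k t)) (Yz k w (Suc t))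
    + (DY k w t - batch_y G q (samp w (Inner_y k t)) (Yz k w t))"
  unfolding Yz_Suc xk_Suc by (simp add: Yz_def DY_def) (simp add: Yl_def P_def Let_def case_prod_beta)

lemma U_Suc: "U k w (Suc j) = (xk (Suc k) w, yk (Suc k) w,
    closest_point (cball 0 M) (snd (snd (U k w j)) - (l2 * \<eta>) *\<^sub>R DV k w j))"
  unfolding yk_Suc xk_Suc by (simp add: U_def DV_def Yz_def) (simp add: Vl_def P_def Let_def case_prod_beta)

lemma DX_Suc: "DX k w (Suc j) = batch_x F G q (samp w (Inner_x k j)) (U k w (Suc j))
    + (DX k w j - batch_x F G q (samp w (Inner_x k j)) (U k w j))"
  unfolding U_Suc yk_Suc xk_Suc
  by (simp add: U_def DV_def DX_def Yz_def) (simp add: Vl_def P_def Let_def case_prod_beta)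

lemma DV_Suc: "DV k w (Suc j) = batch_v F G q (samp w (Inner_v k j)) (U k w (Suc j))
    + (DV k w j - batch_v F G q (samp w (Inner_v k j)) (U k w j))"
  unfolding U_Suc yk_Suc xk_Suc
  by (simp add: U_def DV_def DX_def Yz_def) (simp add: Vl_def P_def Let_def case_prod_beta)

lemma norm_closest_point_le: "norm (closest_point (cball 0 M) (a :: real^'q)) \<le> M"
  using closest_point_in_set[of "cball 0 M :: (real^'q) set" a] M_nonneg by auto

lemma norm_vk: "norm (vk k w) \<le> M" and norm_U: "norm (snd (snd (U k w j))) \<le> M"
proof -
  have U: "norm (snd (snd (U k w j))) \<le> M" if "norm (vk k w) \<le> M" for k j
    using that norm_closest_point_le by (cases j) (simp_all add: U_0 U_Suc)
  have vk: "norm (vk k w) \<le> M" for k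
    using v0 U by (induction k) (simp_all add: st_0 vk_Suc)
  show "norm (vk k w) \<le> M" "norm (snd (snd (U k w j))) \<le> M" using U vk by auto
qed

lemma calls_Yl: "snd (snd (Yl k w t)) = calls0 k w + t * (2 * q)"
proof (induction t)
  case 0 then show ?case by (simp add: Yl_def)
next
  case (Suc t) then show ?case
    by (simp add: Yl_def P_def Let_def case_prod_beta calls_y_def)
qed

lemma calls_Vl: "snd (snd (snd (Vl k w j))) = calls0 k w + T * (2 * q) + j * (8 * q)"
proof (induction j)
  case 0 then show ?case by (simp add: Vl_def calls_Yl)
next
  case (Suc j) then show ?case
    by (simp add: Vl_def P_def Let_def case_prod_beta calls_x_def calls_v_def)
qed

text \<open>A restart costs 2 + 1 + 2 calls per sample. An inner step evaluates its sample sets at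
  two points each: 2 calls per sample for y, and 4 + 4 for x and v.\<close>

lemma st_calls_eq:
  "st_calls (st k w) = (\<Sum>i<k. if q dvd i then 5 * S1 else 0) + k * (T * (2 * q) + J * (8 * q))"
proof (induction k)
  case (Suc k)
  have "st_calls (st (Suc k) w) = calls0 k w + T * (2 * q) + J * (8 * q)"
    by (simp add: st_Suc calls_Vl)
  then show ?case using Suc by (simp add: calls0_def calls_x_def calls_y_def calls_v_def)
qed (simp add: st_0)

section \<open>Which samples each quantity depends on\<close>

lemma st_upd: "k \<le> outer_iter d \<Longrightarrow> st k (w((d, i) := z)) = st k w"
  unfolding st_def by (intro alg_run_cong samp_upd_other) auto

lemma D0_upd:
  assumes "k \<le> outer_iter d" "d \<noteq> Outer_x k" "d \<noteq> Outer_y k" "d \<noteq> Outer_v k"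
  shows "Dx0 k (w((d, i) := z)) = Dx0 k w" "Dy0 k (w((d, i) := z)) = Dy0 k w"
    "Dv0 k (w((d, i) := z)) = Dv0 k w" "calls0 k (w((d, i) := z)) = calls0 k w"
  using assms by (simp_all add: Dx0_def Dy0_def Dv0_def calls0_def st_upd samp_upd_other)

lemma Yl_upd:
  assumes "k \<le> outer_iter d" "d \<noteq> Outer_x k" "d \<noteq> Outer_y k" "d \<noteq> Outer_v k"
    and "\<And>t'. t' < t \<Longrightarrow> d \<noteq> Inner_y k t'"
  shows "Yl k (w((d, i) := z)) t = Yl k w t"
  unfolding Yl_def D0_upd[OF assms(1-4)] st_upd[OF assms(1)]
  using assms(5) by (intro y_loop_cong samp_upd_other) blast

lemma Vl_upd:
  assumes "k \<le> outer_iter d" "d \<noteq> Outer_x k" "d \<noteq> Outer_y k" "d \<noteq> Outer_v k"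
    and "\<And>t. d \<noteq> Inner_y k t" "\<And>j'. j' < j \<Longrightarrow> d \<noteq> Inner_x k j' \<and> d \<noteq> Inner_v k j'"
  shows "Vl k (w((d, i) := z)) j = Vl k w j"
  unfolding Vl_def D0_upd[OF assms(1-4)] st_upd[OF assms(1)] Yl_upd[OF assms(1-5)]
  using assms(6) by (intro v_loop_cong conjI samp_upd_other) blast+

lemma Outer_upd:
  "d \<in> {Outer_x k, Outer_y k, Outer_v k} \<Longrightarrow> st k (w((d, i) := z)) = st k w"
  by (rule st_upd) auto

text \<open>Position \<open>t'\<close> of the loop has used only the sample sets numbered below
  \<open>t'\<close>, so set \<open>t\<close> is still fresh at \<open>t' = t\<close>.\<close>

lemma Inner_y_upd:
  "st k (w((Inner_y k t, i) := z)) = st k w" "Dx0 k (w((Inner_y k t, i) := z)) = Dx0 k w"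
  "Dy0 k (w((Inner_y k t, i) := z)) = Dy0 k w" "Dv0 k (w((Inner_y k t, i) := z)) = Dv0 k w"
  "t' \<le> t \<Longrightarrow> Yz k (w((Inner_y k t, i) := z)) t' = Yz k w t'"
  "t' \<le> t \<Longrightarrow> DY k (w((Inner_y k t, i) := z)) t' = DY k w t'"
  "xk (Suc k) (w((Inner_y k t, i) := z)) = xk (Suc k) w"
  by (simp_all add: st_upd D0_upd Yl_upd Yz_def DY_def xk_Suc)

text \<open>The next iterate is formed with the estimator from before the draw. Hence both points at
  which the new sample set is evaluated ignore it, and the increment noise is centred.\<close>

lemma Yz_Inner_y_upd: "Yz k (w((Inner_y k t, i) := z)) (Suc t) = Yz k w (Suc t)"
  by (simp only: Yz_Suc Inner_y_upd(5-7) order_refl)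

lemma Inner_xv_upd:
  assumes d: "d = Inner_x k j \<or> d = Inner_v k j"
  shows "st k (w((d, i) := z)) = st k w" "Dx0 k (w((d, i) := z)) = Dx0 k w"
  "Dy0 k (w((d, i) := z)) = Dy0 k w" "Dv0 k (w((d, i) := z)) = Dv0 k w"
  "Yz k (w((d, i) := z)) t = Yz k w t" "DY k (w((d, i) := z)) t = DY k w t"
  "xk (Suc k) (w((d, i) := z)) = xk (Suc k) w" "yk (Suc k) (w((d, i) := z)) = yk (Suc k) w"
  "j' \<le> j \<Longrightarrow> U k (w((d, i) := z)) j' = U k w j'"
  "j' \<le> j \<Longrightarrow> DX k (w((d, i) := z)) j' = DX k w j'"
  "j' \<le> j \<Longrightarrow> DV k (w((d, i) := z)) j' = DV k w j'"
  using d by (elim disjE; simp add: st_upd D0_upd Yl_upd Vl_upd Yz_def DY_def U_def DX_def DV_def xk_Suc yk_Suc)+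

lemma U_Suc_upd:
  assumes d: "d = Inner_x k j \<or> d = Inner_v k j"
  shows "U k (w((d, i) := z)) (Suc j) = U k w (Suc j)"
  by (simp only: U_Suc Inner_xv_upd[OF d] order_refl)

text \<open>Lets the x-error already updated at step \<open>j\<close> sit in the remainder while the
  v-samples are integrated out.\<close>

lemma DX_Inner_v_upd: "DX k (w((Inner_v k j, i) := z)) (Suc j) = DX k w (Suc j)"
proof -
  have "samp (w((Inner_v k j, i) := z)) (Inner_x k j) = samp w (Inner_x k j)" by (rule samp_upd_other) simp
  then show ?thesis
    by (simp only: DX_Suc U_Suc_upd[OF disjI2[OF refl]] Inner_xv_upd[OF disjI2[OF refl]] order_refl)
qed

section \<open>Measurability of the run\<close>

lemma measurable_fst_snd_borel [measurable (raw)]: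
  fixes h :: "'a \<Rightarrow> 'b::second_countable_topology \<times> 'd::second_countable_topology"
  shows "h \<in> borel_measurable A \<Longrightarrow> (\<lambda>w. fst (h w)) \<in> borel_measurable A"
    "h \<in> borel_measurable A \<Longrightarrow> (\<lambda>w. snd (h w)) \<in> borel_measurable A"
  by (rule measurable_compose[where f = h], assumption,
      rule borel_measurable_continuous_onI, intro continuous_intros)+

lemma measurable_batch [measurable (raw)]:
  "rv u \<Longrightarrow> rv (\<lambda>w. batch_x F G n (samp w d) (u w))"
  "rv u \<Longrightarrow> rv (\<lambda>w. batch_v F G n (samp w d) (u w))"
  "rv y \<Longrightarrow> rv (\<lambda>w. batch_y G n (samp w d) (y w))"
  unfolding batch_x_def batch_v_def batch_y_def batch_mean_def samp_def
  by (intro borel_measurable_scaleR borel_measurable_const borel_measurable_sum measurable_sample_dir, assumption)+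

lemma measurable_closest_point [measurable]: "closest_point (cball 0 M :: (real^'q) set) \<in> borel_measurable borel"
  using M_nonneg by (intro borel_measurable_continuous_onI continuous_on_closest_point) auto

lemma measurable_run_step:
  assumes [measurable]: "rv (\<lambda>w. xk k w)" "rv (\<lambda>w. yk k w)"
      "rv (\<lambda>w. vk k w)" "rv (\<lambda>w. st_Dx (st k w))"
      "rv (\<lambda>w. st_Dy (st k w))" "rv (\<lambda>w. st_Dv (st k w))"
  shows "rv (Dx0 k)" "rv (Dy0 k)" "rv (Dv0 k)"
    "rv (\<lambda>w. Yz k w t)" "rv (\<lambda>w. DY k w t)"
    "rv (\<lambda>w. U k w j)" "rv (\<lambda>w. DX k w j)"
    "rv (\<lambda>w. DV k w j)"
proof -
  show [measurable]: "rv (Dx0 k)" "rv (Dy0 k)" "rv (Dv0 k)"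
    unfolding Dx0_def[abs_def] Dy0_def[abs_def] Dv0_def[abs_def] by (cases "q dvd k"; simp; measurable)+
  have x [measurable]: "rv (\<lambda>w. xk (Suc k) w)" unfolding xk_Suc by measurable
  have Y: "rv (\<lambda>w. Yz k w t) \<and> rv (\<lambda>w. DY k w t)" for t
  proof (induction t)
    case 0 show ?case unfolding Yz_0 DY_0 by measurable
  next
    case (Suc t)
    then have [measurable]: "rv (\<lambda>w. Yz k w t)" "rv (\<lambda>w. DY k w t)" by auto
    have [measurable]: "rv (\<lambda>w. Yz k w (Suc t))" unfolding Yz_Suc by measurable
    have "rv (\<lambda>w. DY k w (Suc t))" unfolding DY_Suc by measurable
    then show ?case by simp
  qed
  then show "rv (\<lambda>w. Yz k w t)" "rv (\<lambda>w. DY k w t)" by auto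
  have y [measurable]: "rv (\<lambda>w. yk (Suc k) w)"
    unfolding yk_Suc using Y[of T, THEN conjunct1] by (rule measurable_fst_snd_borel)
  have "rv (\<lambda>w. U k w j) \<and> rv (\<lambda>w. DX k w j)
      \<and> rv (\<lambda>w. DV k w j)" for j
  proof (induction j)
    case 0 show ?case unfolding U_0 DX_0 DV_0 by measurable
  next
    case (Suc j)
    then have [measurable]: "rv (\<lambda>w. U k w j)" "rv (\<lambda>w. DX k w j)"
      "rv (\<lambda>w. DV k w j)" by auto
    have [measurable]: "rv (\<lambda>w. U k w (Suc j))" unfolding U_Suc by measurable
    have "rv (\<lambda>w. DX k w (Suc j))" "rv (\<lambda>w. DV k w (Suc j))"
      unfolding DX_Suc DV_Suc by measurable
    then show ?case by simp
  qed
  then show "rv (\<lambda>w. U k w j)" "rv (\<lambda>w. DX k w j)"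
    "rv (\<lambda>w. DV k w j)" by auto
qed

lemma measurable_st [measurable]:
  "rv (\<lambda>w. xk k w)" "rv (\<lambda>w. yk k w)"
  "rv (\<lambda>w. vk k w)" "rv (\<lambda>w. st_Dx (st k w))"
  "rv (\<lambda>w. st_Dy (st k w))" "rv (\<lambda>w. st_Dv (st k w))"
proof (induction k)
  case 0
  { case 1 show ?case by (simp add: st_0) next case 2 show ?case by (simp add: st_0)
    next case 3 show ?case by (simp add: st_0) next case 4 show ?case by (simp add: st_0)
    next case 5 show ?case by (simp add: st_0) next case 6 show ?case by (simp add: st_0) }
next
  case (Suc k)
  note [measurable] = Suc measurable_run_step[OF Suc]
  { case 1 show ?case unfolding xk_Suc by measurable next case 2 show ?case unfolding yk_Suc by measurable
    next case 3 show ?case unfolding vk_Suc by measurable next case 4 show ?case unfolding st_Dx_Suc by measurable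
    next case 5 show ?case unfolding st_Dy_Suc by measurable next case 6 show ?case unfolding st_Dv_Suc by measurable }
qed

lemmas measurable_run [measurable] = measurable_run_step[OF measurable_st]

end

section \<open>Evolution of the estimation errors\<close>

context stochastic_bilevel begin

text \<open>The new error is the old one plus a batch mean of centred increments. The old error
  ignores block \<open>d\<close>, so in expectation the squares add.\<close>

lemma increment_estimate:
  fixes D D' :: "(draw \<times> nat \<Rightarrow> 'xi \<times> 'zeta) \<Rightarrow> 'b::euclidean_space" and h :: "'xi \<times> 'zeta \<Rightarrow> 'u \<Rightarrow> 'b"
  assumes D': "\<And>w. D' w = batch_mean n (\<lambda>i. h (w (d, i)) (u' w)) + (D w - batch_mean n (\<lambda>i. h (w (d, i)) (u w)))"
    and noise: "\<And>i w. has_bochner_integral (N (d, i)) (\<lambda>z. (h z (u' w) - h z (u w)) - (htrue (u' w) - htrue (u w))) 0"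
      "\<And>i w. mean_le (N (d, i)) (\<lambda>z. (norm ((h z (u' w) - h z (u w)) - (htrue (u' w) - htrue (u w))))\<^sup>2) (C (u' w) (u w))"
    and meas [measurable]: "\<And>i. rv (\<lambda>w. h (w (d, i)) (u' w))" "\<And>i. rv (\<lambda>w. h (w (d, i)) (u w))"
      "rv (\<lambda>w. htrue (u' w))" "rv (\<lambda>w. htrue (u w))" "rv D" "rv (\<lambda>w. C (u' w) (u w))" "rv R"
    and inv: "\<And>w i z. u' (w((d, i) := z)) = u' w" "\<And>w i z. u (w((d, i) := z)) = u w"
      "\<And>w i z. D (w((d, i) := z)) = D w" "\<And>w i z. R (w((d, i) := z)) = R w"
    and nonneg: "\<And>w. 0 \<le> R w" "\<And>a a'. 0 \<le> C a a'" "0 \<le> b" and n: "0 < n"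
  shows "E (\<lambda>w. R w + b * (norm (D' w - htrue (u' w)))\<^sup>2)
    \<le> E (\<lambda>w. R w + b * ((norm (D w - htrue (u w)))\<^sup>2 + C (u' w) (u w) / real n))"
proof -
  define X where "X w z = (h z (u' w) - h z (u w)) - (htrue (u' w) - htrue (u w))" for w z
  have eq: "D' w - htrue (u' w) = (D w - htrue (u w)) + batch_mean n (\<lambda>i. X w (w (d, i)))" for w
    unfolding X_def D' using n by (simp add: batch_mean_diff_const)
  show ?thesis
    unfolding eq
  proof (rule nn_integral_batch_noise[OF prob_N])
    show "rv (\<lambda>w. X w (w (d, i)))" for i unfolding X_def by measurable
    show "X (w((d, i) := z)) = X w" for w i z by (simp only: X_def fun_eq_iff inv) simp
  qed (measurable, simp_all only: X_def noise inv nonneg n)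
qed

text \<open>At a restart, the previous estimators are discarded, so the error is a plain sample-mean error.\<close>

lemma restart_estimate:
  fixes D :: "(draw \<times> nat \<Rightarrow> 'xi \<times> 'zeta) \<Rightarrow> 'b::euclidean_space" and h :: "'xi \<times> 'zeta \<Rightarrow> 'u \<Rightarrow> 'b"
  assumes D: "\<And>w. D w = batch_mean n (\<lambda>i. h (w (d, i)) (u w))"
    and noise: "\<And>i w. has_bochner_integral (N (d, i)) (\<lambda>z. h z (u w) - htrue (u w)) 0"
      "\<And>i w. mean_le (N (d, i)) (\<lambda>z. (norm (h z (u w) - htrue (u w)))\<^sup>2) C"
    and meas [measurable]: "\<And>i. rv (\<lambda>w. h (w (d, i)) (u w))" "rv (\<lambda>w. htrue (u w))" "rv R"
    and inv: "\<And>w i z. u (w((d, i) := z)) = u w" "\<And>w i z. R (w((d, i) := z)) = R w"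
    and nonneg: "\<And>w. 0 \<le> R w" "0 \<le> C" "0 \<le> b" and n: "0 < n"
  shows "E (\<lambda>w. R w + b * (norm (D w - htrue (u w)))\<^sup>2) \<le> E (\<lambda>w. R w + b * (C / real n))"
proof -
  define X where "X w z = h z (u w) - htrue (u w)" for w z
  have eq: "D w - htrue (u w) = 0 + batch_mean n (\<lambda>i. X w (w (d, i)))" for w
    unfolding X_def D using n by (simp add: batch_mean_diff_const)
  have "E (\<lambda>w. R w + b * (norm (0 + batch_mean n (\<lambda>i. X w (w (d, i)))))\<^sup>2)
    \<le> E (\<lambda>w. R w + b * ((norm (0::'b))\<^sup>2 + C / real n))"
  proof (rule nn_integral_batch_noise[OF prob_N])
    show "rv (\<lambda>w. X w (w (d, i)))" for i unfolding X_def by measurable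
    show "X (w((d, i) := z)) = X w" for w i z by (simp only: X_def fun_eq_iff inv) simp
  qed (measurable, simp_all only: X_def noise inv nonneg n)
  then show ?thesis unfolding eq by simp
qed

end

context als_run begin

lemma measurable_components [measurable]:
  "rv (\<lambda>w. fst (Yz k w t))" "rv (\<lambda>w. snd (Yz k w t))"
  "rv (\<lambda>w. fst (U k w j))" "rv (\<lambda>w. fst (snd (U k w j)))" "rv (\<lambda>w. snd (snd (U k w j)))"
  by (rule measurable_fst_snd_borel measurable_run)+

lemma measurable_drift [measurable]:
  "rv (\<lambda>w. drift (U k w j) (U k' w j'))"
  "rv (\<lambda>w. drift_y (Yz k w t) (Yz k' w t'))"
proof -
  have *: "rv (\<lambda>w. (norm (a w - b w))\<^sup>2)"
    if "rv a" "rv b" for a b :: "_ \<Rightarrow> real^'n"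
    using that by measurable
  show "rv (\<lambda>w. drift (U k w j) (U k' w j'))"
    unfolding drift_def
    by (rule borel_measurable_add borel_measurable_times borel_measurable_const * measurable_components)+
  show "rv (\<lambda>w. drift_y (Yz k w t) (Yz k' w t'))"
    unfolding drift_y_def
    by (rule borel_measurable_add borel_measurable_times borel_measurable_const * measurable_components)+
qed

lemma inner_noise_y:
  assumes "rv R" "\<And>w. 0 \<le> R w" "\<And>w i z. R (w((Inner_y k t, i) := z)) = R w" "0 \<le> b"
  shows "E (\<lambda>w. R w + b * (norm (DY k w (Suc t) - dir_y g (Yz k w (Suc t))))\<^sup>2)
    \<le> E (\<lambda>w. R w + b * ((norm (DY k w t - dir_y g (Yz k w t)))\<^sup>2 + drift_y (Yz k w (Suc t)) (Yz k w t) / real q))"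
  by (rule increment_estimate[where h = "\<lambda>z. dir_y (G (snd z))" and d = "Inner_y k t"
        and htrue = "dir_y g" and u = "\<lambda>w. Yz k w t" and u' = "\<lambda>w. Yz k w (Suc t)" and C = drift_y, OF _ increment_noise_y(1) increment_noise_y(2)])
     (insert assms(1), measurable, simp_all add: assms Inner_y_upd Yz_Inner_y_upd q_pos drift_nonneg DY_Suc batch_y_def samp_def)

lemma inner_noise_x:
  assumes "rv R" "\<And>w. 0 \<le> R w" "\<And>w i z. R (w((Inner_x k j, i) := z)) = R w" "0 \<le> b"
  shows "E (\<lambda>w. R w + b * (norm (DX k w (Suc j) - dir_x f g (U k w (Suc j))))\<^sup>2)
    \<le> E (\<lambda>w. R w + b * ((norm (DX k w j - dir_x f g (U k w j)))\<^sup>2 + drift (U k w (Suc j)) (U k w j) / real q))"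
  by (rule increment_estimate[where h = "\<lambda>z. dir_x (F (fst z)) (G (snd z))" and d = "Inner_x k j"
        and htrue = "dir_x f g" and u = "\<lambda>w. U k w j" and u' = "\<lambda>w. U k w (Suc j)" and C = drift, OF _ increment_noise_x(1) increment_noise_x(2)[OF norm_U]])
     (insert assms(1), measurable, simp_all add: assms Inner_xv_upd[OF disjI1[OF refl]] U_Suc_upd[OF disjI1[OF refl]] q_pos drift_nonneg DX_Suc batch_x_def samp_def)

lemma inner_noise_v:
  assumes "rv R" "\<And>w. 0 \<le> R w" "\<And>w i z. R (w((Inner_v k j, i) := z)) = R w" "0 \<le> b"
  shows "E (\<lambda>w. R w + b * (norm (DV k w (Suc j) - dir_v f g (U k w (Suc j))))\<^sup>2)
    \<le> E (\<lambda>w. R w + b * ((norm (DV k w j - dir_v f g (U k w j)))\<^sup>2 + drift (U k w (Suc j)) (U k w j) / real q))"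
  by (rule increment_estimate[where h = "\<lambda>z. dir_v (F (fst z)) (G (snd z))" and d = "Inner_v k j"
        and htrue = "dir_v f g" and u = "\<lambda>w. U k w j" and u' = "\<lambda>w. U k w (Suc j)" and C = drift, OF _ increment_noise_v(1) increment_noise_v(2)[OF norm_U]])
     (insert assms(1), measurable, simp_all add: assms Inner_xv_upd[OF disjI2[OF refl]] U_Suc_upd[OF disjI2[OF refl]] q_pos drift_nonneg DV_Suc batch_v_def samp_def)

lemma outer_noise_x:
  assumes "q dvd k" "rv R" "\<And>w. 0 \<le> R w" "\<And>w i z. R (w((Outer_x k, i) := z)) = R w" "0 \<le> b"
  shows "E (\<lambda>w. R w + b * (norm (Dx0 k w - dir_x f g (uk k w)))\<^sup>2) \<le> E (\<lambda>w. R w + b * (sig_x / real S1))"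
  by (rule restart_estimate[where h = "\<lambda>z. dir_x (F (fst z)) (G (snd z))" and d = "Outer_x k" and htrue = "dir_x f g" and u = "\<lambda>w. uk k w",
        OF _ noise_x(1) noise_x(2)])
     (insert assms(2), measurable, simp_all add: assms Outer_upd norm_vk S1_pos sig_nonneg Dx0_def batch_x_def samp_def)

lemma outer_noise_y:
  assumes "q dvd k" "rv R" "\<And>w. 0 \<le> R w" "\<And>w i z. R (w((Outer_y k, i) := z)) = R w" "0 \<le> b"
  shows "E (\<lambda>w. R w + b * (norm (Dy0 k w - dir_y g (xk k w, yk k w)))\<^sup>2) \<le> E (\<lambda>w. R w + b * (sig_y / real S1))"
  by (rule restart_estimate[where h = "\<lambda>z. dir_y (G (snd z))" and d = "Outer_y k" and htrue = "dir_y g" and u = "\<lambda>w. (xk k w, yk k w)",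
        OF _ noise_y])
     (insert assms(2), measurable, simp_all add: assms Outer_upd norm_vk S1_pos sig_nonneg Dy0_def batch_y_def samp_def)

lemma outer_noise_v:
  assumes "q dvd k" "rv R" "\<And>w. 0 \<le> R w" "\<And>w i z. R (w((Outer_v k, i) := z)) = R w" "0 \<le> b"
  shows "E (\<lambda>w. R w + b * (norm (Dv0 k w - dir_v f g (uk k w)))\<^sup>2) \<le> E (\<lambda>w. R w + b * (sig_v / real S1))"
  by (rule restart_estimate[where h = "\<lambda>z. dir_v (F (fst z)) (G (snd z))" and d = "Outer_v k" and htrue = "dir_v f g" and u = "\<lambda>w. uk k w",
        OF _ noise_v(1) noise_v(2)])
     (insert assms(2), measurable, simp_all add: assms Outer_upd norm_vk S1_pos sig_nonneg Dv0_def batch_v_def samp_def)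

end

section \<open>Descent of the potential\<close>

text \<open>The weights are what one iteration pays per unit of squared error: \<open>al\<close> in
  \<open>x_step\<close>, at most \<open>5 * lam / mu\<close> in each of \<open>T\<close> y-steps and
  \<open>9 * rho / mu\<close> in each of \<open>J\<close> v-steps. \<open>gain_y\<close> and
  \<open>gain_v\<close> let the negative terms of the y- and v-steps pay for the drift caused by
  those steps; the conditions on \<open>al\<close> do the same for the x-step, which moreover moves
  both solutions.\<close>

locale als_steps = als_run c f g M P\<xi> P\<zeta> F G N T J q S1 \<beta> \<eta> l1 l2 al x0 y0 v0
  for c and f g :: "(real^'p) \<times> (real^'q) \<Rightarrow> real" and M
    and P\<xi> :: "'xi measure" and P\<zeta> :: "'zeta measure"
    and F :: "'xi \<Rightarrow> (real^'p) \<times> (real^'q) \<Rightarrow> real" and G :: "'zeta \<Rightarrow> (real^'p) \<times> (real^'q) \<Rightarrow> real"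
    and N :: "draw \<times> nat \<Rightarrow> ('xi \<times> 'zeta) measure"
    and T J q S1 :: nat and \<beta> \<eta> l1 l2 al :: real and x0 :: "real^'p" and y0 v0 :: "real^'q" +
  fixes lam rho Ax Ay Av :: real
  assumes lam_def: "lam = l1 * \<beta>" and rho_def: "rho = l2 * \<eta>"
    and Ax_def: "Ax = al" and Ay_def: "Ay = 5 * real T * lam / mu" and Av_def: "Av = 9 * real J * rho / mu"
    and T_pos: "0 < T" and J_pos: "0 < J"
    and \<beta>: "0 < \<beta>" "\<beta> < 1" and \<eta>: "0 < \<eta>" "\<eta> < 1"
    and l1: "0 < l1" "l1 \<le> 1 / (2 * Lg + 2 * mu)"
    and l2: "0 < l2" "l2 \<le> 1 / (2 * Lg + 2 * mu)"
    and al_pos: "0 < al"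
    and rho_le: "real J * rho * M1 / mu \<le> lam * mu / 128"
    and gain_y: "Ay * ((Lg)\<^sup>2 * lam\<^sup>2) + (Ax + Av) * M1 * (real T * lam\<^sup>2) \<le> lam * l1 / 2"
    and gain_v: "(Ax + Av) * (2 * (Lg)\<^sup>2 * rho\<^sup>2) \<le> rho * l2 / 2"
    and al_M1: "al * M1 \<le> lam * mu / 8" and al_Cy: "96 * al * (C_y c)\<^sup>2 \<le> lam * mu"
    and al_Lg: "48 * al * (Lg)\<^sup>2 \<le> rho * mu" and al_Cv: "48 * al * (C_v c)\<^sup>2 \<le> rho * mu"
    and al_L_Phi: "al * L_Phi c \<le> 1 / 6" and al_M1': "Ax * M1 * al \<le> 1 / 144"
    and al_Av: "Av * M1 * al \<le> 1 / 16" and al_Ay: "Ay * (Lg)\<^sup>2 * al \<le> 1 / 16"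
begin

lemma lam_pos: "0 < lam" and rho_pos: "0 < rho"
  using l1 l2 \<beta> \<eta> by (auto simp: lam_def rho_def)

lemma step_mu_le: "0 < l \<Longrightarrow> l \<le> 1 / (2 * Lg + 2 * mu) \<Longrightarrow> 0 < b \<Longrightarrow> b < 1 \<Longrightarrow> l * b * mu \<le> 1 / 4"
proof -
  assume l: "0 < l" "l \<le> 1 / (2 * Lg + 2 * mu)" and b: "0 < b" "b < 1"
  have "l \<le> 1 / (4 * mu)"
    using mu_le_Lg mu_pos by (intro order_trans[OF l(2)]) (auto intro!: divide_left_mono)
  moreover have "l * b \<le> l" using l b by simp
  ultimately have "l * b * mu \<le> 1 / (4 * mu) * mu" using mu_pos by (intro mult_right_mono) auto
  then show ?thesis using mu_pos by simp
qed

lemma lam_mu: "lam * mu \<le> 1 / 4" and rho_mu: "rho * mu \<le> 1 / 4"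
  unfolding lam_def rho_def by (rule step_mu_le[OF l1 \<beta>] step_mu_le[OF l2 \<eta>])+

lemma A_nonneg: "0 \<le> Ax" "0 \<le> Ay" "0 \<le> Av"
  using al_pos lam_pos rho_pos mu_pos by (auto simp: Ax_def Ay_def Av_def)

text \<open>Every v-step after the first is biased by the final y-error and adds
  \<open>4 * rho * M1 / mu\<close> times it. This surplus is set aside on the y-error and consumed
  step by step.\<close>

definition kap :: "nat \<Rightarrow> real" where "kap j = real j * (4 * rho * M1 / mu)"

lemma kap_nonneg: "0 \<le> kap j" using rho_pos mu_pos M1_pos by (simp add: kap_def)

lemma kap_J: "kap J \<le> lam * mu / 32" "kap J \<le> 1 / 128"
proof -
  have "kap J = 4 * (real J * rho * M1 / mu)" by (simp add: kap_def)
  then show "kap J \<le> lam * mu / 32" using rho_le by linarith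
  then show "kap J \<le> 1 / 128" using lam_mu by linarith
qed

lemma kap_Suc: "kap (Suc j) = kap j + 4 * rho * M1 / mu"
  by (simp add: kap_def distrib_right add_divide_distrib)

definition Ph where "Ph x = Phi f g x - Inf (range (Phi f g))"

lemma Ph_nonneg: "0 \<le> Ph x" unfolding Ph_def using bdd by (simp add: cINF_lower)

definition dy where "dy k w = (norm (yk k w - ys (xk k w)))\<^sup>2"
definition dv where "dv k w = (norm (vk k w - vs (xk k w)))\<^sup>2"
definition ex where "ex k w = (norm (Dx0 k w - dir_x f g (uk k w)))\<^sup>2"
definition ey where "ey k w = (norm (Dy0 k w - dir_y g (xk k w, yk k w)))\<^sup>2"
definition ev where "ev k w = (norm (Dv0 k w - dir_v f g (uk k w)))\<^sup>2"
definition errY where "errY k t w = (norm (DY k w t - dir_y g (Yz k w t)))\<^sup>2"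
definition errX where "errX k j w = (norm (DX k w j - dir_x f g (U k w j)))\<^sup>2"
definition errV where "errV k j w = (norm (DV k w j - dir_v f g (U k w j)))\<^sup>2"
definition nx where "nx k w = (norm (Dx0 k w))\<^sup>2"
definition NY where "NY k t w = (norm (DY k w t))\<^sup>2"
definition NV where "NV k j w = (norm (DV k w j))\<^sup>2"
definition gP where "gP k w = al / 2 * (norm (gradPhi (xk k w)))\<^sup>2"
text \<open>\<open>del\<close> and \<open>nu\<close> are measured from the solutions at the new x,
  unlike \<open>dy\<close> and \<open>dv\<close>; at the last position they become \<open>dy\<close>
  and \<open>dv\<close> of the next iteration.\<close>

definition del where "del k t w = (norm (snd (Yz k w t) - ys (xk (Suc k) w)))\<^sup>2"
definition nu where "nu k j w = (norm (snd (snd (U k w j)) - vs (xk (Suc k) w)))\<^sup>2"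
definition SD where "SD k t w = (\<Sum>i<t. NY k i w)"

lemmas sq_defs = dy_def dv_def ex_def ey_def ev_def errY_def errX_def errV_def nx_def NY_def NV_def del_def nu_def

lemma sq_nonneg: "0 \<le> dy k w" "0 \<le> dv k w" "0 \<le> ex k w" "0 \<le> ey k w" "0 \<le> ev k w" "0 \<le> errY k t w"
  "0 \<le> errX k j w" "0 \<le> errV k j w" "0 \<le> nx k w" "0 \<le> NY k t w" "0 \<le> NV k j w" "0 \<le> gP k w" "0 \<le> del k t w"
  "0 \<le> nu k j w" "0 \<le> SD k t w"
  using al_pos by (simp_all add: sq_defs gP_def SD_def sum_nonneg)

lemma E_0: "errY k 0 w = ey k w" "errX k 0 w = ex k w" "errV k 0 w = ev k w" "NY k 0 w = (norm (Dy0 k w))\<^sup>2"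
  by (simp_all add: sq_defs DY_0 Yz_0 DX_0 DV_0 U_0)

lemma del_T: "del k T w = dy (Suc k) w" and nu_J: "nu k J w = dv (Suc k) w"
  by (simp_all add: del_def dy_def yk_Suc nu_def dv_def vk_Suc)

text \<open>The inner product of \<open>gradPhi\<close> and \<open>Dx0\<close> is polarised, which
  yields \<open>gP\<close>. Since \<open>al * L_Phi c \<le> 1 / 6\<close>, the smoothness term takes
  1/12 of the gain 1/2 and leaves 5/12.\<close>

lemma x_step: "gP k w + Ph (xk (Suc k) w) \<le> Ph (xk k w) - 5 / 12 * al * nx k w + al * ex k w
    + al * M1 * dy k w + 2 * al * (Lg)\<^sup>2 * dv k w"
proof -
  let ?x = "xk k w" and ?D = "Dx0 k w"
  have "Phi f g (?x + (- al) *\<^sub>R ?D) \<le> Phi f g ?x + gradPhi ?x \<bullet> ((- al) *\<^sub>R ?D) + L_Phi c / 2 * (norm ((- al) *\<^sub>R ?D))\<^sup>2"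
    by (rule Phi_descent)
  then have a: "Ph (xk (Suc k) w) \<le> Ph ?x - al * (gradPhi ?x \<bullet> ?D) + (al * L_Phi c) * (al / 2 * nx k w)"
    using al_pos by (simp add: Ph_def xk_Suc nx_def power_mult_distrib power2_eq_square algebra_simps)
  have "(al * L_Phi c) * (al / 2 * nx k w) \<le> 1 / 6 * (al / 2 * nx k w)"
    using al_L_Phi al_pos sq_nonneg by (intro mult_right_mono) auto
  moreover have "al * (gradPhi ?x \<bullet> ?D) = gP k w + al / 2 * nx k w - al / 2 * (norm (?D - gradPhi ?x))\<^sup>2"
    unfolding gP_def nx_def power2_norm_eq_inner
    by (simp add: inner_diff_left inner_diff_right inner_commute algebra_simps)
  moreover have "al / 2 * (norm (?D - gradPhi ?x))\<^sup>2
      \<le> al / 2 * (2 * ex k w + 2 * (M1 * dy k w + 2 * (Lg)\<^sup>2 * dv k w))"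
  proof (intro mult_left_mono)
    have "(norm (?D - gradPhi ?x))\<^sup>2 \<le> 2 * ex k w + 2 * (norm (dir_x f g (uk k w) - gradPhi ?x))\<^sup>2"
      using power2_norm_add_le[of 1 "?D - dir_x f g (uk k w)" "dir_x f g (uk k w) - gradPhi ?x"]
      by (simp add: ex_def)
    also have "\<dots> \<le> 2 * ex k w + 2 * (M1 * dy k w + 2 * (Lg)\<^sup>2 * dv k w)"
      unfolding dy_def dv_def by (intro add_left_mono mult_left_mono dir_x_gradPhi norm_vk) simp
    finally show "(norm (?D - gradPhi ?x))\<^sup>2 \<le> 2 * ex k w + 2 * (M1 * dy k w + 2 * (Lg)\<^sup>2 * dv k w)" .
  qed (use al_pos in simp)
  ultimately show ?thesis using a by (simp add: algebra_simps)
qed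

text \<open>From the second step on x is fixed and the solution does not shift; the contraction
  factor is bounded by 1.\<close>

lemma y_step_later:
  assumes "0 < t"
  shows "del k (Suc t) w \<le> del k t w - lam * l1 / 2 * NY k t w + 4 * lam / mu * errY k t w"
proof -
  obtain t' where t: "t = Suc t'" using assms by (cases t) auto
  let ?z = "Yz k w t"
  have z: "?z = (xk (Suc k) w, snd ?z)" by (simp add: t Yz_Suc)
  have "del k (Suc t) w \<le> (1 - lam * mu / 2) * del k t w - lam * l1 / 2 * NY k t w + 4 * lam / mu * errY k t w"
    using y_step[OF \<beta> l1, of "snd ?z" "DY k w t" "xk (Suc k) w"]
    unfolding del_def NY_def errY_def Yz_Suc snd_conv lam_def z[symmetric] .
  also have "(1 - lam * mu / 2) * del k t w \<le> 1 * del k t w"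
    using lam_pos mu_pos sq_nonneg by (intro mult_right_mono) auto
  finally show ?thesis by simp
qed

text \<open>The first step contracts towards the old solution \<open>b\<close>, but the error is
  measured from the new one \<open>b'\<close>. Young with parameter \<open>s / 4\<close> gives away
  half of the contraction; 17/16 is \<open>1 + s / 4\<close> at the largest
  \<open>s\<close>.\<close>

lemma target_shift:
  fixes a b b' :: "'z::real_inner"
  assumes s: "0 < s" "s \<le> 1 / 4" and old: "(norm (a - b))\<^sup>2 \<le> (1 - s / 2) * d - p + r"
    and p: "0 \<le> p" and d: "0 \<le> d" and r: "0 \<le> r" and shift: "norm (b - b') \<le> C * h"
  shows "(norm (a - b'))\<^sup>2 \<le> (1 - s / 4) * d - p + 17 / 16 * r + (1 + 4 / s) * C\<^sup>2 * h\<^sup>2"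
proof -
  have "(norm (a - b'))\<^sup>2 \<le> (1 + s / 4) * (norm (a - b))\<^sup>2 + (1 + 1 / (s / 4)) * (norm (b - b'))\<^sup>2"
    using power2_norm_add_le[of "s / 4" "a - b" "b - b'"] s by simp
  also have "\<dots> \<le> (1 + s / 4) * ((1 - s / 2) * d - p + r) + (1 + 1 / (s / 4)) * (C * h)\<^sup>2"
    using s old shift by (intro add_mono mult_left_mono power_mono) auto
  also have "(1 + s / 4) * ((1 - s / 2) * d - p + r) = (1 - s / 4 - s\<^sup>2 / 8) * d - p - s / 4 * p + (1 + s / 4) * r"
    by (simp add: algebra_simps power2_eq_square)
  also have "\<dots> \<le> (1 - s / 4) * d - p + 17 / 16 * r"
  proof -
    have "(1 - s / 4 - s\<^sup>2 / 8) * d \<le> (1 - s / 4) * d" using d by (intro mult_right_mono) auto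
    moreover have "0 \<le> s / 4 * p" using s p by simp
    moreover have "(1 + s / 4) * r \<le> 17 / 16 * r" using s r by (intro mult_right_mono) auto
    ultimately show ?thesis by linarith
  qed
  finally show ?thesis by (simp add: power_mult_distrib mult.assoc)
qed

lemma y_step_first:
  "del k 1 w \<le> (1 - lam * mu / 4) * dy k w - lam * l1 / 2 * NY k 0 w + 17 / 4 * lam / mu * ey k w
    + (1 + 4 / (lam * mu)) * (C_y c)\<^sup>2 * (al\<^sup>2 * nx k w)"
proof -
  have y: "(norm (snd (Yz k w 1) - ys (xk k w)))\<^sup>2
      \<le> (1 - lam * mu / 2) * dy k w - lam * l1 / 2 * NY k 0 w + 4 * lam / mu * ey k w"
    using y_step[OF \<beta> l1, of "yk k w" "Dy0 k w" "xk k w"]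
    by (simp add: sq_defs Yz_Suc Yz_0 DY_0 lam_def)
  have "norm (ys (xk k w) - ys (xk (Suc k) w)) \<le> C_y c * (al * norm (Dx0 k w))"
    using ys_lipschitz[of "xk k w" "xk (Suc k) w"] al_pos by (simp add: xk_Suc)
  from target_shift[OF _ lam_mu y _ _ _ this]
  show ?thesis
    using lam_pos mu_pos l1 sq_nonneg by (simp add: del_def nx_def power_mult_distrib)
qed

text \<open>Cauchy-Schwarz over the \<open>T\<close> steps. The v-loop sees this total displacement
  as one jump, so the squared y-estimators have to be remembered in \<open>SD\<close>.\<close>

lemma norm_yk_diff: "(norm (yk (Suc k) w - yk k w))\<^sup>2 \<le> real T * lam\<^sup>2 * SD k T w"
proof -
  have "snd (Yz k w t) - yk k w = - lam *\<^sub>R (\<Sum>i<t. DY k w i)" for t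
    by (induction t) (simp_all add: Yz_0 Yz_Suc lam_def algebra_simps)
  then have "(norm (yk (Suc k) w - yk k w))\<^sup>2 = lam\<^sup>2 * (norm (\<Sum>i<T. DY k w i))\<^sup>2"
    by (simp add: yk_Suc power_mult_distrib)
  moreover have "(norm (\<Sum>i<T. DY k w i))\<^sup>2 \<le> (\<Sum>i<T. 1 * norm (DY k w i))\<^sup>2"
    by (intro power_mono) (auto intro: norm_sum)
  moreover have "(\<Sum>i<T. 1 * norm (DY k w i))\<^sup>2 \<le> (\<Sum>i<T. 1\<^sup>2) * (\<Sum>i<T. (norm (DY k w i))\<^sup>2)"
    by (rule Cauchy_Schwarz_ineq_sum)
  ultimately have "(norm (yk (Suc k) w - yk k w))\<^sup>2 \<le> lam\<^sup>2 * (real T * SD k T w)"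
    by (simp add: SD_def NY_def) (meson mult_left_mono order_trans zero_le_power2)
  then show ?thesis by (simp add: mult_ac)
qed

lemma v_step_first:
  "nu k 1 w \<le> (1 - rho * mu / 4) * dv k w - rho * l2 / 2 * NV k 0 w + 9 * rho / mu * ev k w
    + 5 * rho * M1 / mu * dy k w + (1 + 4 / (rho * mu)) * (C_v c)\<^sup>2 * (al\<^sup>2 * nx k w)"
proof -
  let ?r = "8 * rho / mu * ev k w + 4 * rho / mu * (M1 * dy k w)"
  have v: "(norm (snd (snd (U k w 1)) - vs (xk k w)))\<^sup>2
      \<le> (1 - rho * mu / 2) * dv k w - rho * l2 / 2 * NV k 0 w + ?r"
    using v_step(1)[OF \<eta> l2 norm_vk refl, of k w "Dv0 k w" "xk k w" "yk k w"]
    by (simp add: sq_defs U_Suc U_0 DV_0 rho_def)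
  have "norm (vs (xk k w) - vs (xk (Suc k) w)) \<le> C_v c * (al * norm (Dx0 k w))"
    using vs_lipschitz[of "xk k w" "xk (Suc k) w"] al_pos by (simp add: xk_Suc)
  from target_shift[OF _ rho_mu v _ _ _ this]
  have "nu k 1 w \<le> (1 - rho * mu / 4) * dv k w - rho * l2 / 2 * NV k 0 w + 17 / 16 * ?r
      + (1 + 4 / (rho * mu)) * (C_v c)\<^sup>2 * (al\<^sup>2 * nx k w)"
    using rho_pos mu_pos l2 sq_nonneg M1_pos by (simp add: nu_def nx_def power_mult_distrib)
  \<comment> \<open>17/16 times 8 is below 9, the constant in \<open>Av\<close>, and 17/16 times 4
    is below 5.\<close>
  moreover have "17 / 16 * ?r \<le> 9 * rho / mu * ev k w + 5 * rho * M1 / mu * dy k w"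
  proof -
    have "0 \<le> rho / mu * ev k w" "0 \<le> rho * M1 / mu * dy k w"
      using rho_pos mu_pos sq_nonneg M1_pos by simp_all
    moreover have "17 / 16 * ?r = 17 / 2 * (rho / mu * ev k w) + 17 / 4 * (rho * M1 / mu * dy k w)"
      "9 * rho / mu * ev k w = 9 * (rho / mu * ev k w)"
      "5 * rho * M1 / mu * dy k w = 5 * (rho * M1 / mu * dy k w)"
      by (simp_all add: distrib_left)
    ultimately show ?thesis by linarith
  qed
  ultimately show ?thesis by linarith
qed

lemma v_step_later:
  assumes "0 < j"
  shows "nu k (Suc j) w \<le> nu k j w - rho * l2 / 2 * NV k j w + 8 * rho / mu * errV k j w
    + 4 * rho * M1 / mu * del k T w"
proof -
  obtain j' where j: "j = Suc j'" using assms by (cases j) auto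
  let ?u = "U k w j"
  have u: "?u = (xk (Suc k) w, yk (Suc k) w, snd (snd ?u))" by (simp add: j U_Suc)
  have "nu k (Suc j) w \<le> (1 - rho * mu / 2) * nu k j w - rho * l2 / 2 * NV k j w + 8 * rho / mu * errV k j w
    + 4 * rho / mu * (M1 * del k T w)"
    using v_step(1)[OF \<eta> l2 norm_U refl, of k w j "DV k w j" "xk (Suc k) w" "yk (Suc k) w"]
    unfolding nu_def NV_def errV_def del_T dy_def U_Suc snd_conv rho_def u[symmetric] .
  also have "(1 - rho * mu / 2) * nu k j w \<le> 1 * nu k j w"
    using rho_pos mu_pos sq_nonneg by (intro mult_right_mono) auto
  finally show ?thesis by simp
qed

lemma norm_v_diff: "(norm (snd (snd (U k w (Suc j))) - snd (snd (U k w j))))\<^sup>2 \<le> rho\<^sup>2 * NV k j w"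
proof -
  have "norm (snd (snd (U k w (Suc j))) - snd (snd (U k w j))) \<le> l2 * \<eta> * norm (DV k w j)"
    by (rule v_step(2)[OF \<eta> l2 norm_U[of k w j]]) (simp add: U_Suc)
  then have "(norm (snd (snd (U k w (Suc j))) - snd (snd (U k w j))))\<^sup>2 \<le> (l2 * \<eta> * norm (DV k w j))\<^sup>2"
    by (intro power_mono) auto
  then show ?thesis by (simp add: rho_def NV_def power_mult_distrib)
qed

lemma drift_y_first: "drift_y (Yz k w 1) (Yz k w 0) = (Lg)\<^sup>2 * (al\<^sup>2 * nx k w + lam\<^sup>2 * NY k 0 w)"
  by (simp add: drift_y_def Yz_Suc Yz_0 DY_0 xk_Suc nx_def NY_def lam_def power_mult_distrib)

lemma drift_y_later: "0 < t \<Longrightarrow> drift_y (Yz k w (Suc t)) (Yz k w t) = (Lg)\<^sup>2 * lam\<^sup>2 * NY k t w"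
  by (cases t) (simp_all add: drift_y_def Yz_Suc NY_def lam_def power_mult_distrib)

text \<open>The first step of the v-loop carries the whole change of x and y; afterwards only
  \<open>v\<close> moves.\<close>

lemma drift_first: "drift (U k w 1) (U k w 0)
    \<le> M1 * (al\<^sup>2 * nx k w + real T * lam\<^sup>2 * SD k T w) + 2 * (Lg)\<^sup>2 * (rho\<^sup>2 * NV k 0 w)"
proof -
  have "(norm (fst (U k w 1) - fst (U k w 0)))\<^sup>2 = al\<^sup>2 * nx k w"
    by (simp add: U_Suc U_0 xk_Suc nx_def power_mult_distrib)
  moreover have "(norm (fst (snd (U k w 1)) - fst (snd (U k w 0))))\<^sup>2 \<le> real T * lam\<^sup>2 * SD k T w"
    using norm_yk_diff[of k w] by (simp add: U_Suc U_0)
  ultimately show ?thesis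
    unfolding drift_def using norm_v_diff[of k w 0] M1_pos
    by (intro add_mono mult_left_mono) auto
qed

lemma drift_later: "0 < j \<Longrightarrow> drift (U k w (Suc j)) (U k w j) \<le> 2 * (Lg)\<^sup>2 * (rho\<^sup>2 * NV k j w)"
proof -
  assume "0 < j"
  then have "fst (U k w (Suc j)) = fst (U k w j)" "fst (snd (U k w (Suc j))) = fst (snd (U k w j))"
    by (cases j; simp add: U_Suc)+
  then show ?thesis unfolding drift_def using norm_v_diff[of k w j] by (simp add: mult_left_mono)
qed

end

text \<open>Bookkeeping of one inner step. Lowering the error weight from \<open>b'\<close> to
  \<open>b\<close> pays for the error term \<open>r\<close>; the gain \<open>p\<close> pays for the
  drift and for the growth of the reserve \<open>th\<close>.\<close>

lemma stage_inequality:
  fixes \<kappa> :: real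
  assumes step: "d' \<le> d - p * D + r * E" and nonneg: "0 \<le> \<kappa>" "0 \<le> p" "0 \<le> D" "0 \<le> E"
    and h1: "(1 + \<kappa>) * r + b \<le> b'" and h2: "b * c1 / q + th \<le> p"
  shows "(1 + \<kappa>) * d' + b * (E + c1 * D / q) + th * (S + D) \<le> (1 + \<kappa>) * d + b' * E + th * S"
proof -
  have "(1 + \<kappa>) * d' \<le> (1 + \<kappa>) * (d - p * D + r * E)"
    using step nonneg by (intro mult_left_mono) auto
  moreover have "((1 + \<kappa>) * r + b) * E \<le> b' * E" "(b * c1 / q + th) * D \<le> p * D"
    using h1 h2 nonneg by (auto intro: mult_right_mono)
  moreover have "0 \<le> \<kappa> * p * D" using nonneg by simp
  ultimately show ?thesis by (simp add: algebra_simps)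
qed

lemma distrib_right3: "(x + y + z) * d = x * d + y * d + z * d" for x y z d :: real
  by (simp add: distrib_right)

context als_steps begin

section \<open>Potentials inside one iteration\<close>

definition cD where "cD = (1 + 4 / (rho * mu)) * (C_v c)\<^sup>2 * al\<^sup>2 + (Ax + Av) * M1 * al\<^sup>2"
definition cy where "cy = (1 + 4 / (lam * mu)) * (C_y c)\<^sup>2 * al\<^sup>2"
definition theta where "theta = (Ax + Av) * M1 * (real T * lam\<^sup>2)"

definition V where
  "V n k w = Ph (xk k w) + dy k w + dv k w + real n * (Ax * ex k w + Ay * ey k w + Av * ev k w)"

text \<open>Set aside during the y-loop for the first v-step: the bound of
  \<open>v_step_first\<close> without its gain, with the error charge contained in the multiplicity
  \<open>Suc m\<close>, and the share of the x-movement that the v-loop causes to be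
  charged.\<close>

definition K0 where
  "K0 m k w = gP k w + Ph (xk (Suc k) w) + (1 - rho * mu / 4) * dv k w
    + 5 * rho * M1 / mu * dy k w + real (Suc m) * Av * ev k w + real m * Ax * ex k w + cD * nx k w"

text \<open>\<open>wy\<close> falls from \<open>Suc m\<close> to \<open>m\<close> multiples of
  \<open>Ay\<close> in \<open>T\<close> equal parts. \<open>wv\<close> is matched to the later
  v-steps, at 8 each; the first one, at 9, is accounted for in \<open>Theta_first\<close>.\<close>

definition wy where "wy m t = real m * Ay + (real T - real t) * (5 * lam / mu)"
definition wv where "wv m j = real m * Av + (real J - real j) * (8 * rho / mu)"

definition Psi where
  "Psi m k t w = K0 m k w + (1 + kap J) * del k t w + wy m t * errY k t w + theta * SD k t w"

definition Theta where
  "Theta m k j w = gP k w + Ph (xk (Suc k) w) + (1 + kap (J - j)) * del k T w + real m * Ay * errY k T w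
    + nu k j w + wv m j * errV k j w + real m * Ax * errX k j w"

lemma coeff_nonneg: "0 \<le> cD" "0 \<le> cy" "0 \<le> theta" "0 \<le> 5 * rho * M1 / mu" "0 \<le> 1 - rho * mu / 4"
  "t \<le> T \<Longrightarrow> 0 \<le> wy m t" "j \<le> J \<Longrightarrow> 0 \<le> wv m j"
  using lam_pos rho_pos mu_pos M1_pos A_nonneg rho_mu
  by (simp_all add: cD_def cy_def theta_def wy_def wv_def)

text \<open>Here the batch size being equal to the period matters: a weight of at most
  \<open>q\<close> multiples is divided by \<open>q\<close> samples.\<close>

lemma wy_le: "Suc m \<le> q \<Longrightarrow> wy m t / real q \<le> Ay"
proof -
  assume m: "Suc m \<le> q"
  have "(real T - real t) * (5 * lam / mu) \<le> real T * (5 * lam / mu)"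
    using lam_pos mu_pos by (intro mult_right_mono) auto
  also have "\<dots> = Ay" by (simp add: Ay_def)
  finally have "wy m t \<le> real (Suc m) * Ay" by (simp add: wy_def distrib_right)
  also have "\<dots> \<le> real q * Ay" using m A_nonneg by (intro mult_right_mono) auto
  finally show ?thesis using q_pos by (simp add: divide_le_eq mult.commute)
qed

lemma wv_le: "Suc m \<le> q \<Longrightarrow> wv m j / real q \<le> Av"
proof -
  assume m: "Suc m \<le> q"
  have "(real J - real j) * (8 * rho / mu) \<le> real J * (9 * rho / mu)"
    using rho_pos mu_pos by (intro mult_mono) (auto intro: divide_right_mono)
  also have "\<dots> = Av" by (simp add: Av_def)
  finally have "wv m j \<le> real (Suc m) * Av" by (simp add: wv_def distrib_right)
  also have "\<dots> \<le> real q * Av" using m A_nonneg by (intro mult_right_mono) auto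
  finally show ?thesis using q_pos by (simp add: divide_le_eq mult.commute)
qed

text \<open>The 5 leaves room for the factor \<open>1 + kap J\<close>, at most 129/128.\<close>

lemma kap_5: "(1 + kap J) * (4 * lam / mu) \<le> 5 * lam / mu"
  "(1 + kap J) * (17 / 4 * lam / mu) \<le> 5 * lam / mu"
proof -
  have "(1 + kap J) * (17 / 4) * (lam / mu) \<le> 5 * (lam / mu)"
    "(1 + kap J) * 4 * (lam / mu) \<le> 5 * (lam / mu)"
    using kap_J(2) lam_pos mu_pos by (intro mult_right_mono; simp)+
  then show "(1 + kap J) * (4 * lam / mu) \<le> 5 * lam / mu"
    "(1 + kap J) * (17 / 4 * lam / mu) \<le> 5 * lam / mu"
    by (simp_all only: mult.assoc times_divide_eq_right)
qed

lemma wy_Suc: "wy m t = wy m (Suc t) + 5 * lam / mu"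
proof -
  have "(real T - real t) * d = (real T - real (Suc t)) * d + d" for d by (simp add: algebra_simps)
  from this[of "5 * lam / mu"] show ?thesis by (simp only: wy_def add.assoc)
qed

lemma wy_1: "wy m 1 = real (Suc m) * Ay - 5 * lam / mu"
proof -
  have "real T * (5 * lam / mu) = Ay" by (simp add: Ay_def)
  then have "wy m 0 = real (Suc m) * Ay" by (simp add: wy_def distrib_right)
  then show ?thesis using wy_Suc[of m 0] by simp
qed

lemma measurable_dir_run [measurable]:
  "rv (\<lambda>w. dir_v f g (uk k w))" "rv (\<lambda>w. dir_y g (xk k w, yk k w))"
  "rv (\<lambda>w. dir_x f g (U k w j))" "rv (\<lambda>w. dir_v f g (U k w j))" "rv (\<lambda>w. dir_y g (Yz k w t))"
  by (rule measurable_compose[OF _ measurable_dir(1)] measurable_compose[OF _ measurable_dir(2)]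
      measurable_compose[OF _ measurable_dir(3)], measurable)+

lemma measurable_potentials [measurable]:
  "rv (dy k)" "rv (dv k)" "rv (ex k)" "rv (ey k)" "rv (ev k)" "rv (errY k t)" "rv (errX k j)" "rv (errV k j)"
  "rv (nx k)" "rv (NY k t)" "rv (NV k j)" "rv (gP k)" "rv (del k t)" "rv (nu k j)" "rv (\<lambda>w. Ph (xk k w))"
  unfolding sq_defs[abs_def] gP_def[abs_def] Ph_def by measurable

lemma measurable_SD [measurable]: "rv (SD k t)"
  unfolding SD_def[abs_def] by measurable

lemma upd_y:
  "t' \<le> t \<Longrightarrow> NY k t' (w((Inner_y k t, i) := z)) = NY k t' w"
  "SD k (Suc t) (w((Inner_y k t, i) := z)) = SD k (Suc t) w"
  "del k (Suc t) (w((Inner_y k t, i) := z)) = del k (Suc t) w"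
  "K0 m k (w((Inner_y k t, i) := z)) = K0 m k w"
proof -
  show NY: "NY k t' (w((Inner_y k t, i) := z)) = NY k t' w" if "t' \<le> t" for t'
    using that by (simp add: NY_def Inner_y_upd)
  show "SD k (Suc t) (w((Inner_y k t, i) := z)) = SD k (Suc t) w"
    unfolding SD_def by (intro sum.cong refl NY) simp
  show "del k (Suc t) (w((Inner_y k t, i) := z)) = del k (Suc t) w"
    by (simp add: del_def Inner_y_upd Yz_Inner_y_upd)
  show "K0 m k (w((Inner_y k t, i) := z)) = K0 m k w"
    by (simp add: K0_def gP_def sq_defs Inner_y_upd)
qed

definition base_Psi where
  "base_Psi m k t w = K0 m k w + (1 + kap J) * del k t w + theta * SD k t w"

lemma Psi_noise:
  assumes "t < T"
  shows "E (Psi m k (Suc t)) \<le> E (\<lambda>w. base_Psi m k (Suc t) w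
    + wy m (Suc t) * (errY k t w + drift_y (Yz k w (Suc t)) (Yz k w t) / real q))"
proof -
  have "E (Psi m k (Suc t)) = E (\<lambda>w. base_Psi m k (Suc t) w + wy m (Suc t) * errY k (Suc t) w)"
    by (simp add: Psi_def base_Psi_def add_ac)
  also have "\<dots> \<le> E (\<lambda>w. base_Psi m k (Suc t) w
      + wy m (Suc t) * (errY k t w + drift_y (Yz k w (Suc t)) (Yz k w t) / real q))"
    unfolding errY_def
  proof (rule inner_noise_y)
    show "rv (base_Psi m k (Suc t))" unfolding base_Psi_def[abs_def] K0_def by measurable
    show "0 \<le> base_Psi m k (Suc t) w" for w
      unfolding base_Psi_def K0_def using kap_nonneg sq_nonneg coeff_nonneg Ph_nonneg A_nonneg
      by (intro add_nonneg_nonneg mult_nonneg_nonneg) auto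
    show "base_Psi m k (Suc t) (w((Inner_y k t, i) := z)) = base_Psi m k (Suc t) w" for w i z
      by (simp only: base_Psi_def upd_y)
    show "0 \<le> wy m (Suc t)" using assms by (intro coeff_nonneg) auto
  qed
  finally show ?thesis .
qed

lemma Psi_step:
  assumes t: "0 < t" "t < T" and m: "Suc m \<le> q"
  shows "E (Psi m k (Suc t)) \<le> E (Psi m k t)"
proof (rule order_trans[OF Psi_noise[OF t(2)]], intro nn_integral_mono ennreal_leI)
    fix w
    have "(1 + kap J) * del k (Suc t) w
        + wy m (Suc t) * (errY k t w + ((Lg)\<^sup>2 * lam\<^sup>2) * NY k t w / real q) + theta * (SD k t w + NY k t w)
      \<le> (1 + kap J) * del k t w + wy m t * errY k t w + theta * SD k t w"
    proof (rule stage_inequality)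
      show "del k (Suc t) w \<le> del k t w - (lam * l1 / 2) * NY k t w + (4 * lam / mu) * errY k t w"
        using y_step_later[OF t(1)] by simp
      show "(1 + kap J) * (4 * lam / mu) + wy m (Suc t) \<le> wy m t"
        using kap_5(1) wy_Suc[of m t] by linarith
      have "wy m (Suc t) * ((Lg)\<^sup>2 * lam\<^sup>2) / real q = (wy m (Suc t) / real q) * ((Lg)\<^sup>2 * lam\<^sup>2)" by simp
      also have "\<dots> \<le> Ay * ((Lg)\<^sup>2 * lam\<^sup>2)" by (intro mult_right_mono wy_le m) simp
      finally show "wy m (Suc t) * ((Lg)\<^sup>2 * lam\<^sup>2) / real q + theta \<le> lam * l1 / 2"
        using gain_y unfolding theta_def[symmetric] by linarith
    qed (use kap_nonneg sq_nonneg lam_pos l1 in simp_all)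
    then show "base_Psi m k (Suc t) w + wy m (Suc t) * (errY k t w + drift_y (Yz k w (Suc t)) (Yz k w t) / real q) \<le> Psi m k t w"
      unfolding base_Psi_def Psi_def drift_y_later[OF t(1)] by (simp add: SD_def)
qed

text \<open>Budget of the x-movement: 1/10 for the shift of \<open>vs\<close>, 1/144 + 1/16 for the
  drift in the v-loop, 129/1280 for the shift of \<open>ys\<close>, 1/16 for the drift in the
  y-loop; together less than the 5/12 of \<open>x_step\<close>.\<close>

lemma nx_coeff: "cD + (1 + kap J) * cy + Ay * (Lg)\<^sup>2 * al\<^sup>2 \<le> 5 / 12 * al"
proof -
  \<comment> \<open>\<open>1 + 4 / s\<close> is at most 17/4 over \<open>s\<close> because
    \<open>s \<le> 1 / 4\<close>, and 17/4 divided by 48 is below 1/10.\<close>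
  have four: "(1 + 4 / s) * X * al\<^sup>2 \<le> 1 / 10 * al"
    if s: "0 < s" "s \<le> 1 / 4" "48 * al * X \<le> s" "0 \<le> X" for s X
  proof -
    have "1 + 4 / s \<le> 17 / 4 / s" using s by (simp add: field_simps)
    then have "(1 + 4 / s) * (al * X) \<le> 17 / 4 / s * (al * X)" using s al_pos by (intro mult_right_mono) auto
    also have "\<dots> \<le> 17 / 4 / s * (s / 48)" using s by (intro mult_left_mono) auto
    also have "\<dots> \<le> 1 / 10" using s by simp
    finally have "(1 + 4 / s) * (al * X) * al \<le> 1 / 10 * al" using al_pos by (intro mult_right_mono) auto
    then show ?thesis by (simp add: power2_eq_square mult_ac)
  qed
  have v: "(1 + 4 / (rho * mu)) * (C_v c)\<^sup>2 * al\<^sup>2 \<le> 1 / 10 * al"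
    using rho_pos mu_pos rho_mu al_Cv by (intro four) auto
  have "cy \<le> 1 / 10 * al"
    unfolding cy_def
  proof (rule four)
    have "0 \<le> al * (C_y c)\<^sup>2" using al_pos by simp
    then show "48 * al * (C_y c)\<^sup>2 \<le> lam * mu" using al_Cy by linarith
  qed (use lam_pos mu_pos lam_mu in auto)
  then have "(1 + kap J) * cy \<le> 129 / 128 * (1 / 10 * al)"
    using kap_J kap_nonneg coeff_nonneg al_pos by (intro mult_mono) auto
  moreover have "Ax * M1 * al * al \<le> 1 / 144 * al" "Av * M1 * al * al \<le> 1 / 16 * al"
    "Ay * (Lg)\<^sup>2 * al * al \<le> 1 / 16 * al"
    using al_M1' al_Av al_Ay al_pos by (auto intro!: mult_right_mono)
  moreover have "(Ax + Av) * M1 * al\<^sup>2 = Ax * M1 * al * al + Av * M1 * al * al"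
    "Ay * (Lg)\<^sup>2 * al\<^sup>2 = Ay * (Lg)\<^sup>2 * al * al"
    by (simp_all add: power2_eq_square algebra_simps)
  moreover have sum: "a1 + (a2 + a3) + a4 + a5 \<le> 5 / 12 * al" if "a1 \<le> 1 / 10 * al" "a2 \<le> 1 / 144 * al"
    "a3 \<le> 1 / 16 * al" "a4 \<le> 129 / 128 * (1 / 10 * al)" "a5 \<le> 1 / 16 * al" for a1 a2 a3 a4 a5
    using that al_pos by linarith
  ultimately show ?thesis unfolding cD_def using v by (simp only: sum)
qed

text \<open>In units of \<open>lam * mu / 128\<close>, the contraction gains 32, against 4 for
  \<open>kap J\<close>, 5 for the bias of the first v-step and 16 for the x-step.\<close>

lemma dy_coeff:
  "(1 + kap J) * (1 - lam * mu / 4) + 5 * rho * M1 / mu + al * M1 \<le> 1"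
proof -
  have "1 * (rho * M1 / mu) \<le> real J * (rho * M1 / mu)"
    using J_pos rho_pos M1_pos mu_pos by (intro mult_right_mono) auto
  then have "5 * rho * M1 / mu \<le> 5 * (lam * mu / 128)" using rho_le by simp
  moreover have "(1 + kap J) * (1 - lam * mu / 4) \<le> 1 + kap J - lam * mu / 4"
    using kap_nonneg[of J] lam_pos mu_pos by (simp add: algebra_simps)
  moreover have "0 < lam * mu" using lam_pos mu_pos by simp
  ultimately show ?thesis using kap_J(1) al_M1 by linarith
qed

text \<open>The x-step and the first y-step are compared with \<open>V\<close> together, and the
  terms are balanced separately in each of \<open>dy\<close>, \<open>dv\<close>, \<open>nx\<close>,
  the squared y-estimator and the errors.\<close>

lemma Psi_first:
  assumes m: "Suc m \<le> q"
  shows "E (Psi m k 1) \<le> E (V (Suc m) k)"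
  unfolding One_nat_def
proof (rule order_trans[OF Psi_noise[OF T_pos]], intro nn_integral_mono ennreal_leI)
    fix w
    define a where "a = (Lg)\<^sup>2"
    define n0 where "n0 = NY k 0 w"
    have "(1 + kap J) * del k (Suc 0) w \<le> (1 + kap J) * ((1 - lam * mu / 4) * dy k w - lam * l1 / 2 * n0
        + 17 / 4 * lam / mu * ey k w + (1 + 4 / (lam * mu)) * (C_y c)\<^sup>2 * (al\<^sup>2 * nx k w))"
      unfolding n0_def using kap_nonneg[of J] by (intro mult_left_mono y_step_first[unfolded One_nat_def]) auto
    also have "\<dots> = (1 + kap J) * (1 - lam * mu / 4) * dy k w - (1 + kap J) * (lam * l1 / 2 * n0)
        + (1 + kap J) * (17 / 4 * lam / mu) * ey k w + (1 + kap J) * cy * nx k w"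
      by (simp add: cy_def algebra_simps)
    finally have f1: "(1 + kap J) * del k (Suc 0) w \<le> (1 + kap J) * (1 - lam * mu / 4) * dy k w - (1 + kap J) * (lam * l1 / 2 * n0)
        + (1 + kap J) * (17 / 4 * lam / mu) * ey k w + (1 + kap J) * cy * nx k w" .
    have f1': "1 * (lam * l1 / 2 * n0) \<le> (1 + kap J) * (lam * l1 / 2 * n0)"
      using kap_nonneg[of J] sq_nonneg lam_pos l1 by (intro mult_right_mono) (auto simp: n0_def)
    have f2: "(1 + kap J) * (17 / 4 * lam / mu) * ey k w \<le> 5 * lam / mu * ey k w"
      by (intro mult_right_mono kap_5 sq_nonneg)
    have "wy m (Suc 0) * (drift_y (Yz k w (Suc 0)) (Yz k w 0) / real q)
        = (wy m (Suc 0) / real q) * (a * (al\<^sup>2 * nx k w + lam\<^sup>2 * n0))"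
      using drift_y_first[of k w, unfolded One_nat_def] by (simp add: a_def n0_def)
    also have "\<dots> \<le> Ay * (a * (al\<^sup>2 * nx k w + lam\<^sup>2 * n0))"
      using sq_nonneg by (intro mult_right_mono wy_le m) (auto simp: a_def n0_def)
    finally have f3: "wy m (Suc 0) * (drift_y (Yz k w (Suc 0)) (Yz k w 0) / real q)
        \<le> Ay * a * al\<^sup>2 * nx k w + Ay * (a * lam\<^sup>2) * n0" by (simp add: algebra_simps)
    \<comment> \<open>The gain of the first y-step covers its own drift and its contribution to the
      reserve for the v-loop.\<close>
    have f4: "(Ay * (a * lam\<^sup>2) + theta) * n0 \<le> lam * l1 / 2 * n0"
      using gain_y sq_nonneg by (intro mult_right_mono) (auto simp: theta_def a_def n0_def)
    have f5: "((1 + kap J) * (1 - lam * mu / 4) + 5 * rho * M1 / mu + al * M1) * dy k w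
        \<le> 1 * dy k w"
      by (intro mult_right_mono dy_coeff sq_nonneg)
    have f6: "(1 - rho * mu / 4 + 2 * al * a) * dv k w \<le> 1 * dv k w"
    proof (intro mult_right_mono sq_nonneg)
      have "0 < rho * mu" using rho_pos mu_pos by simp
      then show "1 - rho * mu / 4 + 2 * al * a \<le> 1" using al_Lg unfolding a_def by linarith
    qed
    have f7: "(cD + (1 + kap J) * cy + Ay * a * al\<^sup>2) * nx k w \<le> 5 / 12 * al * nx k w"
      unfolding a_def by (intro mult_right_mono nx_coeff sq_nonneg)
    have f8: "gP k w + Ph (xk (Suc k) w) \<le> Ph (xk k w) - 5 / 12 * al * nx k w + Ax * ex k w
        + al * M1 * dy k w + 2 * al * a * dv k w"
      using x_step[of k w] Ax_def unfolding a_def by simp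
    have f9: "wy m (Suc 0) * errY k 0 w = real (Suc m) * Ay * ey k w - 5 * lam / mu * ey k w"
      unfolding wy_1[unfolded One_nat_def] E_0 by (rule left_diff_distrib)
    have f10: "SD k (Suc 0) w = n0" by (simp add: SD_def n0_def)
    have "base_Psi m k (Suc 0) w + wy m (Suc 0) * (errY k 0 w + drift_y (Yz k w (Suc 0)) (Yz k w 0) / real q)
        = base_Psi m k (Suc 0) w + wy m (Suc 0) * errY k 0 w + wy m (Suc 0) * (drift_y (Yz k w (Suc 0)) (Yz k w 0) / real q)"
      by (simp only: distrib_left add.assoc)
    moreover have "V (Suc m) k w = Ph (xk k w) + dy k w + dv k w + real m * Ax * ex k w + Ax * ex k w
        + real (Suc m) * Ay * ey k w + real (Suc m) * Av * ev k w"
      by (simp add: V_def algebra_simps)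
    ultimately show "base_Psi m k (Suc 0) w + wy m (Suc 0) * (errY k 0 w + drift_y (Yz k w (Suc 0)) (Yz k w 0) / real q) \<le> V (Suc m) k w"
      using f1 f1' f2 f3 f4[unfolded distrib_right] f5[unfolded distrib_right3] f6[unfolded distrib_right]
        f7[unfolded distrib_right3] f8 f9
      unfolding base_Psi_def K0_def f10 by linarith
qed

end

section \<open>The v-loop of one iteration\<close>

context als_steps begin

text \<open>The v-samples are integrated out first, with the new x-error in the remainder, and then
  the x-samples. The iterate at \<open>Suc j\<close> ignores both sets.\<close>

lemma inner_noise_xv:
  assumes R [measurable]: "rv R" and R0: "\<And>w. 0 \<le> R w"
    and inv: "\<And>w i z. R (w((Inner_x k j, i) := z)) = R w" "\<And>w i z. R (w((Inner_v k j, i) := z)) = R w"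
    and ab: "0 \<le> a" "0 \<le> b"
  shows "E (\<lambda>w. R w + a * errX k (Suc j) w + b * errV k (Suc j) w)
    \<le> E (\<lambda>w. R w + a * (errX k j w + drift (U k w (Suc j)) (U k w j) / real q)
          + b * (errV k j w + drift (U k w (Suc j)) (U k w j) / real q))"
proof -
  let ?d = "\<lambda>w. drift (U k w (Suc j)) (U k w j) / real q"
  note upd_x = U_Suc_upd[OF disjI1[OF refl]] Inner_xv_upd[of "Inner_x k j" k j, OF disjI1[OF refl]]
    and upd_v = U_Suc_upd[OF disjI2[OF refl]] Inner_xv_upd[of "Inner_v k j" k j, OF disjI2[OF refl]] DX_Inner_v_upd
  have "E (\<lambda>w. (R w + a * errX k (Suc j) w) + b * errV k (Suc j) w)
      \<le> E (\<lambda>w. (R w + a * errX k (Suc j) w) + b * (errV k j w + ?d w))"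
    unfolding errV_def
    by (rule inner_noise_v) (measurable, simp_all add: R0 ab sq_nonneg inv upd_v errX_def)
  also have "\<dots> = E (\<lambda>w. (R w + b * (errV k j w + ?d w)) + a * errX k (Suc j) w)"
    by (simp add: add_ac)
  also have "\<dots> \<le> E (\<lambda>w. (R w + b * (errV k j w + ?d w)) + a * (errX k j w + ?d w))"
    unfolding errX_def
    by (rule inner_noise_x) (measurable, simp_all add: R0 ab sq_nonneg drift_nonneg inv upd_x errV_def)
  finally show ?thesis by (simp add: add_ac)
qed

lemma upd_xv:
  assumes "d = Inner_x k j \<or> d = Inner_v k j"
  shows "gP k (w((d, i) := z)) = gP k w" "xk (Suc k) (w((d, i) := z)) = xk (Suc k) w"
    "del k T (w((d, i) := z)) = del k T w" "errY k T (w((d, i) := z)) = errY k T w"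
    "nu k (Suc j) (w((d, i) := z)) = nu k (Suc j) w"
  using Inner_xv_upd[OF assms] U_Suc_upd[OF assms] by (simp_all only: gP_def del_def errY_def nu_def)

lemma xv_weight: "Suc m \<le> q \<Longrightarrow> 0 \<le> D \<Longrightarrow> real m * Ax * (D / real q) + wv m j * (D / real q) \<le> (Ax + Av) * D"
proof -
  assume m: "Suc m \<le> q" and D: "0 \<le> D"
  have "real m * Ax \<le> real q * Ax" using m A_nonneg by (intro mult_right_mono) auto
  then have "real m * Ax / real q \<le> Ax" using q_pos by (simp add: divide_le_eq mult.commute)
  then have "real m * Ax / real q * D + wv m j / real q * D \<le> Ax * D + Av * D"
    using wv_le[OF m, of j] D by (intro add_mono mult_right_mono) auto
  then show ?thesis by (simp add: distrib_right)
qed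

definition rest where
  "rest m k j w = gP k w + Ph (xk (Suc k) w) + (1 + kap (J - j)) * del k T w + real m * Ay * errY k T w + nu k j w"

lemma Theta_rest: "Theta m k j w = rest m k j w + real m * Ax * errX k j w + wv m j * errV k j w"
  by (simp add: Theta_def rest_def)

lemma Theta_noise:
  assumes j: "j < J"
  shows "E (Theta m k (Suc j))
    \<le> E (\<lambda>w. rest m k (Suc j) w + real m * Ax * (errX k j w + drift (U k w (Suc j)) (U k w j) / real q)
          + wv m (Suc j) * (errV k j w + drift (U k w (Suc j)) (U k w j) / real q))"
  unfolding Theta_rest
proof (rule inner_noise_xv)
  show "rv (rest m k (Suc j))" unfolding rest_def[abs_def] by measurable
  show "0 \<le> rest m k (Suc j) w" for w
    unfolding rest_def using sq_nonneg Ph_nonneg kap_nonneg A_nonneg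
    by (intro add_nonneg_nonneg mult_nonneg_nonneg) auto
  show "rest m k (Suc j) (w((Inner_x k j, i) := z)) = rest m k (Suc j) w"
    "rest m k (Suc j) (w((Inner_v k j, i) := z)) = rest m k (Suc j) w" for w i z
    by (simp_all only: rest_def upd_xv[OF disjI1[OF refl]] upd_xv[OF disjI2[OF refl]])
qed (use j A_nonneg coeff_nonneg in auto)

lemma wv_Suc: "wv m j = wv m (Suc j) + 8 * rho / mu"
proof -
  have "(real J - real j) * d = (real J - real (Suc j)) * d + d" for d by (simp add: algebra_simps)
  from this[of "8 * rho / mu"] show ?thesis by (simp only: wv_def add.assoc)
qed

lemma Theta_step:
  assumes j: "0 < j" "j < J" and m: "Suc m \<le> q"
  shows "E (Theta m k (Suc j)) \<le> E (Theta m k j)"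
proof (rule order_trans[OF Theta_noise[OF j(2)]], intro nn_integral_mono ennreal_leI)
  fix w
  define D where "D = drift (U k w (Suc j)) (U k w j)"
  have "real m * Ax * (D / real q) + wv m (Suc j) * (D / real q) \<le> (Ax + Av) * D"
    unfolding D_def by (rule xv_weight[OF m drift_nonneg(1)])
  also have "\<dots> \<le> (Ax + Av) * (2 * (Lg)\<^sup>2 * (rho\<^sup>2 * NV k j w))"
    unfolding D_def using A_nonneg by (intro mult_left_mono drift_later j) auto
  also have "\<dots> = (Ax + Av) * (2 * (Lg)\<^sup>2 * rho\<^sup>2) * NV k j w" by simp
  also have "\<dots> \<le> rho * l2 / 2 * NV k j w" by (intro mult_right_mono gain_v sq_nonneg)
  finally have f1: "real m * Ax * (D / real q) + wv m (Suc j) * (D / real q) \<le> rho * l2 / 2 * NV k j w" .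
  have f2: "nu k (Suc j) w \<le> nu k j w - rho * l2 / 2 * NV k j w + 8 * rho / mu * errV k j w
    + 4 * rho * M1 / mu * del k T w"
    by (rule v_step_later[OF j(1)])
  \<comment> \<open>One increment of \<open>kap\<close> is released and matches the bias term of
    \<open>v_step_later\<close>.\<close>
  have "J - j = Suc (J - Suc j)" using j by simp
  then have f3: "(1 + kap (J - j)) * del k T w = (1 + kap (J - Suc j)) * del k T w + 4 * rho * M1 / mu * del k T w"
    by (simp only: kap_Suc) (simp add: distrib_right)
  have f4: "wv m j * errV k j w = wv m (Suc j) * errV k j w + 8 * rho / mu * errV k j w"
    by (subst wv_Suc) (rule distrib_right)
  have "rest m k (Suc j) w + real m * Ax * (errX k j w + D / real q) + wv m (Suc j) * (errV k j w + D / real q)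
      \<le> Theta m k j w"
    using f1 f2 unfolding rest_def Theta_def distrib_left[of "real m * Ax"] distrib_left[of "wv m (Suc j)"] f3 f4
    by linarith
  then show "rest m k (Suc j) w + real m * Ax * (errX k j w + drift (U k w (Suc j)) (U k w j) / real q)
      + wv m (Suc j) * (errV k j w + drift (U k w (Suc j)) (U k w j) / real q) \<le> Theta m k j w"
    by (simp only: D_def)
qed

lemma Theta_first:
  assumes m: "Suc m \<le> q"
  shows "E (Theta m k 1) \<le> E (Psi m k T)"
  unfolding One_nat_def
proof (rule order_trans[OF Theta_noise[OF J_pos]], intro nn_integral_mono ennreal_leI)
  fix w
  define D where "D = drift (U k w (Suc 0)) (U k w 0)"
  let ?a = "(Ax + Av) * M1 * al\<^sup>2"
  have "real m * Ax * (D / real q) + wv m (Suc 0) * (D / real q) \<le> (Ax + Av) * D"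
    unfolding D_def by (rule xv_weight[OF m drift_nonneg(1)])
  also have "\<dots> \<le> (Ax + Av) * (M1 * (al\<^sup>2 * nx k w + real T * lam\<^sup>2 * SD k T w) + 2 * (Lg)\<^sup>2 * (rho\<^sup>2 * NV k 0 w))"
    unfolding D_def using A_nonneg drift_first[of k w] by (intro mult_left_mono) auto
  \<comment> \<open>The reserve \<open>theta\<close> meets the displacement of y in the
    drift.\<close>
  also have "\<dots> = ?a * nx k w + theta * SD k T w + (Ax + Av) * (2 * (Lg)\<^sup>2 * rho\<^sup>2) * NV k 0 w"
    by (simp add: theta_def algebra_simps)
  also have "\<dots> \<le> ?a * nx k w + theta * SD k T w + rho * l2 / 2 * NV k 0 w"
    by (intro add_left_mono mult_right_mono gain_v sq_nonneg)
  finally have f1: "real m * Ax * (D / real q) + wv m (Suc 0) * (D / real q)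
      \<le> ?a * nx k w + theta * SD k T w + rho * l2 / 2 * NV k 0 w" .
  have f2: "nu k (Suc 0) w \<le> (1 - rho * mu / 4) * dv k w - rho * l2 / 2 * NV k 0 w + 9 * rho / mu * ev k w
    + 5 * rho * M1 / mu * dy k w + (1 + 4 / (rho * mu)) * (C_v c)\<^sup>2 * al\<^sup>2 * nx k w"
    using v_step_first[of k w] by (simp add: mult.assoc)
  \<comment> \<open>The first v-step is biased by the old y-error, already charged in
    \<open>K0\<close>, so this increment of \<open>kap\<close> is dropped.\<close>
  have f3: "(1 + kap (J - Suc 0)) * del k T w \<le> (1 + kap J) * del k T w"
  proof (intro mult_right_mono sq_nonneg add_left_mono)
    show "kap (J - Suc 0) \<le> kap J"
      unfolding kap_def using rho_pos mu_pos M1_pos by (intro mult_right_mono) auto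
  qed
  \<comment> \<open>The \<open>J - 1\<close> later steps are rounded up from 8 to 9; with 9 for the
    first step they make one full \<open>Av\<close>.\<close>
  have "wv m (Suc 0) + 9 * rho / mu \<le> real (Suc m) * Av"
  proof -
    have "(real J - real (Suc 0)) * (8 * rho / mu) \<le> (real J - real (Suc 0)) * (9 * rho / mu)"
      using J_pos rho_pos mu_pos by (intro mult_left_mono divide_right_mono) auto
    moreover have "(real J - real (Suc 0)) * (9 * rho / mu) + 9 * rho / mu = Av"
    proof -
      have "(real J - real (Suc 0)) * d + d = real J * d" for d by (simp add: algebra_simps)
      from this[of "9 * rho / mu"] show ?thesis by (simp add: Av_def)
    qed
    moreover have "real (Suc m) * Av = real m * Av + Av" by (simp add: distrib_right)
    ultimately show ?thesis unfolding wv_def by linarith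
  qed
  then have "(wv m (Suc 0) + 9 * rho / mu) * ev k w \<le> real (Suc m) * Av * ev k w"
    by (intro mult_right_mono sq_nonneg)
  then have f4: "wv m (Suc 0) * ev k w + 9 * rho / mu * ev k w \<le> real (Suc m) * Av * ev k w"
    by (simp only: distrib_right)
  have f5: "cD * nx k w = (1 + 4 / (rho * mu)) * (C_v c)\<^sup>2 * al\<^sup>2 * nx k w + ?a * nx k w"
    unfolding cD_def by (rule distrib_right)
  have f6: "wy m T = real m * Ay" by (simp add: wy_def)
  have "rest m k (Suc 0) w + real m * Ax * (errX k 0 w + D / real q) + wv m (Suc 0) * (errV k 0 w + D / real q)
      \<le> Psi m k T w"
    using f1 f2 f3 f4 unfolding rest_def Psi_def K0_def distrib_left[of "real m * Ax"] distrib_left[of "wv m (Suc 0)"]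
      f5 f6 E_0 by linarith
  then show "rest m k (Suc 0) w + real m * Ax * (errX k 0 w + drift (U k w (Suc 0)) (U k w 0) / real q)
      + wv m (Suc 0) * (errV k 0 w + drift (U k w (Suc 0)) (U k w 0) / real q) \<le> Psi m k T w"
    by (simp only: D_def)
qed

text \<open>The potential with the estimators as they are before a possible restart.\<close>

definition V' where
  "V' n k w = Ph (xk k w) + dy k w + dv k w
    + real n * (Ax * (norm (st_Dx (st k w) - dir_x f g (uk k w)))\<^sup>2
      + Ay * (norm (st_Dy (st k w) - dir_y g (xk k w, yk k w)))\<^sup>2
      + Av * (norm (st_Dv (st k w) - dir_v f g (uk k w)))\<^sup>2)"

text \<open>At the last position \<open>kap\<close> is zero and \<open>wv\<close> is
  \<open>m\<close> multiples of \<open>Av\<close>. Positivity of \<open>T\<close> and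
  \<open>J\<close> enters because only positive positions of the loops carry the new x.\<close>

lemma Theta_J: "Theta m k J w = gP k w + V' m (Suc k) w"
proof -
  have "U k w j = (xk (Suc k) w, yk (Suc k) w, snd (snd (U k w j)))" if "0 < j" for j
    using that by (cases j) (simp_all add: U_Suc)
  from this[OF J_pos] have "U k w J = uk (Suc k) w" by (simp only: vk_Suc)
  moreover have "Yz k w t = (xk (Suc k) w, snd (Yz k w t))" if "0 < t" for t
    using that by (cases t) (simp_all add: Yz_Suc)
  from this[OF T_pos] have "Yz k w T = (xk (Suc k) w, yk (Suc k) w)" by (simp only: yk_Suc)
  ultimately show ?thesis
    unfolding Theta_def V'_def del_T nu_J errX_def errY_def errV_def st_Dx_Suc st_Dy_Suc st_Dv_Suc
    by (simp add: kap_def wv_def algebra_simps)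
qed

text \<open>\<open>V\<close>, \<open>Psi\<close> and \<open>Theta\<close> are chained along the
  algorithm: the multiplicity falls from \<open>Suc m\<close> to \<open>m\<close> in exchange for
  \<open>gP\<close>.\<close>

lemma iteration:
  assumes m: "Suc m \<le> q"
  shows "E (\<lambda>w. gP k w + V' m (Suc k) w) \<le> E (V (Suc m) k)"
proof -
  have Psi: "E (Psi m k t) \<le> E (V (Suc m) k)"
    if "1 \<le> t" "t \<le> T" for t
    using that
  proof (induction t rule: dec_induct)
    case base show ?case by (rule Psi_first[OF m])
  next
    case (step t) then show ?case using Psi_step[OF _ _ m, of t k] by fastforce
  qed
  have Theta: "E (Theta m k j) \<le> E (Psi m k T)"
    if "1 \<le> j" "j \<le> J" for j
    using that
  proof (induction j rule: dec_induct)
    case base show ?case by (rule Theta_first[OF m])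
  next
    case (step j) then show ?case using Theta_step[OF _ _ m, of j k] by fastforce
  qed
  have "1 \<le> J" "1 \<le> T" using J_pos T_pos by auto
  then show ?thesis using order_trans[OF Theta[of J] Psi[of T]] by (simp add: Theta_J)
qed

section \<open>Restarts and summation over the iterations\<close>

definition sig where "sig = real q * (Ax * sig_x + Ay * sig_y + Av * sig_v) / real S1"

lemma sig_tot_nonneg: "0 \<le> sig" using A_nonneg sig_nonneg by (simp add: sig_def)

definition base where "base k w = Ph (xk k w) + dy k w + dv k w"

lemma base_nonneg: "0 \<le> base k w" using Ph_nonneg sq_nonneg by (simp add: base_def)

lemma measurable_base [measurable]: "rv (\<lambda>w. base k w)"
  unfolding base_def by measurable

text \<open>The three sample sets are integrated out in turn; errors not yet treated use other
  blocks and stay in the remainder. The fresh errors carry the full multiplicity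
  \<open>q\<close>.\<close>

lemma restart:
  assumes dvd: "q dvd k"
  shows "E (V q k) \<le> E (base k) + ennreal sig"
proof -
  let ?a = "real q * Ax" and ?b = "real q * Ay" and ?d = "real q * Av"
  have base: "base k (w((d, i) := z)) = base k w" if "d \<in> {Outer_x k, Outer_y k, Outer_v k}" for w i z d
    using Outer_upd[OF that] by (simp add: base_def sq_defs)
  have o: "samp (w((Outer_x k, i) := z)) (Outer_y k) = samp w (Outer_y k)"
    "samp (w((Outer_x k, i) := z)) (Outer_v k) = samp w (Outer_v k)"
    "samp (w((Outer_y k, i) := z)) (Outer_v k) = samp w (Outer_v k)" for w :: "draw \<times> nat \<Rightarrow> 'xi \<times> 'zeta" and i z
    by (rule samp_upd_other; simp)+
  have st: "st k (w((Outer_x k, i) := z)) = st k w" "st k (w((Outer_y k, i) := z)) = st k w"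
     "st k (w((Outer_v k, i) := z)) = st k w" for w i z
    by (rule Outer_upd; simp)+
  have inv: "ey k (w((Outer_x k, i) := z)) = ey k w" "ev k (w((Outer_x k, i) := z)) = ev k w"
    "ev k (w((Outer_y k, i) := z)) = ev k w" for w i z
    by (simp_all only: ey_def ev_def Dy0_def Dv0_def st o)
  have "E (V q k)
      = E (\<lambda>w. (base k w + ?b * ey k w + ?d * ev k w) + ?a * ex k w)"
    by (simp add: V_def base_def algebra_simps)
  also have "\<dots> \<le> E (\<lambda>w. (base k w + ?b * ey k w + ?d * ev k w) + ?a * (sig_x / real S1))"
    unfolding ex_def
    by (rule outer_noise_x[OF dvd]) (measurable, simp_all add: base_nonneg A_nonneg sq_nonneg inv base)
  also have "\<dots> = E (\<lambda>w. (base k w + ?a * (sig_x / real S1) + ?d * ev k w) + ?b * ey k w)"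
    by (simp add: add_ac)
  also have "\<dots> \<le> E (\<lambda>w. (base k w + ?a * (sig_x / real S1) + ?d * ev k w) + ?b * (sig_y / real S1))"
    unfolding ey_def
    by (rule outer_noise_y[OF dvd]) (measurable, simp_all add: base_nonneg A_nonneg sq_nonneg sig_nonneg inv base)
  also have "\<dots> = E (\<lambda>w. (base k w + ?a * (sig_x / real S1) + ?b * (sig_y / real S1)) + ?d * ev k w)"
    by (simp add: add_ac)
  also have "\<dots> \<le> E (\<lambda>w. (base k w + ?a * (sig_x / real S1) + ?b * (sig_y / real S1)) + ?d * (sig_v / real S1))"
    unfolding ev_def
    by (rule outer_noise_v[OF dvd]) (measurable, simp_all add: base_nonneg A_nonneg sq_nonneg sig_nonneg base)
  also have "\<dots> = (\<integral>\<^sup>+ w. ennreal (base k w) + ennreal sig \<partial>Q)"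
  proof (intro nn_integral_cong)
    fix w
    have "(base k w + ?a * (sig_x / real S1) + ?b * (sig_y / real S1)) + ?d * (sig_v / real S1) = base k w + sig"
      by (simp add: sig_def distrib_left add_divide_distrib)
    then show "ennreal ((base k w + ?a * (sig_x / real S1) + ?b * (sig_y / real S1)) + ?d * (sig_v / real S1))
      = ennreal (base k w) + ennreal sig"
      by (simp only:) (rule ennreal_plus[OF base_nonneg sig_tot_nonneg])
  qed
  also have "\<dots> = E (base k) + ennreal sig"
    using prob_space.emeasure_space_1[OF prob_Q] by (simp add: nn_integral_add)
  finally show ?thesis .
qed

lemma V_no_restart: "\<not> q dvd k \<Longrightarrow> V n k w = V' n k w"
  by (simp add: V_def V'_def ex_def ey_def ev_def Dx0_def Dy0_def Dv0_def)

lemma V'_nonneg: "0 \<le> V' n k w"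
  unfolding V'_def using Ph_nonneg sq_nonneg A_nonneg by (intro add_nonneg_nonneg mult_nonneg_nonneg) auto

text \<open>The current iteration counts as remaining: the multiplicity is \<open>q\<close> at a
  restart and never below 1.\<close>

definition total where "total k = E (\<lambda>w. V (q - k mod q) k w)"

lemma measurable_V' [measurable]: "rv (V' n k)"
  unfolding V'_def[abs_def] by measurable

text \<open>At the end of an epoch the multiplicity left is 0, so discarding the old estimators is
  free; otherwise no restart happens and \<open>V\<close> agrees with \<open>V'\<close>.\<close>

lemma total_Suc:
  "E (gP k) + total (Suc k) \<le> total k + (if q dvd Suc k then ennreal sig else 0)"
proof -
  define m where "m = q - k mod q - 1"
  have kq: "k mod q < q" using q_pos by simp
  have m: "Suc m \<le> q" "q - k mod q = Suc m" using kq by (auto simp: m_def)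
  have "E (gP k) + E (V' m (Suc k))
      = E (\<lambda>w. gP k w + V' m (Suc k) w)"
    using sq_nonneg V'_nonneg by (subst nn_integral_add[symmetric]) (auto simp: ennreal_plus)
  also have "\<dots> \<le> total k" unfolding total_def m(2) by (rule iteration[OF m(1)])
  finally have *: "E (gP k) + E (V' m (Suc k)) \<le> total k" .
  show ?thesis
  proof (cases "q dvd Suc k")
    case True
    then have "Suc k mod q = 0" by simp
    then have "k mod q = q - 1" using q_pos by (simp add: mod_Suc split: if_splits)
    then have m0: "m = 0" by (simp add: m_def)
    have "total (Suc k) \<le> E (base (Suc k)) + ennreal sig"
      unfolding total_def using restart[OF True] True by simp
    also have "E (base (Suc k)) = E (V' m (Suc k))"
      by (simp add: m0 V'_def base_def)
    finally have "E (gP k) + total (Suc k)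
        \<le> E (gP k) + (E (V' m (Suc k)) + ennreal sig)"
      by (rule add_left_mono)
    also have "\<dots> \<le> total k + ennreal sig" using * by (simp add: add.assoc[symmetric] add_right_mono)
    finally show ?thesis using True by simp
  next
    case False
    then have "Suc k mod q \<noteq> 0" by (simp add: dvd_eq_mod_eq_0)
    then have "Suc k mod q = Suc (k mod q)" by (simp add: mod_Suc split: if_splits)
    then have "q - Suc k mod q = m" by (simp add: m_def)
    then show ?thesis using * False by (simp add: total_def V_no_restart)
  qed
qed

text \<open>The last sum includes \<open>n\<close>, because \<open>total n\<close> already contains
  a restart at \<open>n\<close>.\<close>

lemma sum_gradients:
  "(\<Sum>i<n. E (gP i)) + total n
    \<le> ennreal (Ph x0 + (norm (y0 - ys x0))\<^sup>2 + (norm (v0 - vs x0))\<^sup>2) + (\<Sum>i\<le>n. if q dvd i then ennreal sig else 0)"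
proof (induction n)
  case 0
  have "total 0 \<le> E (base 0) + ennreal sig"
    unfolding total_def using restart[of 0] by simp
  then show ?case
    using prob_space.emeasure_space_1[OF prob_Q] by (simp add: base_def sq_defs st_0)
next
  case (Suc n)
  have "(\<Sum>i<Suc n. E (gP i)) + total (Suc n)
      = (\<Sum>i<n. E (gP i)) + (E (gP n) + total (Suc n))"
    by (simp add: add.assoc)
  also have "\<dots> \<le> (\<Sum>i<n. E (gP i)) + (total n + (if q dvd Suc n then ennreal sig else 0))"
    by (intro add_left_mono total_Suc)
  also have "\<dots> = ((\<Sum>i<n. E (gP i)) + total n) + (if q dvd Suc n then ennreal sig else 0)"
    by (simp only: add.assoc)
  also have "\<dots> \<le> (ennreal (Ph x0 + (norm (y0 - ys x0))\<^sup>2 + (norm (v0 - vs x0))\<^sup>2)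
      + (\<Sum>i\<le>n. if q dvd i then ennreal sig else 0)) + (if q dvd Suc n then ennreal sig else 0)"
    by (intro add_right_mono Suc.IH)
  finally show ?case by (simp only: sum.atMost_Suc add.assoc)
qed

end

section \<open>The step sizes\<close>

lemma le_divide_imp_mult_le: "(a::real) \<le> b / d \<Longrightarrow> 0 < d \<Longrightarrow> a * d \<le> b"
  by (simp add: le_divide_eq)

locale spider_steps = bilevel c f g M
  for c and f g :: "(real^'p) \<times> (real^'q) \<Rightarrow> real" and M +
  fixes T J :: nat and \<beta> \<eta> :: real
  assumes T_pos: "0 < T" and J_pos: "0 < J" and \<beta>: "0 < \<beta>" "\<beta> < 1" and \<eta>: "0 < \<eta>" "\<eta> < 1"
begin

text \<open>The last argument is the ratio of inner batch size to period, hence 1.\<close>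

abbreviation "l1 \<equiv> spider_lambda1 c M T J \<beta> 1"
abbreviation "l2 \<equiv> spider_lambda2 c M T J \<beta> \<eta> 1"
abbreviation "al \<equiv> spider_alpha c M T J \<beta> \<eta> 1"

lemma C_3_ge: "2 \<le> C_3 M T J" "real T \<le> C_3 M T J"
proof -
  have T: "1 \<le> real T" using T_pos by simp
  then have "real T * 1 \<le> real T * real T" by (intro mult_left_mono) auto
  moreover have "0 \<le> (real J)\<^sup>2 * M\<^sup>2" "0 \<le> (real J)\<^sup>2" by simp_all
  ultimately show "2 \<le> C_3 M T J" "real T \<le> C_3 M T J"
    using T unfolding C_3_def power2_eq_square[of "real T"] by linarith+
qed

text \<open>Since \<open>T\<close> and \<open>J\<close> are at least 1, the exponents in the step
  sizes are at least 7, 10 and 7; monotonicity turns the powers into fixed numbers.\<close>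

lemma half_power_le: "m \<le> n \<Longrightarrow> (1/2::real)^n \<le> (1/2)^m"
  by (rule power_decreasing) auto

lemma spider_lambda1_pos: "0 < l1"
  unfolding spider_lambda1_def
  using mu_pos Lg_pos T_pos \<beta> C_3_ge by simp

lemma spider_lambda1_le: "l1 \<le> 1 / (2 * Lg + 2 * mu)"
  "real T * (Lg)\<^sup>2 * \<beta>\<^sup>2 * l1 / mu \<le> 1 / 256"
proof -
  show "l1 \<le> 1 / (2 * Lg + 2 * mu)" by (simp add: spider_lambda1_def)
  let ?D = "real T * (Lg)\<^sup>2 * \<beta>\<^sup>2"
  have D: "0 < ?D" using T_pos Lg_pos \<beta> by simp
  have "l1 \<le> (1/2)^(2*T + 5) * mu * 1 / (?D * C_3 M T J)"
    by (simp only: spider_lambda1_def min.cobounded2)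
  then have "l1 * (?D * C_3 M T J) \<le> (1/2)^(2*T + 5) * mu * 1"
    using D C_3_ge by (intro le_divide_imp_mult_le) auto
  also have "\<dots> \<le> (1/2)^7 * mu"
    using T_pos mu_pos half_power_le[of 7 "2 * T + 5"] by (simp add: mult_right_mono)
  finally have "l1 * ?D * C_3 M T J \<le> mu / 128" by (simp add: power_divide mult.assoc)
  moreover have "l1 * ?D * 2 \<le> l1 * ?D * C_3 M T J"
    using C_3_ge D spider_lambda1_pos by (intro mult_left_mono) auto
  ultimately have "?D * l1 \<le> mu / 256" by (simp add: mult_ac)
  then have "?D * l1 / mu \<le> mu / 256 / mu" using mu_pos by (intro divide_right_mono) auto
  then show "?D * l1 / mu \<le> 1 / 256" using mu_pos by simp
qed

lemma spider_lambda2_pos: "0 < l2"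
proof -
  have "0 < (Lg)\<^sup>2 * \<eta>\<^sup>2 + real T * M1 * \<beta> * \<eta>"
    using Lg_pos \<eta> \<beta> M1_pos by (intro add_pos_nonneg) auto
  then show ?thesis
    unfolding spider_lambda2_def using mu_pos Lg_pos T_pos J_pos \<beta> \<eta> M1_pos spider_lambda1_pos by simp
qed

lemma spider_lambda2_le: "l2 \<le> 1 / (2 * Lg + 2 * mu)"
  "real J * (l2 * \<eta>) * M1 / mu \<le> l1 * \<beta> * mu / 128"
  "real J * l2 * ((Lg)\<^sup>2 * \<eta>\<^sup>2) / mu \<le> 1 / 1024"
  "real J * l2 * (real T * M1 * \<beta> * \<eta>) / mu \<le> 1 / 1024"
proof -
  show "l2 \<le> 1 / (2 * Lg + 2 * mu)" unfolding spider_lambda2_def by (rule Min_le; simp)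
  have "l2 \<le> (mu)\<^sup>2 * l1 * \<beta> / (128 * M1 * real J * \<eta>)" unfolding spider_lambda2_def by (rule Min_le; simp)
  then have "l2 * (128 * M1 * real J * \<eta>) \<le> (mu)\<^sup>2 * l1 * \<beta>"
    using M1_pos J_pos \<eta> by (intro le_divide_imp_mult_le) auto
  then have "(real J * (l2 * \<eta>) * M1 * 128) / mu \<le> (mu)\<^sup>2 * l1 * \<beta> / mu"
    using mu_pos by (intro divide_right_mono) (auto simp: mult_ac)
  then show "real J * (l2 * \<eta>) * M1 / mu \<le> l1 * \<beta> * mu / 128"
    using mu_pos by (simp add: power2_eq_square mult_ac)
  let ?a = "(Lg)\<^sup>2 * \<eta>\<^sup>2" and ?b = "real T * M1 * \<beta> * \<eta>"
  have ab: "0 < ?a" "0 \<le> ?b" using Lg_pos \<eta> \<beta> M1_pos by simp_all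
  have "l2 \<le> (1/2)^(2*(T + J) + 6) * mu * 1 / (real J * (?a + ?b))" unfolding spider_lambda2_def by (rule Min_le; simp)
  then have "l2 * (real J * (?a + ?b)) \<le> (1/2)^(2*(T + J) + 6) * mu * 1"
    using J_pos ab by (intro le_divide_imp_mult_le) auto
  also have "\<dots> \<le> (1/2)^10 * mu"
    using T_pos J_pos mu_pos half_power_le[of 10 "2 * (T + J) + 6"] by (simp add: mult_right_mono)
  finally have le: "real J * l2 * ?a + real J * l2 * ?b \<le> mu / 1024"
    by (simp add: power_divide algebra_simps)
  have "0 \<le> real J * l2 * ?a" "0 \<le> real J * l2 * ?b"
    using ab spider_lambda2_pos by simp_all
  with le have "real J * l2 * ?a \<le> mu / 1024" "real J * l2 * ?b \<le> mu / 1024" by linarith+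
  then have "real J * l2 * ?a / mu \<le> mu / 1024 / mu" "real J * l2 * ?b / mu \<le> mu / 1024 / mu"
    using mu_pos by (auto intro: divide_right_mono)
  then show "real J * l2 * ?a / mu \<le> 1 / 1024" "real J * l2 * ?b / mu \<le> 1 / 1024"
    using mu_pos by simp_all
qed

lemma alpha_denominators_pos:
  "0 < 96 * (C_y c)\<^sup>2 + 8 * M1" "0 < 48 * ((Lg)\<^sup>2 + (C_v c)\<^sup>2)"
  "0 < C_4 c M T J \<beta> 1" "0 < C_5 c M T J \<beta> \<eta> 1" "0 < M1 * real T * \<beta> + (Lg)\<^sup>2 * \<eta>"
proof -
  show "0 < 96 * (C_y c)\<^sup>2 + 8 * M1" using M1_pos by (intro add_nonneg_pos) auto
  show "0 < 48 * ((Lg)\<^sup>2 + (C_v c)\<^sup>2)" using Lg_pos by (simp add: add_pos_nonneg)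
  have "0 < 1 + inverse 1 * C_3 M T J" using C_3_ge by simp
  then show "0 < C_4 c M T J \<beta> 1" unfolding C_4_def using spider_lambda1_pos \<beta> Lg_pos by simp
  have "0 < 1 + (C_y c)\<^sup>2 + inverse 1 * real J" by (simp add: add_pos_nonneg)
  then show "0 < C_5 c M T J \<beta> \<eta> 1" unfolding C_5_def using spider_lambda2_pos \<eta> M1_pos by simp
  show "0 < M1 * real T * \<beta> + (Lg)\<^sup>2 * \<eta>" using M1_pos T_pos \<beta> Lg_pos \<eta> by (simp add: add_pos_pos)
qed

lemma spider_alpha_pos: "0 < al"
proof -
  have Min_pos: "\<forall>a\<in>A. 0 < a \<Longrightarrow> finite A \<Longrightarrow> A \<noteq> {} \<Longrightarrow> 0 < Min A" for A :: "real set" by simp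
  show ?thesis
    unfolding spider_alpha_def
    by (rule Min_pos)
       (use alpha_denominators_pos mu_pos spider_lambda1_pos spider_lambda2_pos \<beta> \<eta> L_Phi_pos M1_pos in simp_all)
qed

text \<open>The entries of the minimum, cleared of denominators; a sum in a denominator splits
  because its summands are nonnegative.\<close>

lemma spider_alpha_le:
  "al * M1 \<le> l1 * \<beta> * mu / 8" "96 * al * (C_y c)\<^sup>2 \<le> l1 * \<beta> * mu"
  "48 * al * (Lg)\<^sup>2 \<le> l2 * \<eta> * mu" "48 * al * (C_v c)\<^sup>2 \<le> l2 * \<eta> * mu"
  "al * L_Phi c \<le> 1 / 6" "al * M1 * al \<le> 1 / 144"
  "192 * (l1 * \<beta>) * (Lg)\<^sup>2 * real T * al \<le> mu"
  "192 * (l2 * \<eta>) * M1 * real J * al \<le> mu"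
  "al * (M1 * real T * \<beta>) \<le> 1 / 128" "al * ((Lg)\<^sup>2 * \<eta>) \<le> 1 / 128"
proof -
  note pos = alpha_denominators_pos spider_alpha_pos spider_lambda1_pos spider_lambda2_pos
  have "al \<le> mu * l1 * \<beta> / (96 * (C_y c)\<^sup>2 + 8 * M1)" unfolding spider_alpha_def by (rule Min_le; simp)
  then have 1: "al * (96 * (C_y c)\<^sup>2 + 8 * M1) \<le> mu * l1 * \<beta>"
    by (rule le_divide_imp_mult_le) (rule pos)
  have "0 \<le> al * (C_y c)\<^sup>2" "0 \<le> al * M1" using pos M1_pos by auto
  with 1 show "al * M1 \<le> l1 * \<beta> * mu / 8" "96 * al * (C_y c)\<^sup>2 \<le> l1 * \<beta> * mu"
    by (simp_all add: algebra_simps)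
  have "al \<le> mu * l2 * \<eta> / (48 * ((Lg)\<^sup>2 + (C_v c)\<^sup>2))" unfolding spider_alpha_def by (rule Min_le; simp)
  then have 2: "al * (48 * ((Lg)\<^sup>2 + (C_v c)\<^sup>2)) \<le> mu * l2 * \<eta>"
    by (rule le_divide_imp_mult_le) (rule pos)
  have "0 \<le> al * (C_v c)\<^sup>2" "0 \<le> al * (Lg)\<^sup>2" using pos by auto
  with 2 show "48 * al * (Lg)\<^sup>2 \<le> l2 * \<eta> * mu" "48 * al * (C_v c)\<^sup>2 \<le> l2 * \<eta> * mu"
    by (simp_all add: algebra_simps)
  have "al \<le> 1 / (6 * L_Phi c)" unfolding spider_alpha_def by (rule Min_le; simp)
  then show "al * L_Phi c \<le> 1 / 6" using le_divide_imp_mult_le[of al 1 "6 * L_Phi c"] L_Phi_pos by simp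
  have "al \<le> sqrt 1 / (12 * sqrt (M1))" unfolding spider_alpha_def by (rule Min_le; simp)
  then have "al * (12 * sqrt (M1)) \<le> sqrt 1" using M1_pos by (intro le_divide_imp_mult_le) auto
  then have "(al * (12 * sqrt (M1)))\<^sup>2 \<le> (sqrt 1)\<^sup>2" using pos M1_pos by (intro power_mono) auto
  then show "al * M1 * al \<le> 1 / 144" using M1_pos by (simp add: power_mult_distrib power2_eq_square[of al] mult_ac)
  have "al \<le> mu / C_4 c M T J \<beta> 1" unfolding spider_alpha_def by (rule Min_le; simp)
  then have "al * C_4 c M T J \<beta> 1 \<le> mu" by (rule le_divide_imp_mult_le) (rule pos)
  moreover have "192 * (l1 * \<beta>) * (Lg)\<^sup>2 * real T \<le> C_4 c M T J \<beta> 1"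
  proof -
    have "192 * (l1 * \<beta>) * (Lg)\<^sup>2 * real T \<le> 192 * (l1 * \<beta>) * (Lg)\<^sup>2 * (1 + inverse 1 * C_3 M T J)"
      using C_3_ge pos \<beta> by (intro mult_left_mono) auto
    then show ?thesis by (simp add: C_4_def mult_ac)
  qed
  then have "al * (192 * (l1 * \<beta>) * (Lg)\<^sup>2 * real T) \<le> al * C_4 c M T J \<beta> 1"
    using pos by (intro mult_left_mono) auto
  ultimately show "192 * (l1 * \<beta>) * (Lg)\<^sup>2 * real T * al \<le> mu" by (simp only: mult.commute[of _ al])
  have "al \<le> mu / C_5 c M T J \<beta> \<eta> 1" unfolding spider_alpha_def by (rule Min_le; simp)
  then have "al * C_5 c M T J \<beta> \<eta> 1 \<le> mu" by (rule le_divide_imp_mult_le) (rule pos)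
  moreover have "192 * (l2 * \<eta>) * M1 * real J \<le> C_5 c M T J \<beta> \<eta> 1"
  proof -
    have "192 * (l2 * \<eta>) * M1 * real J \<le> 192 * (l2 * \<eta>) * M1 * (1 + (C_y c)\<^sup>2 + inverse 1 * real J)"
      using pos \<eta> M1_pos by (intro mult_left_mono) auto
    then show ?thesis by (simp add: C_5_def mult_ac)
  qed
  then have "al * (192 * (l2 * \<eta>) * M1 * real J) \<le> al * C_5 c M T J \<beta> \<eta> 1"
    using pos by (intro mult_left_mono) auto
  ultimately show "192 * (l2 * \<eta>) * M1 * real J * al \<le> mu" by (simp only: mult.commute[of _ al])
  let ?a = "M1 * real T * \<beta>" and ?b = "(Lg)\<^sup>2 * \<eta>"
  have "al \<le> (1/2)^(2*(T + J) + 3) * 1 / (?a + ?b)" unfolding spider_alpha_def by (rule Min_le; simp)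
  then have "al * (?a + ?b) \<le> (1/2)^(2*(T + J) + 3) * 1" by (rule le_divide_imp_mult_le) (rule pos)
  also have "\<dots> \<le> (1/2)^7" using T_pos J_pos half_power_le[of 7 "2 * (T + J) + 3"] by simp
  finally have "al * ?a + al * ?b \<le> 1 / 128" by (simp add: power_divide algebra_simps)
  moreover have "0 \<le> al * ?a" "0 \<le> al * ?b" using pos M1_pos \<beta> \<eta> by auto
  ultimately show "al * ?a \<le> 1 / 128" "al * ?b \<le> 1 / 128" by linarith+
qed

text \<open>Divided by \<open>l1 * \<beta> * l1\<close>, the three terms are at most 5/256, 1/128
  and 9/1024.\<close>

lemma spider_gain_y:
  "5 * real T * (l1 * \<beta>) / mu * ((Lg)\<^sup>2 * (l1 * \<beta>)\<^sup>2)
    + (al + 9 * real J * (l2 * \<eta>) / mu) * M1 * (real T * (l1 * \<beta>)\<^sup>2) \<le> l1 * \<beta> * l1 / 2"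
proof -
  let ?x = "real T * (Lg)\<^sup>2 * \<beta>\<^sup>2 * l1 / mu" and ?y = "al * (M1 * real T * \<beta>)"
    and ?z = "real J * l2 * (real T * M1 * \<beta> * \<eta>) / mu"
  have "5 * ?x + ?y + 9 * ?z \<le> 1 / 2"
    using spider_lambda1_le(2) spider_alpha_le(9) spider_lambda2_le(4) by linarith
  then have "(l1 * \<beta> * l1) * (5 * ?x + ?y + 9 * ?z) \<le> (l1 * \<beta> * l1) * (1 / 2)"
    using spider_lambda1_pos \<beta> by (intro mult_left_mono) auto
  moreover have "(l1 * \<beta> * l1) * (5 * ?x + ?y + 9 * ?z) = 5 * real T * (l1 * \<beta>) / mu * ((Lg)\<^sup>2 * (l1 * \<beta>)\<^sup>2)
    + (al + 9 * real J * (l2 * \<eta>) / mu) * M1 * (real T * (l1 * \<beta>)\<^sup>2)"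
    using mu_pos by (simp add: power2_eq_square field_simps)
  ultimately show ?thesis by simp
qed

lemma spider_gain_v:
  "(al + 9 * real J * (l2 * \<eta>) / mu) * (2 * (Lg)\<^sup>2 * (l2 * \<eta>)\<^sup>2) \<le> l2 * \<eta> * l2 / 2"
proof -
  let ?x = "al * ((Lg)\<^sup>2 * \<eta>)" and ?y = "real J * l2 * ((Lg)\<^sup>2 * \<eta>\<^sup>2) / mu"
  have "2 * ?x + 18 * ?y \<le> 1 / 2" using spider_alpha_le(10) spider_lambda2_le(3) by linarith
  then have "(l2 * \<eta> * l2) * (2 * ?x + 18 * ?y) \<le> (l2 * \<eta> * l2) * (1 / 2)"
    using spider_lambda2_pos \<eta> by (intro mult_left_mono) auto
  moreover have "(l2 * \<eta> * l2) * (2 * ?x + 18 * ?y)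
      = (al + 9 * real J * (l2 * \<eta>) / mu) * (2 * (Lg)\<^sup>2 * (l2 * \<eta>)\<^sup>2)"
    using mu_pos by (simp add: power2_eq_square field_simps)
  ultimately show ?thesis by simp
qed

text \<open>The 192 in \<open>C_5\<close> and \<open>C_4\<close> leaves 9/192 and 5/192.\<close>

lemma spider_error_weights:
  "9 * real J * (l2 * \<eta>) / mu * M1 * al \<le> 1 / 16"
  "5 * real T * (l1 * \<beta>) / mu * (Lg)\<^sup>2 * al \<le> 1 / 16"
  using spider_alpha_le(7,8) mu_pos by (simp_all add: divide_le_eq mult_ac)

end

section \<open>Sample complexity\<close>

lemma card_multiples_below: "card {i \<in> {..<q * q}. q dvd i} = q" if "0 < q" for q :: nat
proof -
  have "{i \<in> {..<q * q}. q dvd i} = (\<lambda>j. q * j) ` {..<q}" using that by (auto simp: dvd_def)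
  moreover have "inj_on (\<lambda>j. q * j) {..<q}" using that by (auto simp: inj_on_def)
  ultimately show ?thesis by (simp add: card_image)
qed

text \<open>The additional multiple is the restart at \<open>q * q\<close>, which the bound of
  \<open>sum_gradients\<close> counts although a run of \<open>q * q\<close> iterations stops before
  it.\<close>

lemma card_multiples_upto: "card {i \<in> {..q * q}. q dvd i} = q + 1" if "0 < q" for q :: nat
proof -
  have "{i \<in> {..q * q}. q dvd i} = (\<lambda>j. q * j) ` {..q}" using that by (auto simp: dvd_def)
  moreover have "inj_on (\<lambda>j. q * j) {..q}" using that by (auto simp: inj_on_def)
  ultimately show ?thesis by (simp add: card_image)
qed

context stochastic_bilevel begin

definition initial_gap :: "real^'p \<Rightarrow> real^'q \<Rightarrow> real^'q \<Rightarrow> real" where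
  "initial_gap x0 y0 v0 = Phi f g x0 - Inf (range (Phi f g)) + (norm (y0 - ys x0))\<^sup>2 + (norm (v0 - vs x0))\<^sup>2"

text \<open>\<open>q\<close> times the cost of one restart when the outer batch has size
  \<open>q * q\<close>; the factors cancel, so all epochs together cost a constant.\<close>

definition noise_level :: "nat \<Rightarrow> nat \<Rightarrow> real \<Rightarrow> real \<Rightarrow> real" where
  "noise_level T J \<beta> \<eta> = spider_alpha c M T J \<beta> \<eta> 1 * sig_x
     + 5 * real T * (spider_lambda1 c M T J \<beta> 1 * \<beta>) / mu * sig_y
     + 9 * real J * (spider_lambda2 c M T J \<beta> \<eta> 1 * \<eta>) / mu * sig_v"

lemma spider_run:
  fixes x0 :: "real^'p" and y0 v0 :: "real^'q"
  assumes TJ: "0 < T" "0 < J" and \<beta>: "0 < \<beta>" "\<beta> < 1" and \<eta>: "0 < \<eta>" "\<eta> < 1"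
    and v0: "norm v0 \<le> M" and q: "0 < q"
  defines "x k w \<equiv> st_x (alg_run (als_spider c M T J \<beta> \<eta> q (q * q) q) F G x0 y0 v0 (samp w) k)"
  shows "(\<Sum>i<q * q. \<integral>\<^sup>+ w. ennreal ((norm (gradPhi (x i w)))\<^sup>2) \<partial>Q)
      \<le> ennreal (2 / spider_alpha c M T J \<beta> \<eta> 1 * (initial_gap x0 y0 v0 + 2 * noise_level T J \<beta> \<eta>))"
    and "rv (x k)"
    and "st_calls (alg_run (als_spider c M T J \<beta> \<eta> q (q * q) q) F G x0 y0 v0 (samp w) (q * q))
      = q ^ 3 * (5 + 2 * T + 8 * J)"
    and "0 < spider_alpha c M T J \<beta> \<eta> 1" and "0 \<le> initial_gap x0 y0 v0 + 2 * noise_level T J \<beta> \<eta>"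
proof -
  interpret S: spider_steps c f g M T J \<beta> \<eta> by unfold_locales (fact assms)+
  interpret A: als_steps c f g M P\<xi> P\<zeta> F G N T J q "q * q" \<beta> \<eta> S.l1 S.l2 S.al x0 y0 v0
    "S.l1 * \<beta>" "S.l2 * \<eta>" S.al "5 * real T * (S.l1 * \<beta>) / mu" "9 * real J * (S.l2 * \<eta>) / mu"
    by unfold_locales
       (use assms S.spider_lambda1_pos S.spider_lambda2_pos S.spider_alpha_pos S.spider_lambda1_le(1)
          S.spider_lambda2_le(1,2) S.spider_alpha_le S.spider_gain_y S.spider_gain_v S.spider_error_weights in \<open>simp_all\<close>)
  have P: "als_spider c M T J \<beta> \<eta> q (q * q) q = A.P" using q by (simp add: als_spider_def A.P_def)
  have st: "alg_run (als_spider c M T J \<beta> \<eta> q (q * q) q) F G x0 y0 v0 (samp w) k = A.st k w" for k w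
    by (simp add: P A.st_def)
  show "rv (x k)" unfolding x_def st by (rule A.measurable_st(1))
  show al: "0 < S.al" by (rule S.spider_alpha_pos)
  show nn: "0 \<le> initial_gap x0 y0 v0 + 2 * noise_level T J \<beta> \<eta>"
    using A.Ph_nonneg[of x0] A.A_nonneg sig_nonneg
    by (simp add: initial_gap_def noise_level_def A.Ph_def del: times_divide_eq_left)
  have "(\<Sum>i<q * q. if q dvd i then 5 * (q * q) else 0) = q * (5 * (q * q))"
    using card_multiples_below[OF q] by (simp add: sum.If_cases Int_def)
  then show "st_calls (alg_run (als_spider c M T J \<beta> \<eta> q (q * q) q) F G x0 y0 v0 (samp w) (q * q))
      = q ^ 3 * (5 + 2 * T + 8 * J)"
    unfolding st A.st_calls_eq by (simp add: power3_eq_cube algebra_simps)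
  have sig: "(\<Sum>i\<le>q * q. if q dvd i then ennreal A.sig else 0) \<le> ennreal (2 * noise_level T J \<beta> \<eta>)"
  proof -
    have "(\<Sum>i\<le>q * q. if q dvd i then ennreal A.sig else 0) = of_nat (q + 1) * ennreal A.sig"
      using card_multiples_upto[OF q] by (simp add: sum.If_cases Int_def)
    also have "\<dots> = ennreal (real (q + 1) * A.sig)"
      using A.sig_tot_nonneg by (simp add: ennreal_mult'' ennreal_of_nat_eq_real_of_nat)
    also have "\<dots> \<le> ennreal (2 * noise_level T J \<beta> \<eta>)"
    proof (rule ennreal_leI)
      have qs: "real q * A.sig = noise_level T J \<beta> \<eta>"
        using q by (simp add: A.sig_def noise_level_def)
      have "real (q + 1) * A.sig \<le> (2 * real q) * A.sig"
        using q A.sig_tot_nonneg by (intro mult_right_mono) auto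
      then show "real (q + 1) * A.sig \<le> 2 * noise_level T J \<beta> \<eta>" using qs by simp
    qed
    finally show ?thesis .
  qed
  have "(\<Sum>i<q * q. \<integral>\<^sup>+ w. ennreal (A.gP i w) \<partial>Q) \<le> (\<Sum>i<q * q. \<integral>\<^sup>+ w. ennreal (A.gP i w) \<partial>Q) + A.total (q * q)"
    by simp
  also have "\<dots> \<le> ennreal (initial_gap x0 y0 v0) + (\<Sum>i\<le>q * q. if q dvd i then ennreal A.sig else 0)"
    using A.sum_gradients[of "q * q"] by (simp only: initial_gap_def A.Ph_def)
  also have "\<dots> \<le> ennreal (initial_gap x0 y0 v0) + ennreal (2 * noise_level T J \<beta> \<eta>)"
    by (rule add_left_mono[OF sig])
  also have "\<dots> = ennreal (initial_gap x0 y0 v0 + 2 * noise_level T J \<beta> \<eta>)"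
    using A.Ph_nonneg[of x0] A.A_nonneg sig_nonneg
    by (intro ennreal_plus[symmetric])
       (simp_all add: initial_gap_def noise_level_def A.Ph_def del: times_divide_eq_left)
  finally have le: "(\<Sum>i<q * q. \<integral>\<^sup>+ w. ennreal (A.gP i w) \<partial>Q) \<le> ennreal (initial_gap x0 y0 v0 + 2 * noise_level T J \<beta> \<eta>)" .
  have "E (\<lambda>w. (norm (gradPhi (x i w)))\<^sup>2) = ennreal (2 / S.al) * E (A.gP i)" for i
  proof -
    have "ennreal ((norm (gradPhi (x i w)))\<^sup>2) = ennreal (2 / S.al) * ennreal (A.gP i w)" for w
      using al by (simp add: A.gP_def x_def st ennreal_mult[symmetric])
    then show ?thesis by (simp add: nn_integral_cmult)
  qed
  then have "(\<Sum>i<q * q. \<integral>\<^sup>+ w. ennreal ((norm (gradPhi (x i w)))\<^sup>2) \<partial>Q)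
      = ennreal (2 / S.al) * (\<Sum>i<q * q. \<integral>\<^sup>+ w. ennreal (A.gP i w) \<partial>Q)"
    by (simp add: sum_distrib_left)
  also have "\<dots> \<le> ennreal (2 / S.al) * ennreal (initial_gap x0 y0 v0 + 2 * noise_level T J \<beta> \<eta>)"
    by (intro mult_left_mono le) simp
  also have "\<dots> = ennreal (2 / S.al * (initial_gap x0 y0 v0 + 2 * noise_level T J \<beta> \<eta>))"
    using al nn by (intro ennreal_mult[symmetric]) simp_all
  finally show "(\<Sum>i<q * q. \<integral>\<^sup>+ w. ennreal ((norm (gradPhi (x i w)))\<^sup>2) \<partial>Q)
      \<le> ennreal (2 / S.al * (initial_gap x0 y0 v0 + 2 * noise_level T J \<beta> \<eta>))" .
qed

end

section \<open>The random output index and the orders in \<epsilon>\<close>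

text \<open>Fubini over the uniform index turns the sum into \<open>K\<close> times the mean;
  finiteness of the nonnegative integral yields the integrability that \<open>mean_le\<close>
  demands.\<close>

lemma eps_stationary_uniform_index:
  fixes x :: "nat \<Rightarrow> 'w \<Rightarrow> 'a::real_inner"
  assumes \<P>: "prob_space \<P>" and meas: "\<And>k. (\<lambda>\<omega>. (norm (grad \<phi> (x k \<omega>)))\<^sup>2) \<in> borel_measurable \<P>"
    and le: "(\<Sum>k<K. \<integral>\<^sup>+ \<omega>. ennreal ((norm (grad \<phi> (x k \<omega>)))\<^sup>2) \<partial>\<P>) \<le> ennreal B"
    and K: "0 < K" and B: "0 \<le> B" "B \<le> \<epsilon> * real K"
  shows "eps_stationary (output_space \<P> K) \<phi> (\<lambda>(\<omega>, k). x k \<omega>) \<epsilon>"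
proof -
  interpret P: prob_space \<P> by (rule \<P>)
  let ?U = "measure_pmf (pmf_of_set {..<K})"
  interpret U: prob_space ?U by (rule prob_space_measure_pmf)
  interpret PU: pair_sigma_finite \<P> ?U ..
  define h where "h = (\<lambda>p. (norm (grad \<phi> (x (snd p) (fst p))))\<^sup>2)"
  have "snd \<in> \<P> \<Otimes>\<^sub>M ?U \<rightarrow>\<^sub>M ?U" by (rule measurable_snd)
  also have "measurable (\<P> \<Otimes>\<^sub>M ?U) ?U = measurable (\<P> \<Otimes>\<^sub>M ?U) (count_space UNIV)"
    by (rule measurable_cong_sets) simp_all
  finally have h [measurable]: "h \<in> borel_measurable (\<P> \<Otimes>\<^sub>M ?U)"
    unfolding h_def
    by (rule measurable_compose_countable[where f = "\<lambda>k p. (norm (grad \<phi> (x k (fst p))))\<^sup>2", rotated])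
       (rule measurable_compose[OF measurable_fst meas])
  have "(\<integral>\<^sup>+ p. ennreal (h p) \<partial>(\<P> \<Otimes>\<^sub>M ?U)) = (\<integral>\<^sup>+ k. \<integral>\<^sup>+ \<omega>. ennreal (h (\<omega>, k)) \<partial>\<P> \<partial>?U)"
    by (subst PU.nn_integral_snd[symmetric]) auto
  also have "\<dots> = (\<Sum>k<K. \<integral>\<^sup>+ \<omega>. ennreal (h (\<omega>, k)) \<partial>\<P>) / real K"
    using K by (subst nn_integral_pmf_of_set) (auto simp: ennreal_of_nat_eq_real_of_nat)
  also have "\<dots> \<le> ennreal B / real K"
    using le by (intro divide_right_mono_ennreal) (simp add: h_def)
  also have "\<dots> = ennreal (B / real K)" using K B by (simp add: divide_ennreal)
  also have "\<dots> \<le> ennreal \<epsilon>" using K B by (intro ennreal_leI) (simp add: divide_le_eq)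
  finally have int: "(\<integral>\<^sup>+ p. ennreal (h p) \<partial>(\<P> \<Otimes>\<^sub>M ?U)) \<le> ennreal \<epsilon>" .
  have \<epsilon>: "0 \<le> \<epsilon>" using B K by (smt (verit) mult_neg_pos of_nat_0_less_iff)
  have h0: "0 \<le> h p" for p by (simp add: h_def)
  have i: "integrable (\<P> \<Otimes>\<^sub>M ?U) h"
    using int by (intro integrableI_nonneg) (auto simp: h0 le_less_trans[OF _ ennreal_less_top])
  then have "ennreal (integral\<^sup>L (\<P> \<Otimes>\<^sub>M ?U) h) \<le> ennreal \<epsilon>"
    using int by (simp add: nn_integral_eq_integral[OF i] h0)
  then have "integral\<^sup>L (\<P> \<Otimes>\<^sub>M ?U) h \<le> \<epsilon>" using \<epsilon> by simp
  then show ?thesis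
    using i by (simp add: eps_stationary_def mean_le_def output_space_def h_def case_prod_beta)
qed


text \<open>Rounding up costs at most 1, which is below \<open>\<epsilon> powr (-0.5)\<close> for
  \<open>\<epsilon> \<le> 1\<close>.\<close>

lemma nat_ceiling_sqrt_bounds:
  assumes "0 < b" "0 < \<epsilon>"
  shows "0 < nat \<lceil>sqrt (b / \<epsilon>)\<rceil>" "b \<le> \<epsilon> * real (nat \<lceil>sqrt (b / \<epsilon>)\<rceil> * nat \<lceil>sqrt (b / \<epsilon>)\<rceil>)"
    and "\<epsilon> \<le> 1 \<Longrightarrow> real (nat \<lceil>sqrt (b / \<epsilon>)\<rceil>) \<le> (sqrt b + 1) * \<epsilon> powr (-0.5)"
proof -
  let ?r = "sqrt (b / \<epsilon>)" and ?q = "nat \<lceil>sqrt (b / \<epsilon>)\<rceil>"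
  have r: "0 < ?r" using assms by simp
  then show "0 < ?q" by (simp only: zero_less_nat_eq zero_less_ceiling)
  have q: "?r \<le> real ?q" by linarith
  have "b / \<epsilon> = ?r * ?r" using assms by simp
  also have "\<dots> \<le> real ?q * real ?q" by (rule mult_mono[OF q q of_nat_0_le_iff less_imp_le[OF r]])
  finally show "b \<le> \<epsilon> * real (?q * ?q)" using assms by (simp add: field_simps)
  assume "\<epsilon> \<le> 1"
  have p: "\<epsilon> powr (-0.5) = 1 / sqrt \<epsilon>" using assms by (simp add: powr_minus powr_half_sqrt inverse_eq_divide)
  have "real ?q \<le> ?r + 1" using r by linarith
  moreover have "?r = sqrt b * \<epsilon> powr (-0.5)" using p by (simp add: real_sqrt_divide)
  moreover have "1 \<le> \<epsilon> powr (-0.5)" using \<open>\<epsilon> \<le> 1\<close> assms p by simp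
  ultimately show "real ?q \<le> (sqrt b + 1) * \<epsilon> powr (-0.5)"
    unfolding distrib_right mult_1 by linarith
qed

lemma bigo_at_right_powr:
  fixes h :: "real \<Rightarrow> real"
  assumes "\<And>\<epsilon>. 0 < \<epsilon> \<Longrightarrow> \<epsilon> \<le> 1 \<Longrightarrow> 0 \<le> h \<epsilon> \<and> h \<epsilon> \<le> C * \<epsilon> powr a"
  shows "h \<in> O[at_right 0](\<lambda>\<epsilon>. \<epsilon> powr a)"
proof (rule bigoI[where c = C])
  show "\<forall>\<^sub>F \<epsilon> in at_right 0. norm (h \<epsilon>) \<le> C * norm (\<epsilon> powr a)"
    by (rule eventually_at_rightI[of 0 1]) (use assms in auto)
qed

theorem corollary1:
  fixes f g :: "(real^'p) \<times> (real^'q) \<Rightarrow> real"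
    and F :: "'xi \<Rightarrow> (real^'p) \<times> (real^'q) \<Rightarrow> real"
    and G :: "'zeta \<Rightarrow> (real^'p) \<times> (real^'q) \<Rightarrow> real"
    and P\<xi> :: "'xi measure" and P\<zeta> :: "'zeta measure"
    and \<P> :: "'w measure"
    and s :: "draw \<Rightarrow> nat \<Rightarrow> 'w \<Rightarrow> 'xi \<times> 'zeta"
    and c :: problem_consts
    and M \<beta> \<eta> :: real and T J :: nat
    and x0 :: "real^'p" and y0 v0 :: "real^'q"
  assumes "stochastic_objectives P\<xi> P\<zeta> f g F G"
    and "assumption_A1 c P\<xi> P\<zeta> f g F G"
    and "assumption_A2 c f g"
    and "assumption_A3 c P\<xi> P\<zeta> f g F G"
    and "assumption_A4 c P\<xi> P\<zeta> F G"
    and "fresh_samples \<P> P\<xi> P\<zeta> s"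
    and "M \<ge> c_f c / c_mu c"
    and "T > 0" and "J > 0"
    and "0 < \<beta>" and "\<beta> < 1" and "0 < \<eta>" and "\<eta> < 1"
    and "v0 \<in> cball 0 M"
  shows "\<exists>K S1 S2 q1 N :: real \<Rightarrow> nat.
    (\<lambda>\<epsilon>. real (K \<epsilon>)) \<in> O[at_right 0](\<lambda>\<epsilon>. \<epsilon> powr (-1)) \<and>
    (\<lambda>\<epsilon>. real (S1 \<epsilon>)) \<in> O[at_right 0](\<lambda>\<epsilon>. \<epsilon> powr (-1)) \<and>
    (\<lambda>\<epsilon>. real (S2 \<epsilon>)) \<in> O[at_right 0](\<lambda>\<epsilon>. \<epsilon> powr (-0.5)) \<and>
    (\<lambda>\<epsilon>. real (N \<epsilon>)) \<in> O[at_right 0](\<lambda>\<epsilon>. \<epsilon> powr (-1.5)) \<and>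
    (\<forall>\<epsilon>>0.
      K \<epsilon> > 0 \<and> S1 \<epsilon> > 0 \<and> S2 \<epsilon> > 0 \<and> S2 \<epsilon> = q1 \<epsilon> \<and> real (q1 \<epsilon>) = sqrt (real (S1 \<epsilon>)) \<and>
      (let P = als_spider c M T J \<beta> \<eta> (q1 \<epsilon>) (S1 \<epsilon>) (S2 \<epsilon>)
       in eps_stationary (output_space \<P> (K \<epsilon>)) (Phi f g) (alg_output P F G x0 y0 v0 s) \<epsilon> \<and>
          (\<forall>\<omega>\<in>space \<P>. st_calls (alg_run P F G x0 y0 v0 (\<lambda>d i. s d i \<omega>) (K \<epsilon>)) = N \<epsilon>)))"
proof -
  interpret \<P>: prob_space \<P> using assms(6) by (simp add: fresh_samples_def)
  let ?Z = "P\<xi> \<Otimes>\<^sub>M P\<zeta>"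
  define X where "X = (\<lambda>(d, i). s d i)"
  define N where "N j = distr \<P> ?Z (X j)" for j
  \<comment> \<open>Collects all samples into one point of the product space on which the run was
    analysed.\<close>
  define W where "W \<omega> = (\<lambda>j. X j \<omega>)" for \<omega>
  have indep: "\<P>.indep_vars (\<lambda>_. ?Z) X UNIV"
    and marg: "\<And>d i. distr \<P> P\<xi> (fst \<circ> s d i) = P\<xi>" "\<And>d i. distr \<P> P\<zeta> (snd \<circ> s d i) = P\<zeta>"
    using assms(6) by (auto simp: fresh_samples_def X_def)
  have X [measurable]: "X j \<in> \<P> \<rightarrow>\<^sub>M ?Z" for j
    using indep unfolding \<P>.indep_vars_def2 by blast
  have N_marg: "distr (N j) P\<xi> fst = P\<xi>" "distr (N j) P\<zeta> snd = P\<zeta>" for j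
    using marg[of "fst j" "snd j"] by (simp_all add: N_def distr_distr) (simp_all add: X_def case_prod_beta)
  have prob_N: "prob_space (N j)" for j unfolding N_def by (rule \<P>.prob_space_distr) (rule X)
  have "bilevel c f g M"
    using assms by unfold_locales (auto simp: assumption_A1_def assumption_A2_def)
  then interpret S: stochastic_bilevel c f g M P\<xi> P\<zeta> F G N
    by (rule stochastic_bilevel.intro, intro stochastic_bilevel_axioms.intro prob_N N_marg)
       (use assms in \<open>auto simp: assumption_A1_def N_def\<close>)
  \<comment> \<open>Independence in the form of a product joint law; it carries the expectations on
    the product space back to the given sample space.\<close>
  have law: "distr \<P> (PiM UNIV (\<lambda>_. ?Z)) W = S.Q"
  proof -
    have "W = (\<lambda>\<omega>. \<lambda>j\<in>UNIV. X j \<omega>)" "N = (\<lambda>j. distr \<P> ?Z (X j))"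
      by (simp_all add: W_def N_def fun_eq_iff)
    then show ?thesis
      using indep \<P>.indep_vars_iff_distr_eq_PiM[where I = UNIV and M' = "\<lambda>_. ?Z" and X = X] X by simp
  qed
  have W [measurable]: "W \<in> \<P> \<rightarrow>\<^sub>M S.Q"
  proof -
    have "W \<in> \<P> \<rightarrow>\<^sub>M PiM UNIV (\<lambda>_. ?Z)"
      unfolding W_def by (rule measurable_PiM_single') (use measurable_space[OF X] in \<open>auto simp: space_PiM\<close>)
    moreover have "sets S.Q = sets (PiM UNIV (\<lambda>_. ?Z))" by (simp flip: law)
    ultimately show ?thesis using measurable_cong_sets[OF refl] by blast
  qed
  have transfer: "(\<integral>\<^sup>+ \<omega>. h (W \<omega>) \<partial>\<P>) = (\<integral>\<^sup>+ w. h w \<partial>S.Q)" if "h \<in> borel_measurable S.Q" for h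
  proof -
    have "distr \<P> S.Q W = S.Q"
      using law distr_cong[of \<P> \<P> S.Q "PiM UNIV (\<lambda>_. ?Z)" W W] by (metis sets_distr)
    then show ?thesis using nn_integral_distr[OF W, of h] that by simp
  qed
  have samp_W: "samp (W \<omega>) = (\<lambda>d i. s d i \<omega>)" for \<omega> by (simp add: samp_def W_def X_def)
  have v0: "norm v0 \<le> M" using assms(14) by simp
  note run = S.spider_run[OF assms(8,9,10,11,12,13) v0]
  define B where "B = 2 / spider_alpha c M T J \<beta> \<eta> 1 * (S.initial_gap x0 y0 v0 + 2 * S.noise_level T J \<beta> \<eta>)"
  have B: "0 \<le> B" using run(4,5)[of 1] by (simp add: B_def del: times_divide_eq_left)
  \<comment> \<open>\<open>B\<close> does not depend on \<epsilon>; adding 1 keeps the number of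
    iterations positive when \<open>B\<close> is 0.\<close>
  define q where "q \<epsilon> = nat \<lceil>sqrt ((B + 1) / \<epsilon>)\<rceil>" for \<epsilon>
  have q_pos: "0 < q \<epsilon>" and q_ge: "B + 1 \<le> \<epsilon> * real (q \<epsilon> * q \<epsilon>)" if "0 < \<epsilon>" for \<epsilon>
    using nat_ceiling_sqrt_bounds[of "B + 1" \<epsilon>] B that by (simp_all add: q_def)
  define C where "C = sqrt (B + 1) + 1"
  have C: "0 \<le> C" using B by (simp add: C_def)
  have q_le: "real (q \<epsilon>) \<le> C * \<epsilon> powr (-0.5)" if "0 < \<epsilon>" "\<epsilon> \<le> 1" for \<epsilon>
    using nat_ceiling_sqrt_bounds(3)[of "B + 1" \<epsilon>] B that by (simp add: q_def C_def)
  have q_power_le: "real (q \<epsilon>) ^ n \<le> C ^ n * \<epsilon> powr (- 0.5 * real n)" if "0 < \<epsilon>" "\<epsilon> \<le> 1" for \<epsilon> n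
  proof -
    have "real (q \<epsilon>) ^ n \<le> (C * \<epsilon> powr (-0.5)) ^ n" using q_le[OF that] by (intro power_mono) auto
    also have "\<dots> = C ^ n * \<epsilon> powr (- 0.5 * real n)"
      using that by (simp add: power_mult_distrib powr_power)
    finally show ?thesis .
  qed
  define D where "D = 5 + 2 * T + 8 * J"
  have O2: "(\<lambda>\<epsilon>. real (q \<epsilon> * q \<epsilon>)) \<in> O[at_right 0](\<lambda>\<epsilon>. \<epsilon> powr (-1))"
    by (rule bigo_at_right_powr[where C = "C ^ 2"])
       (use q_power_le[of _ 2] in \<open>simp add: power2_eq_square\<close>)
  have O1: "(\<lambda>\<epsilon>. real (q \<epsilon>)) \<in> O[at_right 0](\<lambda>\<epsilon>. \<epsilon> powr (-0.5))"
    by (rule bigo_at_right_powr[where C = C]) (use q_le in simp)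
  have O3: "(\<lambda>\<epsilon>. real (q \<epsilon> ^ 3 * D)) \<in> O[at_right 0](\<lambda>\<epsilon>. \<epsilon> powr (-1.5))"
  proof (rule bigo_at_right_powr[where C = "C ^ 3 * real D"])
    fix \<epsilon> :: real assume "0 < \<epsilon>" "\<epsilon> \<le> 1"
    from mult_right_mono[OF q_power_le[OF this, of 3], of "real D"]
    show "0 \<le> real (q \<epsilon> ^ 3 * D) \<and> real (q \<epsilon> ^ 3 * D) \<le> C ^ 3 * real D * \<epsilon> powr (-1.5)"
      by (simp add: mult_ac)
  qed
  have main: "q \<epsilon> * q \<epsilon> > 0 \<and> q \<epsilon> * q \<epsilon> > 0 \<and> q \<epsilon> > 0 \<and> q \<epsilon> = q \<epsilon> \<and> real (q \<epsilon>) = sqrt (real (q \<epsilon> * q \<epsilon>)) \<and>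
      (let P = als_spider c M T J \<beta> \<eta> (q \<epsilon>) (q \<epsilon> * q \<epsilon>) (q \<epsilon>)
       in eps_stationary (output_space \<P> (q \<epsilon> * q \<epsilon>)) (Phi f g) (alg_output P F G x0 y0 v0 s) \<epsilon> \<and>
          (\<forall>\<omega>\<in>space \<P>. st_calls (alg_run P F G x0 y0 v0 (\<lambda>d i. s d i \<omega>) (q \<epsilon> * q \<epsilon>)) = q \<epsilon> ^ 3 * D))"
    if \<epsilon>: "0 < \<epsilon>" for \<epsilon>
  proof -
    let ?P = "als_spider c M T J \<beta> \<eta> (q \<epsilon>) (q \<epsilon> * q \<epsilon>) (q \<epsilon>)"
    note run = run[OF q_pos[OF \<epsilon>]]
    define x where "x k w = st_x (alg_run ?P F G x0 y0 v0 (samp w) k)" for k w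
    have x [measurable]: "x k \<in> borel_measurable S.Q" for k unfolding x_def[abs_def] by (rule run(2))
    have "(\<Sum>k<q \<epsilon> * q \<epsilon>. \<integral>\<^sup>+ \<omega>. ennreal ((norm (grad (Phi f g) (x k (W \<omega>))))\<^sup>2) \<partial>\<P>) \<le> ennreal B"
    proof -
      have "(\<integral>\<^sup>+ \<omega>. ennreal ((norm (grad (Phi f g) (x k (W \<omega>))))\<^sup>2) \<partial>\<P>)
          = (\<integral>\<^sup>+ w. ennreal ((norm (S.gradPhi (x k w)))\<^sup>2) \<partial>S.Q)" for k
        unfolding S.grad_Phi by (rule transfer) measurable
      then show ?thesis using run(1) by (simp add: x_def B_def)
    qed
    moreover have "(\<lambda>\<omega>. (norm (grad (Phi f g) (x k (W \<omega>))))\<^sup>2) \<in> borel_measurable \<P>" for k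
      unfolding S.grad_Phi by measurable
    moreover have "0 < q \<epsilon> * q \<epsilon>" using q_pos[OF \<epsilon>] by simp
    moreover have "B \<le> \<epsilon> * real (q \<epsilon> * q \<epsilon>)" using q_ge[OF \<epsilon>] by simp
    ultimately have "eps_stationary (output_space \<P> (q \<epsilon> * q \<epsilon>)) (Phi f g) (\<lambda>(\<omega>, k). x k (W \<omega>)) \<epsilon>"
      using B by (intro eps_stationary_uniform_index[where B = B] \<P>.prob_space_axioms)
    moreover have "(\<lambda>(\<omega>, k). x k (W \<omega>)) = alg_output ?P F G x0 y0 v0 s"
      by (simp add: alg_output_def x_def samp_W)
    moreover have "st_calls (alg_run ?P F G x0 y0 v0 (\<lambda>d i. s d i \<omega>) (q \<epsilon> * q \<epsilon>)) = q \<epsilon> ^ 3 * D" for \<omega>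
      using run(3)[of x0 y0 "W \<omega>"] by (simp add: samp_W D_def)
    ultimately show ?thesis using q_pos[OF \<epsilon>] by (simp add: Let_def)
  qed
  show ?thesis
    by (rule exI[of _ "\<lambda>\<epsilon>. q \<epsilon> * q \<epsilon>"], rule exI[of _ "\<lambda>\<epsilon>. q \<epsilon> * q \<epsilon>"], rule exI[of _ q], rule exI[of _ q],
        rule exI[of _ "\<lambda>\<epsilon>. q \<epsilon> ^ 3 * D"], intro conjI O1 O2 O3 allI impI main)
qed

end
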